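(* Let $h$ be the Klein metric on the unit disk $\mathbb{D}^2=\{(x,y)\in\mathbb{R}^2:x^2+y^2<1\}$, i.e. the Riemannian metric with $$h(\mathbf y,\mathbf y)=\frac{(u^2+v^2)-(xv-yu)^2}{(1-x^2-y^2)^2},\qquad \mathbf y=u\frac{\partial}{\partial x}+v\frac{\partial}{\partial y}\in T_{(x,y)}\mathbb{D}^2,$$ and let $\mathbf{v}$ be the vector field on $\mathbb{D}^2$ given by $\mathbf{v}_p=(-y,x)$ at $p=(x,y)$. Let $\epsilon\in\mathbb{R}$, let $\rho=1/\sqrt{1+\epsilon^2}$, and let $\mathbb{D}^2(\rho)=\{(x,y):x^2+y^2<\rho^2\}$. Let $F=\alpha+\beta$ be the Randers metric on $\mathbb{D}^2(\rho)$ given, for a tangent vector $\mathbf y$, by $$\alpha(\mathbf{y})=\frac{\sqrt{\epsilon^2h(\mathbf{v},\mathbf{y})^2+h(\mathbf{y},\mathbf{y})\left(1-\epsilon^2h(\mathbf{v},\mathbf{v})\right)}}{1-\epsilon^2h(\mathbf{v},\mathbf{v})},\qquad \beta(\mathbf{y})=-\frac{\epsilon\,h(\mathbf{v},\mathbf{y})}{1-\epsilon^2h(\mathbf{v},\mathbf{v})}.$$ Then: (a) $F$ has constant curvature $\mathbf{K}=-1$; (b) the S-curvature of $F$ vanishes, $\mathbf{S}=0$; (c) $F$ is not locally projectively flat if $\epsilon\neq0$; (d) the Gauss curvature $\bar{\mathbf{K}}$ of the Riemannian metric $\alpha$ is not constant unless $\epsilon=0$; when $\epsilon=0$, $\ba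r{\mathbf{K}}=-1$.
   Context: A Finsler metric on a manifold $M$ is a function $F:TM\to[0,\infty)$, smooth away from the zero section, positively homogeneous of degree one on each tangent space, such that in standard local coordinates $(x^i,y^i)$ of $TM$ the matrix $g_{ij}=\frac12[F^2]_{y^iy^j}$ is positive definite for $y\ne0$. A Randers metric is a Finsler metric $F=\alpha+\beta$, where $\alpha(\mathbf y)=\sqrt{a_{ij}(x)y^iy^j}$ is (the norm of) a Riemannian metric and $\beta(\mathbf y)=b_i(x)y^i$ is a 1-form with $\sup_{y\in T_xM\setminus\{0\}}\beta(y)/\alpha(y)<1$ at every $x$. With $(g^{ij})=(g_{ij})^{-1}$, the geodesic coefficients of $F$ are $$G^i=\tfrac14 g^{ik}\Big\{2\frac{\partial g_{pk}}{\partial x^q}-\frac{\partial g_{pq}}{\partial x^k}\Big\}y^py^q,$$ and geodesics satisfy $\frac{d^2x^i}{dt^2}+2G^i(x,\frac{dx}{dt})=0$. The Riemann curvature is $\mathbf{R}_{\mathbf y}=R^i_{\ k}\,dx^k\otimes\frac{\partial}{\partial x^i}$ with $$R^i_{\ k}=2\frac{\partial G^i}{\partial x^k}-y^j\frac{\partial^2G^i}{\partial x^j\partial y^k}+2G^j\frac{\partial^2G^i}{\partial y^j\partial y^k}-\frac{\partial G^i}{\partial y^j}\frac{\partial G^j}{\partial y^k}.$$ $F$ has constant (flag) curvature $\mathbf{K}=\lambda$ if $R^i_{\ k}=\lambda\{F^2\delta^i_k-FF_{y^k}y^i\}$. The Busemann–Hausdorff volume form of $F$ on an $n$-manifold is $dV_F=\sigma(x)\,dx^1\cdots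 dx^n$, where $\sigma(x)=\mathrm{Vol}(B^n(1))/\mathrm{Vol}\{(y^i)\in\mathbb{R}^n:F(x,y)<1\}$, with $\mathrm{Vol}$ Euclidean volume and $B^n(1)$ the Euclidean unit ball. The S-curvature is $$\mathbf{S}(\mathbf y)=\frac{\partial G^i}{\partial y^i}(x,y)-\frac{y^i}{\sigma(x)}\frac{\partial\sigma}{\partial x^i}(x).$$ $F$ is locally projectively flat if around every point there is a local coordinate system in which the geodesics of $F$ are straight lines as point sets, equivalently in which $G^i=Py^i$ for some scalar function $P(x,y)$. *)

theory Defs
  imports "HOL-Analysis.Analysis"
begin

text \<open>All manifolds here are open subsets of \<open>\<real>\<^sup>n\<close> (type \<open>real ^ 'n\<close>) with their standard
  coordinates. A function on the tangent bundle is written \<open>F x y\<close>, with \<open>x\<close> the base point and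
  \<open>y\<close> the tangent vector at \<open>x\<close>.\<close>

section \<open>Smoothness and partial derivatives\<close>

text \<open>To be used on open sets \<open>S\<close> only.\<close>

primrec Ck_on :: "nat \<Rightarrow> ('a::euclidean_space \<Rightarrow> 'b::real_normed_vector) \<Rightarrow> 'a set \<Rightarrow> bool" where
  "Ck_on 0 f S \<longleftrightarrow> continuous_on S f"
| "Ck_on (Suc k) f S \<longleftrightarrow>
     (\<forall>x\<in>S. f differentiable (at x)) \<and> (\<forall>v. Ck_on k (\<lambda>x. frechet_derivative f (at x) v) S)"

definition smooth_on :: "('a::euclidean_space \<Rightarrow> 'b::real_normed_vector) \<Rightarrow> 'a set \<Rightarrow> bool" where
  "smooth_on f S \<longleftrightarrow> (\<forall>k. Ck_on k f S)"

definition partial_deriv :: "'n::finite \<Rightarrow> (real ^ 'n \<Rightarrow> real) \<Rightarrow> real ^ 'n \<Rightarrow> real" where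
  "partial_deriv i f x = deriv (\<lambda>t. f (x + t *\<^sub>R axis i 1)) 0"

section \<open>Finsler metrics\<close>

definition fundamental_tensor ::
    "(real ^ 'n \<Rightarrow> real ^ 'n \<Rightarrow> real) \<Rightarrow> real ^ 'n \<Rightarrow> real ^ 'n \<Rightarrow> real ^ 'n ^ 'n::finite" where
  "fundamental_tensor F x y =
     (\<chi> i j. 1/2 * partial_deriv j (partial_deriv i (\<lambda>z. (F x z)\<^sup>2)) y)"

definition finsler_metric_on ::
    "(real ^ 'n) set \<Rightarrow> (real ^ 'n \<Rightarrow> real ^ 'n::finite \<Rightarrow> real) \<Rightarrow> bool" where
  "finsler_metric_on U F \<longleftrightarrow>
     (\<forall>x\<in>U. \<forall>y. F x y \<ge> 0) \<and>
     smooth_on (\<lambda>(x, y). F x y) (U \<times> (- {0})) \<and>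
     (\<forall>x\<in>U. \<forall>y. \<forall>c>0. F x (c *\<^sub>R y) = c * F x y) \<and>
     (\<forall>x\<in>U. \<forall>y. y \<noteq> 0 \<longrightarrow> (\<forall>w. w \<noteq> 0 \<longrightarrow> w \<bullet> (fundamental_tensor F x y *v w) > 0))"

text \<open>\<open>\<alpha>\<close> is the norm of a Riemannian metric \<open>a\<^sub>i\<^sub>j\<close>, and \<open>\<beta>\<close> is a 1-form \<open>b\<^sub>i\<close>.\<close>

definition riemannian_norm_on ::
    "(real ^ 'n) set \<Rightarrow> (real ^ 'n \<Rightarrow> real ^ 'n::finite \<Rightarrow> real) \<Rightarrow> bool" where
  "riemannian_norm_on U \<alpha> \<longleftrightarrow>
     (\<exists>a :: real ^ 'n \<Rightarrow> real ^ 'n ^ 'n.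
        (\<forall>i j. smooth_on (\<lambda>x. a x $ i $ j) U) \<and>
        (\<forall>x\<in>U. transpose (a x) = a x \<and>
                (\<forall>y. y \<noteq> 0 \<longrightarrow> y \<bullet> (a x *v y) > 0) \<and>
                (\<forall>y. \<alpha> x y = sqrt (y \<bullet> (a x *v y)))))"

definition one_form_on ::
    "(real ^ 'n) set \<Rightarrow> (real ^ 'n \<Rightarrow> real ^ 'n::finite \<Rightarrow> real) \<Rightarrow> bool" where
  "one_form_on U \<beta> \<longleftrightarrow>
     (\<exists>b :: real ^ 'n \<Rightarrow> real ^ 'n. smooth_on b U \<and> (\<forall>x\<in>U. \<forall>y. \<beta> x y = b x \<bullet> y))"

text \<open>For \<open>\<alpha>\<close> a Riemannian norm and \<open>\<beta>\<close> a 1-form the quotient \<open>\<beta>/\<alpha>\<close> is bounded on each tangent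
  space, so the real-valued supremum is the true one.\<close>

definition randers_metric_on ::
    "(real ^ 'n) set \<Rightarrow> (real ^ 'n \<Rightarrow> real ^ 'n \<Rightarrow> real) \<Rightarrow> (real ^ 'n \<Rightarrow> real ^ 'n::finite \<Rightarrow> real)
      \<Rightarrow> bool" where
  "randers_metric_on U \<alpha> \<beta> \<longleftrightarrow>
     riemannian_norm_on U \<alpha> \<and> one_form_on U \<beta> \<and>
     (\<forall>x\<in>U. (SUP y\<in>- {0}. \<beta> x y / \<alpha> x y) < 1) \<and>
     finsler_metric_on U (\<lambda>x y. \<alpha> x y + \<beta> x y)"

text \<open>The geodesic coefficients, collected into the vector \<open>(G\<^sup>i)\<close>.\<close>

definition geodesic_coeff ::
    "(real ^ 'n \<Rightarrow> real ^ 'n \<Rightarrow> real) \<Rightarrow> real ^ 'n \<Rightarrow> real ^ 'n \<Rightarrow> real ^ 'n::finite" where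
  "geodesic_coeff F x y =
     (\<chi> i. 1/4 * (\<Sum>k\<in>UNIV. \<Sum>p\<in>UNIV. \<Sum>q\<in>UNIV.
        matrix_inv (fundamental_tensor F x y) $ i $ k *
        (2 * partial_deriv q (\<lambda>z. fundamental_tensor F z y $ p $ k) x
           - partial_deriv k (\<lambda>z. fundamental_tensor F z y $ p $ q) x) * y $ p * y $ q))"

text \<open>The component \<open>R\<^sup>i\<^sub>k\<close> of the Riemann curvature at \<open>(x, y)\<close>.\<close>

definition riemann_curvature ::
    "(real ^ 'n \<Rightarrow> real ^ 'n \<Rightarrow> real) \<Rightarrow> 'n::finite \<Rightarrow> 'n \<Rightarrow> real ^ 'n \<Rightarrow> real ^ 'n \<Rightarrow> real" where
  "riemann_curvature F i k x y =
     (let G = (\<lambda>i x y. geodesic_coeff F x y $ i) in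
        2 * partial_deriv k (\<lambda>z. G i z y) x
        - (\<Sum>j\<in>UNIV. y $ j * partial_deriv j (\<lambda>z. partial_deriv k (G i z) y) x)
        + 2 * (\<Sum>j\<in>UNIV. G j x y * partial_deriv j (partial_deriv k (G i x)) y)
        - (\<Sum>j\<in>UNIV. partial_deriv j (G i x) y * partial_deriv k (G j x) y))"

definition has_constant_curvature_on ::
    "(real ^ 'n) set \<Rightarrow> (real ^ 'n \<Rightarrow> real ^ 'n::finite \<Rightarrow> real) \<Rightarrow> real \<Rightarrow> bool" where
  "has_constant_curvature_on U F c \<longleftrightarrow>
     (\<forall>x\<in>U. \<forall>y. y \<noteq> 0 \<longrightarrow> (\<forall>i k.
        riemann_curvature F i k x y =
          c * ((F x y)\<^sup>2 * (if i = k then 1 else 0) - F x y * partial_deriv k (F x) y * y $ i)))"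

text \<open>The density \<open>\<sigma>\<close> of the Busemann--Hausdorff volume form, and the S-curvature.\<close>

definition bh_density :: "(real ^ 'n \<Rightarrow> real ^ 'n::finite \<Rightarrow> real) \<Rightarrow> real ^ 'n \<Rightarrow> real" where
  "bh_density F x =
     measure lebesgue (ball (0 :: real ^ 'n) 1) / measure lebesgue {y. F x y < 1}"

definition s_curvature ::
    "(real ^ 'n \<Rightarrow> real ^ 'n::finite \<Rightarrow> real) \<Rightarrow> real ^ 'n \<Rightarrow> real ^ 'n \<Rightarrow> real" where
  "s_curvature F x y =
     (\<Sum>i\<in>UNIV. partial_deriv i (\<lambda>z. geodesic_coeff F x z $ i) y)
     - (\<Sum>i\<in>UNIV. y $ i / bh_density F x * partial_deriv i (bh_density F) x)"

text \<open>Geodesics are taken to be regular curves: \<open>F\<close> need not be differentiable on the zero section,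
  so the geodesic equation is meaningful only where the velocity does not vanish.\<close>

definition geodesic_on ::
    "(real ^ 'n \<Rightarrow> real ^ 'n \<Rightarrow> real) \<Rightarrow> real set \<Rightarrow> (real \<Rightarrow> real ^ 'n::finite) \<Rightarrow> bool" where
  "geodesic_on F I c \<longleftrightarrow>
     (\<exists>c'. \<forall>t\<in>I. (c has_vector_derivative c' t) (at t) \<and> c' t \<noteq> 0 \<and>
        (c' has_vector_derivative (- 2 *\<^sub>R geodesic_coeff F (c t) (c' t))) (at t))"

definition coordinate_system_on ::
    "(real ^ 'n) set \<Rightarrow> (real ^ 'n \<Rightarrow> real ^ 'n::finite) \<Rightarrow> bool" where
  "coordinate_system_on W \<phi> \<longleftrightarrow>
     open W \<and> smooth_on \<phi> W \<and> open (\<phi> ` W) \<and>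
     (\<exists>\<psi>. smooth_on \<psi> (\<phi> ` W) \<and> (\<forall>x\<in>W. \<psi> (\<phi> x) = x))"

text \<open>A connected subset of a straight line is a segment, so a regular curve is straight as a point
  set precisely when its image is collinear.\<close>

definition locally_projectively_flat_on ::
    "(real ^ 'n) set \<Rightarrow> (real ^ 'n \<Rightarrow> real ^ 'n::finite \<Rightarrow> real) \<Rightarrow> bool" where
  "locally_projectively_flat_on U F \<longleftrightarrow>
     (\<forall>x\<in>U. \<exists>W \<phi>. x \<in> W \<and> W \<subseteq> U \<and> coordinate_system_on W \<phi> \<and>
        (\<forall>I c. open I \<and> is_interval I \<and> c ` I \<subseteq> W \<and> geodesic_on F I c \<longrightarrow>
           collinear (\<phi> ` c ` I)))"

section \<open>Gauss curvature of a Riemannian metric in dimension two\<close>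

text \<open>The coefficients \<open>a\<^sub>i\<^sub>j\<close> of the Riemannian metric with norm \<open>\<alpha>\<close>, recovered by polarization.\<close>

definition metric_coeff ::
    "(real ^ 'n \<Rightarrow> real ^ 'n \<Rightarrow> real) \<Rightarrow> real ^ 'n \<Rightarrow> real ^ 'n ^ 'n::finite" where
  "metric_coeff \<alpha> x =
     (\<chi> i j. ((\<alpha> x (axis i 1 + axis j 1))\<^sup>2 - (\<alpha> x (axis i 1 - axis j 1))\<^sup>2) / 4)"

text \<open>The Christoffel symbol \<open>\<Gamma>\<^sup>k\<^sub>i\<^sub>j\<close> is \<open>christoffel \<alpha> k i j\<close>.\<close>

definition christoffel ::
    "(real ^ 'n \<Rightarrow> real ^ 'n \<Rightarrow> real) \<Rightarrow> 'n::finite \<Rightarrow> 'n \<Rightarrow> 'n \<Rightarrow> real ^ 'n \<Rightarrow> real" where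
  "christoffel \<alpha> k i j x =
     1/2 * (\<Sum>l\<in>UNIV. matrix_inv (metric_coeff \<alpha> x) $ k $ l *
        (partial_deriv i (\<lambda>z. metric_coeff \<alpha> z $ j $ l) x
         + partial_deriv j (\<lambda>z. metric_coeff \<alpha> z $ i $ l) x
         - partial_deriv l (\<lambda>z. metric_coeff \<alpha> z $ i $ j) x))"

text \<open>\<open>K = \<langle>R(\<partial>\<^sub>1, \<partial>\<^sub>2)\<partial>\<^sub>2, \<partial>\<^sub>1\<rangle> / det a\<close> with \<open>R(X, Y)Z = \<nabla>\<^sub>X\<nabla>\<^sub>YZ - \<nabla>\<^sub>Y\<nabla>\<^sub>XZ - \<nabla>\<^bsub>[X, Y]\<^esub>Z\<close>.\<close>

definition gauss_curvature :: "(real ^ 2 \<Rightarrow> real ^ 2 \<Rightarrow> real) \<Rightarrow> real ^ 2 \<Rightarrow> real" where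
  "gauss_curvature \<alpha> x =
     (\<Sum>m\<in>UNIV. metric_coeff \<alpha> x $ m $ 1 *
        (partial_deriv 1 (christoffel \<alpha> m 2 2) x - partial_deriv 2 (christoffel \<alpha> m 1 2) x
         + (\<Sum>l\<in>UNIV. christoffel \<alpha> l 2 2 x * christoffel \<alpha> m 1 l x
                      - christoffel \<alpha> l 1 2 x * christoffel \<alpha> m 2 l x)))
     / det (metric_coeff \<alpha> x)"

section \<open>The Klein metric and the Randers metric built from it\<close>

text \<open>The bilinear form \<open>h(u, w)\<close> at \<open>p\<close>, in polarized form.\<close>

definition klein :: "real ^ 2 \<Rightarrow> real ^ 2 \<Rightarrow> real ^ 2 \<Rightarrow> real" where
  "klein p u w =
     (u $ 1 * w $ 1 + u $ 2 * w $ 2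
       - (p $ 1 * u $ 2 - p $ 2 * u $ 1) * (p $ 1 * w $ 2 - p $ 2 * w $ 1))
     / (1 - (p $ 1)\<^sup>2 - (p $ 2)\<^sup>2)\<^sup>2"

lemma klein_sym_bilinear: "klein p u w = klein p w u" "bilinear (klein p)"
  by (auto simp: klein_def bilinear_def algebra_simps diff_divide_distrib add_divide_distrib
           intro!: linearI)

lemma klein_diag:
  "klein p y y = (((y $ 1)\<^sup>2 + (y $ 2)\<^sup>2) - (p $ 1 * y $ 2 - p $ 2 * y $ 1)\<^sup>2)
     / (1 - (p $ 1)\<^sup>2 - (p $ 2)\<^sup>2)\<^sup>2"
  by (simp add: klein_def power2_eq_square)

definition rotation_field :: "real ^ 2 \<Rightarrow> real ^ 2" where
  "rotation_field p = vector [- (p $ 2), p $ 1]"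

definition randers_alpha :: "real \<Rightarrow> real ^ 2 \<Rightarrow> real ^ 2 \<Rightarrow> real" where
  "randers_alpha \<epsilon> p y =
     (let v = rotation_field p in
        sqrt (\<epsilon>\<^sup>2 * (klein p v y)\<^sup>2 + klein p y y * (1 - \<epsilon>\<^sup>2 * klein p v v))
        / (1 - \<epsilon>\<^sup>2 * klein p v v))"

definition randers_beta :: "real \<Rightarrow> real ^ 2 \<Rightarrow> real ^ 2 \<Rightarrow> real" where
  "randers_beta \<epsilon> p y =
     (let v = rotation_field p in - (\<epsilon> * klein p v y / (1 - \<epsilon>\<^sup>2 * klein p v v)))"

end

theory Submission
  imports Defs
begin

text \<open>\<open>F\<close> solves Zermelo's navigation problem on the Klein disk with the Killing field \<open>\<epsilon> J x\<close> (\<open>J\<close> the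
  rotation by a right angle) as wind, so its geodesics are the Klein geodesics carried along by the
  rotation flow. This yields the explicit geodesic coefficients
  \<open>G = \<theta> y - \<epsilon> F (\<theta> J x + J y) - \<epsilon>\<^sup>2 F\<^sup>2 x / 2\<close> with \<open>\<theta> = \<langle>x, y\<rangle> / (1 - |x|\<^sup>2)\<close>, which are confirmed by the
  Euler--Lagrange equation of \<open>F\<close>. Since \<open>F\<close> is constant along its spray and \<open>F\<^bsub>y\<^sup>k\<^esub>\<close> has derivative
  \<open>F\<^bsub>x\<^sup>k\<^esub>\<close> along it, the curvature only involves first derivatives of \<open>F\<close>, and these are rational in
  \<open>x\<close>, \<open>y\<close>, \<open>F\<close>. The unit disks of \<open>F\<close> are translates of those of \<open>h\<close>, so both metrics have the same
  Busemann--Hausdorff volume.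

  \<open>F\<close> is not projectively flat at the origin: the geodesics issuing from it in two opposite directions
  are spirals with the same tangent and opposite curvature there, and no chart maps both into lines.\<close>

section \<open>Smooth functions\<close>

text \<open>The obstacle is the square root in F: differentiating it repeatedly and inverting the
  matrix g would leave unmanageable expressions. So F enters only through its quadratic equation
  h(\<eta>, \<eta>) = F^2 with \<eta> = y - \<epsilon> F J x. Implicit differentiation gives each
  first derivative of F with denominators D = 1 - |x|^2 and M, where M is a positive multiple of
  \<alpha>; cleared of D and M, the claims become polynomial identities in x, \<eta>, F and F_y.
  Second derivatives of F are avoided by two relations: F is constant along the spray, and F_{x^k} =
  (G^j)_{y^k} F_{y^j}. Differentiating the first in y^k and inserting the second gives the
  Euler-Lagrange equation, which identifies G without computing the inverse of g. Invertibility of g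
  comes from strong convexity, the one place where the Hessian of F itself is studied. The
  S-curvature vanishes because the part of (G^i)_{y^k} coming from F_y is trace free; what remains
  of the trace is 3 \<theta>, the derivative along y of log D^(-3/2), and D^(-3/2) is the volume
  density. The metric \<alpha> is not treated by navigation: rotational symmetry reduces its
  curvature to functions of |x|^2.\<close>

lemma Ck_on_cong:
  assumes "open S" and "\<And>x. x \<in> S \<Longrightarrow> f x = g x" and "Ck_on k f S"
  shows "Ck_on k g S"
  using assms(2,3)
proof (induction k arbitrary: f g)
  case 0
  then show ?case
    using continuous_on_cong[of S S f g] by simp
next
  case (Suc k)
  have "g differentiable (at x)" if "x \<in> S" for x
    using Suc.prems \<open>open S\<close> that
    by (metis Ck_on.simps(2) differentiable_def has_derivative_transform_within_open)
  moreover have "Ck_on k (\<lambda>x. frechet_derivative g (at x) v) S" for v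
  proof (rule Suc.IH)
    show "Ck_on k (\<lambda>x. frechet_derivative f (at x) v) S"
      using Suc.prems by simp
    show "frechet_derivative f (at x) v = frechet_derivative g (at x) v" if "x \<in> S" for x
      using Suc.prems frechet_derivative_transform_within_open[of f x S g] \<open>open S\<close> that by auto
  qed
  ultimately show ?case
    by simp
qed

text \<open>\<open>Ck_on\<close> speaks of \<open>frechet_derivative\<close>; this form accepts any
  explicit derivative, which is what the calculus rules deliver.\<close>

lemma Ck_on_SucI:
  assumes "open S" and "\<And>x. x \<in> S \<Longrightarrow> (f has_derivative f' x) (at x)"
    and "\<And>v. Ck_on k (\<lambda>x. f' x v) S"
  shows "Ck_on (Suc k) f S"
proof -
  have "f' x = frechet_derivative f (at x)" if "x \<in> S" for x
    using assms(2) that frechet_derivative_at by blast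
  then have "Ck_on k (\<lambda>x. frechet_derivative f (at x) v) S" for v
    by (intro Ck_on_cong[OF assms(1) _ assms(3)]) auto
  then show ?thesis
    using assms(2) by (auto simp: differentiable_def)
qed

lemma Ck_on_SucD:
  assumes "Ck_on (Suc k) f S"
  shows "x \<in> S \<Longrightarrow> (f has_derivative frechet_derivative f (at x)) (at x)"
    and "Ck_on k (\<lambda>x. frechet_derivative f (at x) v) S"
  using assms frechet_derivative_works by auto

lemma Ck_on_Suc_imp: "Ck_on (Suc k) f S \<Longrightarrow> Ck_on k f S"
proof (induction k arbitrary: f)
  case 0
  then show ?case
    by (auto intro!: continuous_at_imp_continuous_on differentiable_imp_continuous_within)
next
  case (Suc k)
  then show ?case
    by (metis Ck_on.simps(2))
qed

lemma Ck_on_const: "Ck_on k (\<lambda>x. c) S"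
  by (induction k arbitrary: c) auto

lemma Ck_on_bounded_linear:
  assumes "bounded_linear L"
  shows "Ck_on k L S"
proof (cases k)
  case 0
  then show ?thesis
    using assms by (simp add: linear_continuous_on)
next
  case (Suc m)
  have "frechet_derivative L (at x) = L" for x
    using assms bounded_linear_imp_has_derivative frechet_derivative_at by metis
  then show ?thesis
    using assms Suc by (simp add: Ck_on_const bounded_linear_imp_differentiable)
qed

lemma Ck_on_compose_bounded_linear:
  assumes "bounded_linear L" and "open S" and "Ck_on k f S"
  shows "Ck_on k (\<lambda>x. L (f x)) S"
  using assms(3)
proof (induction k arbitrary: f)
  case 0
  then show ?case
    using assms(1) by (simp add: bounded_linear.continuous_on)
next
  case (Suc k)
  show ?case
  proof (rule Ck_on_SucI[OF assms(2)])
    show "((\<lambda>x. L (f x)) has_derivative (\<lambda>v. L (frechet_derivative f (at x) v))) (at x)"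
      if "x \<in> S" for x
      using bounded_linear.has_derivative[OF assms(1)] Ck_on_SucD(1)[OF Suc.prems that] by blast
    show "Ck_on k (\<lambda>x. L (frechet_derivative f (at x) v)) S" for v
      by (rule Suc.IH[OF Ck_on_SucD(2)[OF Suc.prems]])
  qed
qed

lemma Ck_on_add:
  assumes "open S" and "Ck_on k f S" and "Ck_on k g S"
  shows "Ck_on k (\<lambda>x. f x + g x) S"
  using assms(2,3)
proof (induction k arbitrary: f g)
  case 0
  then show ?case
    by (simp add: continuous_on_add)
next
  case (Suc k)
  show ?case
    by (rule Ck_on_SucI[OF assms(1) has_derivative_add[OF Ck_on_SucD(1)[OF Suc.prems(1)]
          Ck_on_SucD(1)[OF Suc.prems(2)]]], assumption, assumption)
      (rule Suc.IH[OF Ck_on_SucD(2)[OF Suc.prems(1)] Ck_on_SucD(2)[OF Suc.prems(2)]])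
qed

lemma Ck_on_mult:
  fixes f g :: "'a::euclidean_space \<Rightarrow> real"
  assumes "open S" and "Ck_on k f S" and "Ck_on k g S"
  shows "Ck_on k (\<lambda>x. f x * g x) S"
  using assms(2,3)
proof (induction k arbitrary: f g)
  case 0
  then show ?case
    by (simp add: continuous_on_mult)
next
  case (Suc k)
  \<comment> \<open>The derivative f g' + f' g still contains the undifferentiated factors, hence
    the drop of f and g themselves from \<open>Suc k\<close> to \<open>k\<close>.\<close>
  show ?case
    by (rule Ck_on_SucI[OF assms(1) has_derivative_mult[OF Ck_on_SucD(1)[OF Suc.prems(1)]
          Ck_on_SucD(1)[OF Suc.prems(2)]]])
      (auto intro!: Ck_on_add[OF assms(1)] Suc.IH Ck_on_SucD(2) Suc.prems
        Ck_on_Suc_imp[OF Suc.prems(1)] Ck_on_Suc_imp[OF Suc.prems(2)])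
qed

text \<open>The derivative of 1/f is -f' times two copies of 1/f, so the claim for the same f one
  order lower suffices and the induction does not vary f.\<close>

lemma Ck_on_inverse:
  fixes f :: "'a::euclidean_space \<Rightarrow> real"
  assumes "open S" and "Ck_on k f S" and nz: "\<And>x. x \<in> S \<Longrightarrow> f x \<noteq> 0"
  shows "Ck_on k (\<lambda>x. inverse (f x)) S"
  using assms(2)
proof (induction k)
  case 0
  then show ?case
    using nz by (auto intro!: continuous_on_inverse)
next
  case (Suc k)
  have inv: "Ck_on k (\<lambda>x. inverse (f x)) S"
    by (rule Suc.IH[OF Ck_on_Suc_imp[OF Suc.prems]])
  show ?case
  proof (rule Ck_on_SucI[OF assms(1)])
    show "((\<lambda>x. inverse (f x)) has_derivative
        (\<lambda>v. (- 1) * (inverse (f x) * frechet_derivative f (at x) v * inverse (f x)))) (at x)"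
      if "x \<in> S" for x
      using Deriv.has_derivative_inverse[OF nz[OF that] Ck_on_SucD(1)[OF Suc.prems that]] by simp
    show "Ck_on k (\<lambda>x. (- 1) * (inverse (f x) * frechet_derivative f (at x) v * inverse (f x))) S"
      for v
      by (intro Ck_on_mult Ck_on_const assms(1) inv Ck_on_SucD(2)[OF Suc.prems])
  qed
qed

text \<open>As for the reciprocal: the derivative f' / (2 sqrt f) refers back to sqrt f one order
  lower.\<close>

lemma Ck_on_sqrt:
  fixes f :: "'a::euclidean_space \<Rightarrow> real"
  assumes "open S" and "Ck_on k f S" and pos: "\<And>x. x \<in> S \<Longrightarrow> f x > 0"
  shows "Ck_on k (\<lambda>x. sqrt (f x)) S"
  using assms(2)
proof (induction k)
  case 0
  then show ?case
    by (auto intro!: continuous_on_real_sqrt)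
next
  case (Suc k)
  have IH: "Ck_on k (\<lambda>x. sqrt (f x)) S"
    by (rule Suc.IH[OF Ck_on_Suc_imp[OF Suc.prems]])
  show ?case
  proof (rule Ck_on_SucI[OF assms(1)])
    show "((\<lambda>x. sqrt (f x)) has_derivative
        (\<lambda>v. frechet_derivative f (at x) v * (inverse (sqrt (f x)) * (1/2)))) (at x)"
      if "x \<in> S" for x
      using has_derivative_real_sqrt[OF pos[OF that] Ck_on_SucD(1)[OF Suc.prems that]]
      by (simp add: divide_simps)
    show "Ck_on k (\<lambda>x. frechet_derivative f (at x) v * (inverse (sqrt (f x)) * (1/2))) S" for v
      by (intro Ck_on_mult Ck_on_inverse Ck_on_const assms(1) IH Ck_on_SucD(2)[OF Suc.prems])
        (use pos in force)
  qed
qed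

lemma smooth_on_cong:
  "smooth_on f S \<Longrightarrow> open S \<Longrightarrow> (\<And>x. x \<in> S \<Longrightarrow> f x = g x) \<Longrightarrow> smooth_on g S"
  unfolding smooth_on_def by (blast intro: Ck_on_cong)

lemma smooth_on_const: "smooth_on (\<lambda>x. c) S"
  by (simp add: smooth_on_def Ck_on_const)

lemma smooth_on_bounded_linear: "bounded_linear L \<Longrightarrow> smooth_on L S"
  by (simp add: smooth_on_def Ck_on_bounded_linear)

lemma smooth_on_compose_bounded_linear:
  "bounded_linear L \<Longrightarrow> open S \<Longrightarrow> smooth_on f S \<Longrightarrow> smooth_on (\<lambda>x. L (f x)) S"
  by (simp add: smooth_on_def Ck_on_compose_bounded_linear)

lemma smooth_on_add:
  "open S \<Longrightarrow> smooth_on f S \<Longrightarrow> smooth_on g S \<Longrightarrow> smooth_on (\<lambda>x. f x + g x) S"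
  by (simp add: smooth_on_def Ck_on_add)

lemma smooth_on_mult:
  fixes f g :: "'a::euclidean_space \<Rightarrow> real"
  shows "open S \<Longrightarrow> smooth_on f S \<Longrightarrow> smooth_on g S \<Longrightarrow> smooth_on (\<lambda>x. f x * g x) S"
  by (simp add: smooth_on_def Ck_on_mult)

lemma smooth_on_nth: "smooth_on (\<lambda>x :: real ^ 'n::finite. x $ i) S"
  by (intro smooth_on_bounded_linear bounded_linear_vec_nth)

lemma smooth_on_fst_nth: "smooth_on (\<lambda>z :: (real ^ 'n::finite) \<times> (real ^ 'n). fst z $ i) S"
  by (intro smooth_on_bounded_linear bounded_linear_compose[OF bounded_linear_vec_nth bounded_linear_fst])

lemma smooth_on_snd_nth: "smooth_on (\<lambda>z :: (real ^ 'n::finite) \<times> (real ^ 'n). snd z $ i) S"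
  by (intro smooth_on_bounded_linear bounded_linear_compose[OF bounded_linear_vec_nth bounded_linear_snd])

lemma smooth_on_minus:
  fixes f :: "'a::euclidean_space \<Rightarrow> real"
  assumes "open S" "smooth_on f S"
  shows "smooth_on (\<lambda>x. - f x) S"
  using smooth_on_mult[OF assms(1) smooth_on_const[of "-1"] assms(2)] by simp

lemma smooth_on_diff:
  fixes f g :: "'a::euclidean_space \<Rightarrow> real"
  assumes "open S" "smooth_on f S" "smooth_on g S"
  shows "smooth_on (\<lambda>x. f x - g x) S"
  using smooth_on_add[OF assms(1,2) smooth_on_minus[OF assms(1,3)]] by simp

lemma smooth_on_divide:
  fixes f g :: "'a::euclidean_space \<Rightarrow> real"
  assumes "open S" "smooth_on f S" "smooth_on g S" "\<And>x. x \<in> S \<Longrightarrow> g x \<noteq> 0"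
  shows "smooth_on (\<lambda>x. f x / g x) S"
proof -
  have "smooth_on (\<lambda>x. inverse (g x)) S"
    using assms by (simp add: smooth_on_def Ck_on_inverse)
  then show ?thesis
    using smooth_on_mult[OF assms(1,2)] by (simp add: divide_inverse)
qed

lemma smooth_on_power:
  fixes f :: "'a::euclidean_space \<Rightarrow> real"
  assumes "open S" "smooth_on f S"
  shows "smooth_on (\<lambda>x. f x ^ n) S"
  by (induction n) (auto intro: smooth_on_const smooth_on_mult assms)

lemma smooth_on_sqrt:
  fixes f :: "'a::euclidean_space \<Rightarrow> real"
  shows "open S \<Longrightarrow> smooth_on f S \<Longrightarrow> (\<And>x. x \<in> S \<Longrightarrow> f x > 0) \<Longrightarrow> smooth_on (\<lambda>x. sqrt (f x)) S"
  by (simp add: smooth_on_def Ck_on_sqrt)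

lemmas smooth_on_intros = smooth_on_const smooth_on_add smooth_on_mult smooth_on_minus
  smooth_on_diff smooth_on_divide smooth_on_power smooth_on_sqrt

lemma smooth_on_frechet_derivative:
  "smooth_on f S \<Longrightarrow> smooth_on (\<lambda>x. frechet_derivative f (at x) v) S"
  unfolding smooth_on_def by (metis Ck_on.simps(2))

lemma smooth_on_has_derivative:
  "smooth_on f S \<Longrightarrow> x \<in> S \<Longrightarrow> (f has_derivative frechet_derivative f (at x)) (at x)"
  unfolding smooth_on_def by (meson Ck_on_SucD(1))

lemma smooth_on_continuous_on: "smooth_on f S \<Longrightarrow> continuous_on S f"
  unfolding smooth_on_def by (metis Ck_on.simps(1))

section \<open>Symmetry of second derivatives\<close>

lemma eventually_line_in_open:
  fixes z v :: "'a::real_normed_vector"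
  assumes "open T" "z \<in> T"
  shows "\<forall>\<^sub>F t in nhds 0. z + t *\<^sub>R v \<in> T"
proof -
  have "((\<lambda>t. z + t *\<^sub>R v) \<longlongrightarrow> z) (nhds 0)"
    by (rule tendsto_eq_intros refl filterlim_ident | simp)+
  with eventually_nhds_in_open[OF assms] show ?thesis
    by (rule eventually_compose_filterlim)
qed

lemma frechet_derivative_line:
  fixes f :: "'a::real_normed_vector \<Rightarrow> real"
  assumes "(f has_derivative f') (at (x + t *\<^sub>R v))"
  shows "((\<lambda>t. f (x + t *\<^sub>R v)) has_real_derivative f' v) (at t)"
proof -
  have "((\<lambda>t. x + t *\<^sub>R v) has_derivative (\<lambda>h. h *\<^sub>R v)) (at t)"
    by (auto intro!: derivative_eq_intros)
  from has_derivative_compose[OF this assms]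
  have "((\<lambda>t. f (x + t *\<^sub>R v)) has_derivative (\<lambda>h. f' (h *\<^sub>R v))) (at t)" .
  moreover have "f' (h *\<^sub>R v) = f' v * h" for h
    using linear_cmul[OF has_derivative_linear[OF assms]] by simp
  ultimately show ?thesis
    by (simp add: has_field_derivative_def)
qed

text \<open>Mean value theorem twice: in s for the difference of f across the parallelogram in
  direction v, then in t for the resulting difference of u-derivatives.\<close>

lemma second_difference_eq:
  fixes f :: "'a::euclidean_space \<Rightarrow> real"
  assumes f: "smooth_on f S" and h: "0 < h"
    and S: "\<And>s t. 0 \<le> s \<Longrightarrow> s \<le> h \<Longrightarrow> 0 \<le> t \<Longrightarrow> t \<le> h \<Longrightarrow> x + s *\<^sub>R u + t *\<^sub>R v \<in> S"
  obtains s t where "0 < s" "s < h" "0 < t" "t < h"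
    "f (x + h *\<^sub>R u + h *\<^sub>R v) - f (x + h *\<^sub>R u) - f (x + h *\<^sub>R v) + f x
      = h\<^sup>2 * frechet_derivative (\<lambda>z. frechet_derivative f (at z) u) (at (x + s *\<^sub>R u + t *\<^sub>R v)) v"
proof -
  define fu where "fu = (\<lambda>z. frechet_derivative f (at z) u)"
  have fu: "smooth_on fu S"
    unfolding fu_def by (rule smooth_on_frechet_derivative[OF f])
  have d1: "((\<lambda>s. f (x + s *\<^sub>R u + t *\<^sub>R v)) has_real_derivative fu (x + s *\<^sub>R u + t *\<^sub>R v)) (at s)"
    if "0 \<le> s" "s \<le> h" "0 \<le> t" "t \<le> h" for s t
    using frechet_derivative_line[of f _ "x + t *\<^sub>R v" s u] smooth_on_has_derivative[OF f S[OF that]]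
    unfolding fu_def by (simp add: algebra_simps)
  have d2: "((\<lambda>t. fu (x + s *\<^sub>R u + t *\<^sub>R v)) has_real_derivative
      frechet_derivative fu (at (x + s *\<^sub>R u + t *\<^sub>R v)) v) (at t)"
    if "0 \<le> s" "s \<le> h" "0 \<le> t" "t \<le> h" for s t
    using frechet_derivative_line[of fu _ "x + s *\<^sub>R u" t v] smooth_on_has_derivative[OF fu S[OF that]]
    by (simp add: algebra_simps)
  have d3: "((\<lambda>s. f (x + s *\<^sub>R u + h *\<^sub>R v) - f (x + s *\<^sub>R u + 0 *\<^sub>R v)) has_real_derivative
      fu (x + s *\<^sub>R u + h *\<^sub>R v) - fu (x + s *\<^sub>R u + 0 *\<^sub>R v)) (at s)" if "0 \<le> s" "s \<le> h" for s
    using h that by (intro DERIV_diff d1) auto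
  obtain s where s: "0 < s" "s < h"
    and s_eq: "(f (x + h *\<^sub>R u + h *\<^sub>R v) - f (x + h *\<^sub>R u + 0 *\<^sub>R v))
        - (f (x + 0 *\<^sub>R u + h *\<^sub>R v) - f (x + 0 *\<^sub>R u + 0 *\<^sub>R v))
      = (h - 0) * (fu (x + s *\<^sub>R u + h *\<^sub>R v) - fu (x + s *\<^sub>R u + 0 *\<^sub>R v))"
    using MVT2[OF h d3] by blast
  obtain t where t: "0 < t" "t < h"
    and t_eq: "fu (x + s *\<^sub>R u + h *\<^sub>R v) - fu (x + s *\<^sub>R u + 0 *\<^sub>R v)
      = (h - 0) * frechet_derivative fu (at (x + s *\<^sub>R u + t *\<^sub>R v)) v"
    using MVT2[OF h, of "\<lambda>t. fu (x + s *\<^sub>R u + t *\<^sub>R v)"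
        "\<lambda>t. frechet_derivative fu (at (x + s *\<^sub>R u + t *\<^sub>R v)) v"] s d2[of s] by auto
  show thesis
    using that[OF s t] s_eq t_eq by (simp add: fu_def power2_eq_square)
qed

text \<open>The second difference is symmetric in u and v, so the two mixed derivatives agree at
  points arbitrarily close to x; continuity carries this to x.\<close>

lemma smooth_on_frechet_derivative_commute:
  fixes f :: "'a::euclidean_space \<Rightarrow> real"
  assumes f: "smooth_on f S" and "open S" and x: "x \<in> S"
  shows "frechet_derivative (\<lambda>z. frechet_derivative f (at z) u) (at x) v
    = frechet_derivative (\<lambda>z. frechet_derivative f (at z) v) (at x) u"
    (is "?A x = ?B x")
proof (rule ccontr)
  assume neq: "?A x \<noteq> ?B x"
  have "isCont ?A x" "isCont ?B x"
    using smooth_on_continuous_on[OF smooth_on_frechet_derivative[OF smooth_on_frechet_derivative[OF f]]]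
      \<open>open S\<close> x by (auto simp: continuous_on_eq_continuous_at)
  moreover define e where "e = \<bar>?A x - ?B x\<bar> / 2"
  moreover have "e > 0"
    using neq by (simp add: e_def)
  ultimately obtain r1 r2 where "r1 > 0" "r2 > 0"
    and r1: "\<And>z. dist z x < r1 \<Longrightarrow> \<bar>?A z - ?A x\<bar> < e"
    and r2: "\<And>z. dist z x < r2 \<Longrightarrow> \<bar>?B z - ?B x\<bar> < e"
    unfolding continuous_at_eps_delta dist_real_def by metis
  moreover obtain r3 where "r3 > 0" and r3: "ball x r3 \<subseteq> S"
    using \<open>open S\<close> x open_contains_ball by blast
  moreover define r where "r = Min {r1, r2, r3}"
  ultimately have "r > 0" "r \<le> r1" "r \<le> r2" "r \<le> r3"
    by auto
  \<comment> \<open>Scaled so that the parallelogram with sides h u and h v at x stays in the ball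
    of radius r.\<close>
  define h where "h = r / (norm u + norm v + 1)"
  have pos: "norm u + norm v + 1 > 0"
    by (simp add: add_nonneg_pos)
  have h: "h > 0"
    using \<open>r > 0\<close> pos by (simp add: h_def)
  have near: "dist (x + s *\<^sub>R u + t *\<^sub>R v) x < r" if "0 \<le> s" "s \<le> h" "0 \<le> t" "t \<le> h" for s t
  proof -
    have "dist (x + s *\<^sub>R u + t *\<^sub>R v) x \<le> s * norm u + t * norm v"
      using norm_triangle_ineq[of "s *\<^sub>R u" "t *\<^sub>R v"] that by (simp add: dist_norm)
    also have "\<dots> \<le> h * norm u + h * norm v"
      using that by (intro add_mono mult_right_mono) auto
    also have "\<dots> < h * (norm u + norm v + 1)"
      using h by (simp add: algebra_simps)
    finally show ?thesis
      using pos by (simp add: h_def)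
  qed
  have inS: "x + s *\<^sub>R u + t *\<^sub>R v \<in> S" if "0 \<le> s" "s \<le> h" "0 \<le> t" "t \<le> h" for s t
    using near[OF that] r3 \<open>r \<le> r3\<close> by (auto simp: dist_commute)
  have inS': "x + t *\<^sub>R v + s *\<^sub>R u \<in> S" if "0 \<le> t" "t \<le> h" "0 \<le> s" "s \<le> h" for s t
    using inS[of s t] that by (simp add: ac_simps)
  obtain s t where "0 < s" "s < h" "0 < t" "t < h" and
    A: "f (x + h *\<^sub>R u + h *\<^sub>R v) - f (x + h *\<^sub>R u) - f (x + h *\<^sub>R v) + f x
      = h\<^sup>2 * ?A (x + s *\<^sub>R u + t *\<^sub>R v)"
    using second_difference_eq[OF f h inS] by blast
  moreover obtain s' t' where "0 < s'" "s' < h" "0 < t'" "t' < h" and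
    B: "f (x + h *\<^sub>R v + h *\<^sub>R u) - f (x + h *\<^sub>R v) - f (x + h *\<^sub>R u) + f x
      = h\<^sup>2 * ?B (x + t' *\<^sub>R v + s' *\<^sub>R u)"
    using second_difference_eq[OF f h, of x v u, OF inS'] by blast
  moreover have "?A (x + s *\<^sub>R u + t *\<^sub>R v) = ?B (x + t' *\<^sub>R v + s' *\<^sub>R u)"
  proof -
    have "h\<^sup>2 * ?A (x + s *\<^sub>R u + t *\<^sub>R v) = h\<^sup>2 * ?B (x + t' *\<^sub>R v + s' *\<^sub>R u)"
      unfolding A[symmetric] B[symmetric] by (simp add: algebra_simps)
    then show ?thesis
      using h by simp
  qed
  moreover have "\<bar>?A (x + s *\<^sub>R u + t *\<^sub>R v) - ?A x\<bar> < e"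
    using near[of s t] calculation \<open>r \<le> r1\<close> by (intro r1) auto
  moreover have "\<bar>?B (x + t' *\<^sub>R v + s' *\<^sub>R u) - ?B x\<bar> < e"
    using near[of s' t'] calculation \<open>r \<le> r2\<close> by (intro r2) (auto simp: ac_simps)
  \<comment> \<open>Two equal values cannot lie within half the gap of two different
    numbers.\<close>
  moreover have False if "a = b" "\<bar>a - p\<bar> < \<bar>p - q\<bar> / 2" "\<bar>b - q\<bar> < \<bar>p - q\<bar> / 2" for a b p q :: real
    using that by (auto simp: abs_if split: if_splits)
  ultimately show False
    unfolding e_def by blast
qed

section \<open>Coordinate derivatives of functions on the tangent bundle\<close>

lemma partial_deriv_eqI:
  "((\<lambda>t. f (x + t *\<^sub>R axis i 1)) has_real_derivative d) (at 0) \<Longrightarrow> partial_deriv i f x = d"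
  unfolding partial_deriv_def by (rule DERIV_imp_deriv)

lemma partial_deriv_cong:
  assumes "open S" "x \<in> S" "\<And>z. z \<in> S \<Longrightarrow> f z = g z"
  shows "partial_deriv i f x = partial_deriv i g x"
  unfolding partial_deriv_def
proof (rule deriv_cong_ev[OF _ refl])
  show "\<forall>\<^sub>F t in nhds 0. f (x + t *\<^sub>R axis i 1) = g (x + t *\<^sub>R axis i 1)"
    using eventually_line_in_open[OF assms(1,2)] by (rule eventually_mono) (rule assms(3))
qed

text \<open>Agreement of g with f is required on the slice of T only: this lets formulas for the
  tensor and the geodesic coefficients, valid just on the slit tangent bundle, be inserted under a
  partial derivative.\<close>

lemma partial_deriv_fst:
  fixes f :: "(real ^ 'n) \<times> (real ^ 'n) \<Rightarrow> real"
  assumes f: "smooth_on f T" and "open T" and "(x, y) \<in> T" and "\<And>x. (x, y) \<in> T \<Longrightarrow> g x = f (x, y)"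
  shows "partial_deriv i g x = frechet_derivative f (at (x, y)) (axis i 1, 0)"
proof -
  have "open ((\<lambda>x. (x, y)) -` T)"
    using \<open>open T\<close> by (intro open_vimage) (auto intro: continuous_intros)
  then have "partial_deriv i g x = partial_deriv i (\<lambda>x. f (x, y)) x"
    using assms by (intro partial_deriv_cong) auto
  also have "\<dots> = frechet_derivative f (at (x, y)) (axis i 1, 0)"
    using frechet_derivative_line[of f _ "(x, y)" 0 "(axis i 1, 0)"] smooth_on_has_derivative[OF f assms(3)]
    by (intro partial_deriv_eqI) auto
  finally show ?thesis .
qed

lemma partial_deriv_snd:
  fixes f :: "(real ^ 'n) \<times> (real ^ 'n) \<Rightarrow> real"
  assumes f: "smooth_on f T" and "open T" and "(x, y) \<in> T" and "\<And>y. (x, y) \<in> T \<Longrightarrow> g y = f (x, y)"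
  shows "partial_deriv i g y = frechet_derivative f (at (x, y)) (0, axis i 1)"
proof -
  have "open (Pair x -` T)"
    using \<open>open T\<close> by (intro open_vimage) (auto intro: continuous_intros)
  then have "partial_deriv i g y = partial_deriv i (\<lambda>y. f (x, y)) y"
    using assms by (intro partial_deriv_cong) auto
  also have "\<dots> = frechet_derivative f (at (x, y)) (0, axis i 1)"
    using frechet_derivative_line[of f _ "(x, y)" 0 "(0, axis i 1)"] smooth_on_has_derivative[OF f assms(3)]
    by (intro partial_deriv_eqI) auto
  finally show ?thesis .
qed

section \<open>The Randers metric as a navigation problem\<close>

text \<open>The disk of radius \<open>\<rho>\<close> written without a square root; the inequality
  is L > 0 for the polynomial L that occurs throughout.\<close>

definition nav_domain :: "real \<Rightarrow> (real ^ 2) set" where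
  "nav_domain \<epsilon> = {x. (1 + \<epsilon>\<^sup>2) * ((x $ 1)\<^sup>2 + (x $ 2)\<^sup>2) < 1}"

definition nav_tangent :: "real \<Rightarrow> ((real ^ 2) \<times> (real ^ 2)) set" where
  "nav_tangent \<epsilon> = nav_domain \<epsilon> \<times> (- {0})"

definition randers_F :: "real \<Rightarrow> (real ^ 2) \<times> (real ^ 2) \<Rightarrow> real" where
  "randers_F \<epsilon> z = randers_alpha \<epsilon> (fst z) (snd z) + randers_beta \<epsilon> (fst z) (snd z)"

lemma norm_sq_2: "(norm (x :: real ^ 2))\<^sup>2 = (x $ 1)\<^sup>2 + (x $ 2)\<^sup>2"
  by (simp add: norm_vec_def L2_set_def sum_2)

lemma ball_eq_nav_domain:
  assumes "\<rho> = 1 / sqrt (1 + \<epsilon>\<^sup>2)"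
  shows "ball 0 \<rho> = nav_domain \<epsilon>"
proof -
  have pos: "1 + \<epsilon>\<^sup>2 > 0"
    by (simp add: add_pos_nonneg)
  then have rho: "\<rho> > 0" "\<rho>\<^sup>2 = 1 / (1 + \<epsilon>\<^sup>2)"
    by (simp_all add: assms power_divide)
  have "x \<in> ball 0 \<rho> \<longleftrightarrow> x \<in> nav_domain \<epsilon>" for x :: "real ^ 2"
  proof -
    have "x \<in> ball 0 \<rho> \<longleftrightarrow> \<not> \<rho> \<le> norm x"
      by (simp add: not_le)
    also have "\<dots> \<longleftrightarrow> \<not> \<rho>\<^sup>2 \<le> (norm x)\<^sup>2"
      using rho(1) power_mono_iff[of \<rho> "norm x" 2] by simp
    also have "\<dots> \<longleftrightarrow> (x $ 1)\<^sup>2 + (x $ 2)\<^sup>2 < 1 / (1 + \<epsilon>\<^sup>2)"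
      by (simp only: rho(2) norm_sq_2 not_le)
    also have "\<dots> \<longleftrightarrow> x \<in> nav_domain \<epsilon>"
      by (simp only: nav_domain_def mem_Collect_eq pos_less_divide_eq[OF pos] mult.commute)
    finally show ?thesis .
  qed
  then show ?thesis
    by blast
qed

lemma open_nav_domain: "open (nav_domain \<epsilon>)"
  using ball_eq_nav_domain[OF refl] by (metis open_ball)

lemma open_nav_tangent: "open (nav_tangent \<epsilon>)"
  unfolding nav_tangent_def by (intro open_Times open_nav_domain open_Compl closed_singleton)

lemma nav_domain_pos:
  assumes "x \<in> nav_domain \<epsilon>"
  shows "1 - (1 + \<epsilon>\<^sup>2) * ((x $ 1)\<^sup>2 + (x $ 2)\<^sup>2) > 0" and "1 - (x $ 1)\<^sup>2 - (x $ 2)\<^sup>2 > 0"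
proof -
  show L: "1 - (1 + \<epsilon>\<^sup>2) * ((x $ 1)\<^sup>2 + (x $ 2)\<^sup>2) > 0"
    using assms by (simp add: nav_domain_def)
  have "1 - (x $ 1)\<^sup>2 - (x $ 2)\<^sup>2 = (1 - (1 + \<epsilon>\<^sup>2) * ((x $ 1)\<^sup>2 + (x $ 2)\<^sup>2))
      + \<epsilon>\<^sup>2 * ((x $ 1)\<^sup>2 + (x $ 2)\<^sup>2)"
    by (simp add: algebra_simps)
  also have "\<dots> > 0"
    using L by (intro add_pos_nonneg) simp_all
  finally show "1 - (x $ 1)\<^sup>2 - (x $ 2)\<^sup>2 > 0" .
qed

lemma vec2_nonzero_iff: "(y :: real ^ 2) \<noteq> 0 \<longleftrightarrow> (y $ 1)\<^sup>2 + (y $ 2)\<^sup>2 > 0"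
  by (auto simp: vec_eq_iff forall_2 sum_power2_gt_zero_iff)

lemma klein_rotation_field:
  fixes x y :: "real ^ 2"
  assumes "1 - (x $ 1)\<^sup>2 - (x $ 2)\<^sup>2 \<noteq> 0"
  shows "klein x (rotation_field x) y
      = (x $ 1 * y $ 2 - x $ 2 * y $ 1) / (1 - (x $ 1)\<^sup>2 - (x $ 2)\<^sup>2)"
    and "klein x (rotation_field x) (rotation_field x)
      = ((x $ 1)\<^sup>2 + (x $ 2)\<^sup>2) / (1 - (x $ 1)\<^sup>2 - (x $ 2)\<^sup>2)"
  using assms unfolding klein_def rotation_field_def
  by (simp_all add: divide_simps) (simp_all add: power2_eq_square algebra_simps)

text \<open>Everything follows from h(v, y) = w / D and 1 - \<epsilon>^2 h(v, v) = L / D. Putting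
  \<alpha> under a single root makes its square a rational function, positive off the zero
  section.\<close>

lemma randers_formula:
  fixes x y :: "real ^ 2" and \<epsilon> :: real
  defines "D \<equiv> 1 - (x $ 1)\<^sup>2 - (x $ 2)\<^sup>2"
    and "L \<equiv> 1 - (1 + \<epsilon>\<^sup>2) * ((x $ 1)\<^sup>2 + (x $ 2)\<^sup>2)"
    and "w \<equiv> x $ 1 * y $ 2 - x $ 2 * y $ 1"
    and "N \<equiv> (y $ 1)\<^sup>2 + (y $ 2)\<^sup>2"
  assumes x: "x \<in> nav_domain \<epsilon>"
  shows "randers_alpha \<epsilon> x y = sqrt ((\<epsilon>\<^sup>2 * w\<^sup>2 * D + (N - w\<^sup>2) * L) / (D * L\<^sup>2))"
    and "randers_beta \<epsilon> x y = - (\<epsilon> * w / L)"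
    and "y \<noteq> 0 \<Longrightarrow> 0 < (\<epsilon>\<^sup>2 * w\<^sup>2 * D + (N - w\<^sup>2) * L) / (D * L\<^sup>2)"
    and "N - w\<^sup>2 \<ge> 0"
    and "y \<noteq> 0 \<Longrightarrow> N - w\<^sup>2 > 0"
proof -
  have pos: "L > 0" "D > 0"
    using nav_domain_pos[OF x] by (simp_all add: L_def D_def)
  have klein: "klein x (rotation_field x) y = w / D"
    "klein x (rotation_field x) (rotation_field x) = (1 - D) / D"
    "klein x y y = (N - w\<^sup>2) / D\<^sup>2"
    using klein_rotation_field[of x] pos klein_diag[of x y] by (auto simp: D_def N_def w_def)
  have LD: "1 - \<epsilon>\<^sup>2 * ((1 - D) / D) = L / D"
    using pos by (simp add: divide_simps) (simp add: D_def L_def algebra_simps)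
  have "randers_alpha \<epsilon> x y = sqrt ((\<epsilon>\<^sup>2 * (w / D)\<^sup>2 + (N - w\<^sup>2) / D\<^sup>2 * (L / D)) / (L / D)\<^sup>2)"
    using pos unfolding randers_alpha_def Let_def klein LD
    by (simp add: real_sqrt_divide)
  also have "(\<epsilon>\<^sup>2 * (w / D)\<^sup>2 + (N - w\<^sup>2) / D\<^sup>2 * (L / D)) / (L / D)\<^sup>2
      = (\<epsilon>\<^sup>2 * w\<^sup>2 * D + (N - w\<^sup>2) * L) / (D * L\<^sup>2)"
    using pos by (simp add: divide_simps power2_eq_square algebra_simps)
  finally show "randers_alpha \<epsilon> x y = sqrt ((\<epsilon>\<^sup>2 * w\<^sup>2 * D + (N - w\<^sup>2) * L) / (D * L\<^sup>2))" .
  show "randers_beta \<epsilon> x y = - (\<epsilon> * w / L)"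
    using pos unfolding randers_beta_def Let_def klein LD by (simp add: divide_simps)
  \<comment> \<open>Lagrange's identity |x|^2 |y|^2 = w^2 + <x, y>^2.\<close>
  have sq: "N - w\<^sup>2 = D * N + (x $ 1 * y $ 1 + x $ 2 * y $ 2)\<^sup>2"
    by (simp add: D_def N_def w_def power2_eq_square algebra_simps)
  show nonneg: "N - w\<^sup>2 \<ge> 0"
    unfolding sq using pos by (simp add: N_def)
  show N: "N - w\<^sup>2 > 0" if "y \<noteq> 0"
    unfolding sq using that pos by (auto simp: vec2_nonzero_iff N_def intro!: add_pos_nonneg)
  show "0 < (\<epsilon>\<^sup>2 * w\<^sup>2 * D + (N - w\<^sup>2) * L) / (D * L\<^sup>2)" if "y \<noteq> 0"
    using N[OF that] pos by (intro divide_pos_pos add_nonneg_pos mult_pos_pos) auto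
qed

lemma smooth_randers_F: "smooth_on (randers_F \<epsilon>) (nav_tangent \<epsilon>)"
proof (rule smooth_on_cong)
  let ?D = "\<lambda>z :: (real ^ 2) \<times> (real ^ 2). 1 - (fst z $ 1)\<^sup>2 - (fst z $ 2)\<^sup>2"
  let ?L = "\<lambda>z :: (real ^ 2) \<times> (real ^ 2). 1 - (1 + \<epsilon>\<^sup>2) * ((fst z $ 1)\<^sup>2 + (fst z $ 2)\<^sup>2)"
  let ?w = "\<lambda>z :: (real ^ 2) \<times> (real ^ 2). fst z $ 1 * snd z $ 2 - fst z $ 2 * snd z $ 1"
  let ?N = "\<lambda>z :: (real ^ 2) \<times> (real ^ 2). (snd z $ 1)\<^sup>2 + (snd z $ 2)\<^sup>2"
  let ?A = "\<lambda>z. (\<epsilon>\<^sup>2 * (?w z)\<^sup>2 * ?D z + (?N z - (?w z)\<^sup>2) * ?L z) / (?D z * (?L z)\<^sup>2)"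
  show "open (nav_tangent \<epsilon>)"
    by (rule open_nav_tangent)
  have pos: "?D z > 0" "?L z > 0" "?A z > 0" if "z \<in> nav_tangent \<epsilon>" for z
  proof -
    have z: "fst z \<in> nav_domain \<epsilon>" "snd z \<noteq> 0"
      using that by (auto simp: nav_tangent_def)
    show "?D z > 0" "?L z > 0" "?A z > 0"
      by (rule nav_domain_pos[OF z(1)] randers_formula(3)[OF z])+
  qed
  show "smooth_on (\<lambda>z. sqrt (?A z) + - (\<epsilon> * ?w z / ?L z)) (nav_tangent \<epsilon>)"
    by (intro smooth_on_intros smooth_on_fst_nth smooth_on_snd_nth open_nav_tangent pos)
      (use pos in \<open>simp_all add: less_imp_neq[THEN not_sym]\<close>)
  show "sqrt (?A z) + - (\<epsilon> * ?w z / ?L z) = randers_F \<epsilon> z" if "z \<in> nav_tangent \<epsilon>" for z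
    using that by (auto simp: randers_F_def randers_formula nav_tangent_def)
qed

text \<open>The quadratic equation says that \<open>\<eta> = y - \<epsilon> F J x\<close>, where \<open>J\<close> is the rotation by a right
  angle, has Klein length \<open>F\<close>: this is Zermelo navigation with wind \<open>\<epsilon> J x\<close>.\<close>

lemma randers_F_quadratic:
  fixes x y :: "real ^ 2" and \<epsilon> :: real
  defines "D \<equiv> 1 - (x $ 1)\<^sup>2 - (x $ 2)\<^sup>2"
    and "L \<equiv> 1 - (1 + \<epsilon>\<^sup>2) * ((x $ 1)\<^sup>2 + (x $ 2)\<^sup>2)"
    and "w \<equiv> x $ 1 * y $ 2 - x $ 2 * y $ 1"
    and "F \<equiv> randers_F \<epsilon> (x, y)"
  assumes x: "x \<in> nav_domain \<epsilon>"
  shows "D * L * F\<^sup>2 + 2 * \<epsilon> * D * w * F = (y $ 1)\<^sup>2 + (y $ 2)\<^sup>2 - w\<^sup>2"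
    and "L * F + \<epsilon> * w = L * randers_alpha \<epsilon> x y"
proof -
  have pos: "L > 0" "D > 0"
    using nav_domain_pos[OF x] by (simp_all add: L_def D_def)
  define N where "N = (y $ 1)\<^sup>2 + (y $ 2)\<^sup>2"
  define A where "A = (\<epsilon>\<^sup>2 * w\<^sup>2 * D + (N - w\<^sup>2) * L) / (D * L\<^sup>2)"
  have nonneg: "N - w\<^sup>2 \<ge> 0"
    using randers_formula(4)[OF x, of y] by (simp add: N_def w_def)
  then have "A \<ge> 0"
    unfolding A_def using pos by auto
  have F: "F = sqrt A - \<epsilon> * w / L"
    using randers_formula(1,2)[OF x, of y] by (simp add: F_def randers_F_def A_def N_def w_def D_def L_def)
  have beta: "randers_beta \<epsilon> x y = - (\<epsilon> * w / L)"
    using randers_formula(2)[OF x, of y] by (simp add: w_def L_def)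
  show "L * F + \<epsilon> * w = L * randers_alpha \<epsilon> x y"
    using pos beta by (simp add: F_def randers_F_def right_diff_distrib)
  have 1: "L * F + \<epsilon> * w = L * sqrt A"
    using pos by (simp add: F field_simps)
  have 2: "D * (L * sqrt A)\<^sup>2 = \<epsilon>\<^sup>2 * w\<^sup>2 * D + (N - w\<^sup>2) * L"
    using pos \<open>A \<ge> 0\<close> by (simp add: power_mult_distrib) (simp add: A_def)
  \<comment> \<open>Multiplying by L completes the square.\<close>
  have "L * (D * L * F\<^sup>2 + 2 * \<epsilon> * D * w * F) = D * (L * F + \<epsilon> * w)\<^sup>2 - \<epsilon>\<^sup>2 * w\<^sup>2 * D"
    by (simp add: power2_eq_square algebra_simps)
  also have "\<dots> = L * (N - w\<^sup>2)"
    unfolding 1 2 by simp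
  finally show "D * L * F\<^sup>2 + 2 * \<epsilon> * D * w * F = (y $ 1)\<^sup>2 + (y $ 2)\<^sup>2 - w\<^sup>2"
    using pos by (simp add: N_def)
qed

lemma randers_alpha_pos: "x \<in> nav_domain \<epsilon> \<Longrightarrow> y \<noteq> 0 \<Longrightarrow> randers_alpha \<epsilon> x y > 0"
  using randers_formula(1,3)[of x \<epsilon> y] by simp

text \<open>Implicit differentiation of the quadratic equation in the direction (a, b), so the root
  is never differentiated. D' and w' are the derivatives of D and w, and that of L is (1 +
  \<epsilon>^2) D'. The coefficient of F' is 2 D L \<alpha>, nonzero off the zero section.\<close>

lemma randers_F_line:
  fixes x y a b :: "real ^ 2" and \<epsilon> :: real
  defines "D \<equiv> 1 - (x $ 1)\<^sup>2 - (x $ 2)\<^sup>2"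
    and "L \<equiv> 1 - (1 + \<epsilon>\<^sup>2) * ((x $ 1)\<^sup>2 + (x $ 2)\<^sup>2)"
    and "w \<equiv> x $ 1 * y $ 2 - x $ 2 * y $ 1"
    and "F \<equiv> randers_F \<epsilon> (x, y)"
    and "F' \<equiv> frechet_derivative (randers_F \<epsilon>) (at (x, y)) (a, b)"
    and "D' \<equiv> - 2 * (x $ 1 * a $ 1 + x $ 2 * a $ 2)"
    and "w' \<equiv> x $ 1 * b $ 2 - x $ 2 * b $ 1 + a $ 1 * y $ 2 - a $ 2 * y $ 1"
  assumes z: "(x, y) \<in> nav_tangent \<epsilon>"
  shows "((\<lambda>t. randers_F \<epsilon> (x + t *\<^sub>R a, y + t *\<^sub>R b)) has_real_derivative F') (at 0)"
    and "2 * D * (L * F + \<epsilon> * w) * F' + (D' * L + D * ((1 + \<epsilon>\<^sup>2) * D')) * F\<^sup>2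
      + 2 * \<epsilon> * F * (D' * w + D * w')
      = 2 * (y $ 1 * b $ 1 + y $ 2 * b $ 2) - 2 * w * w'"
proof -
  show F': "((\<lambda>t. randers_F \<epsilon> (x + t *\<^sub>R a, y + t *\<^sub>R b)) has_real_derivative F') (at 0)"
    unfolding F'_def using z
      frechet_derivative_line[of "randers_F \<epsilon>" _ "(x, y)" 0 "(a, b)"] smooth_on_has_derivative[OF smooth_randers_F]
    by auto
  define X1 where "X1 = (\<lambda>t. x $ 1 + t * a $ 1)"
  define X2 where "X2 = (\<lambda>t. x $ 2 + t * a $ 2)"
  define Y1 where "Y1 = (\<lambda>t. y $ 1 + t * b $ 1)"
  define Y2 where "Y2 = (\<lambda>t. y $ 2 + t * b $ 2)"
  define f where "f = (\<lambda>t. randers_F \<epsilon> (x + t *\<^sub>R a, y + t *\<^sub>R b))"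
  \<comment> \<open>The defect of the quadratic equation along the line. It vanishes near 0 because
    the slit tangent bundle is open.\<close>
  define E where "E = (\<lambda>t. (1 - (X1 t)\<^sup>2 - (X2 t)\<^sup>2) * (1 - (1 + \<epsilon>\<^sup>2) * ((X1 t)\<^sup>2 + (X2 t)\<^sup>2)) * (f t)\<^sup>2
     + 2 * \<epsilon> * (1 - (X1 t)\<^sup>2 - (X2 t)\<^sup>2) * (X1 t * Y2 t - X2 t * Y1 t) * f t
     - (Y1 t)\<^sup>2 - (Y2 t)\<^sup>2 + (X1 t * Y2 t - X2 t * Y1 t)\<^sup>2)"
  have d: "(X1 has_real_derivative a $ 1) (at 0)" "(X2 has_real_derivative a $ 2) (at 0)"
    "(Y1 has_real_derivative b $ 1) (at 0)" "(Y2 has_real_derivative b $ 2) (at 0)"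
    "(f has_real_derivative F') (at 0)"
    unfolding X1_def X2_def Y1_def Y2_def f_def using F' by (auto intro!: derivative_eq_intros)
  have at0: "X1 0 = x $ 1" "X2 0 = x $ 2" "Y1 0 = y $ 1" "Y2 0 = y $ 2" "f 0 = F"
    by (simp_all add: X1_def X2_def Y1_def Y2_def f_def F_def)
  have "(E has_real_derivative (2 * D * (L * F + \<epsilon> * w) * F' + (D' * L + D * ((1 + \<epsilon>\<^sup>2) * D')) * F\<^sup>2
      + 2 * \<epsilon> * F * (D' * w + D * w')
      - 2 * (y $ 1 * b $ 1 + y $ 2 * b $ 2) + 2 * w * w')) (at 0)"
    unfolding E_def
    by (rule derivative_eq_intros d refl)+
      (simp add: at0 D_def L_def w_def D'_def w'_def power2_eq_square algebra_simps)
  moreover have "(E has_real_derivative 0) (at 0)"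
  proof (rule DERIV_cong_ev[THEN iffD1, OF refl _ refl DERIV_const])
    have "\<forall>\<^sub>F t in nhds 0. (x + t *\<^sub>R a, y + t *\<^sub>R b) \<in> nav_tangent \<epsilon>"
      using eventually_line_in_open[OF open_nav_tangent z, of "(a, b)"] by simp
    then show "\<forall>\<^sub>F t in nhds 0. 0 = E t"
    proof (rule eventually_mono)
      fix t assume "(x + t *\<^sub>R a, y + t *\<^sub>R b) \<in> nav_tangent \<epsilon>"
      then show "0 = E t"
        using randers_F_quadratic(1)[of "x + t *\<^sub>R a" \<epsilon> "y + t *\<^sub>R b"]
        by (simp add: nav_tangent_def E_def f_def X1_def X2_def Y1_def Y2_def)
    qed
  qed
  ultimately show "2 * D * (L * F + \<epsilon> * w) * F' + (D' * L + D * ((1 + \<epsilon>\<^sup>2) * D')) * F\<^sup>2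
      + 2 * \<epsilon> * F * (D' * w + D * w')
      = 2 * (y $ 1 * b $ 1 + y $ 2 * b $ 2) - 2 * w * w'"
    using DERIV_unique by fastforce
qed

section \<open>Algebraic identities at a tangent vector\<close>

text \<open>All identities at a single tangent vector: \<open>f\<^sub>k\<close> and \<open>X\<^sub>k\<close> stand for the derivatives of \<open>F\<close> in \<open>y\<^sup>k\<close>
  and \<open>x\<^sup>k\<close>, \<open>n\<close> for \<open>\<eta>\<close>, and the assumptions on them are the differentiated quadratic equation.\<close>

locale nav_point =
  fixes x1 x2 y1 y2 \<epsilon> F f1 f2 X1 X2 D L w M d \<theta> n1 n2 :: real
  assumes D: "D = 1 - x1\<^sup>2 - x2\<^sup>2"
    and L: "L = 1 - (1 + \<epsilon>\<^sup>2) * (x1\<^sup>2 + x2\<^sup>2)"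
    and w: "w = x1 * y2 - x2 * y1"
    and M: "M = L * F + \<epsilon> * w"
    and d: "d = x1 * y1 + x2 * y2"
    and \<theta>: "\<theta> = d / D"
    and n1: "n1 = y1 + \<epsilon> * F * x2"
    and n2: "n2 = y2 - \<epsilon> * F * x1"
    and D_nz: "D \<noteq> 0" and M_nz: "M \<noteq> 0"
    and F: "D * L * F\<^sup>2 + 2 * \<epsilon> * D * w * F = y1\<^sup>2 + y2\<^sup>2 - w\<^sup>2"
    and f1: "D * M * f1 - \<epsilon> * F * D * x2 = y1 + w * x2"
    and f2: "D * M * f2 + \<epsilon> * F * D * x1 = y2 - w * x1"
    and X1: "D * M * X1 - x1 * (L + D * (1 + \<epsilon>\<^sup>2)) * F\<^sup>2 + \<epsilon> * F * (D * y2 - 2 * x1 * w) = - w * y2"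
    and X2: "D * M * X2 - x2 * (L + D * (1 + \<epsilon>\<^sup>2)) * F\<^sup>2 - \<epsilon> * F * (D * y1 + 2 * x2 * w) = w * y1"
begin

lemma \<theta>D: "\<theta> * D = d"
  using D_nz by (simp add: \<theta>)

lemma y_eq: "y1 = n1 - \<epsilon> * F * x2" "y2 = n2 + \<epsilon> * F * x1"
  by (simp_all add: n1 n2)

lemma d_eq: "d = x1 * n1 + x2 * n2"
  by (simp add: d n1 n2 algebra_simps)

lemma M_eq: "M = D * F + \<epsilon> * (n2 * x1 - n1 * x2)"
  unfolding M L w n1 n2 D by (simp add: power2_eq_square algebra_simps)

text \<open>This is h(\<eta>, \<eta>) = F^2, using D h(u, u) = |u|^2 + <x, u>^2 / D and <x, \<eta>>
  = d.\<close>

lemma F_eq: "D * F\<^sup>2 = n1\<^sup>2 + n2\<^sup>2 + \<theta> * d"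
proof -
  have "D * (D * F\<^sup>2) = D * (n1\<^sup>2 + n2\<^sup>2) + d * d"
    using F D L w n1 n2 d by algebra
  also have "\<dots> = D * (n1\<^sup>2 + n2\<^sup>2 + \<theta> * d)"
    unfolding \<theta>D[symmetric] by (simp add: algebra_simps)
  finally show ?thesis
    using D_nz by simp
qed

text \<open>Differentiating h(\<eta>, \<eta>) = F^2 in y gives M F_y = D h(\<eta>, -), and the
  covector D h(\<eta>, -) is \<eta> + \<theta> x.\<close>

lemma Mf: "M * f1 = n1 + \<theta> * x1" "M * f2 = n2 + \<theta> * x2"
proof -
  have "D * (M * f1) = D * (n1 + \<theta> * x1)"
    using f1 D w n1 d \<theta>D by algebra
  then show "M * f1 = n1 + \<theta> * x1"
    using D_nz by simp
  have "D * (M * f2) = D * (n2 + \<theta> * x2)"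
    using f2 D w n2 d \<theta>D by algebra
  then show "M * f2 = n2 + \<theta> * x2"
    using D_nz by simp
qed

text \<open>Euler's relation for F, obtained from the quadratic equation alone; it supplies the
  homogeneity assumption of the general Finsler argument.\<close>

lemma f_y: "f1 * y1 + f2 * y2 = F"
proof -
  have "M * (f1 * y1 + f2 * y2) = M * F"
    using Mf F_eq M_eq y_eq d_eq by algebra
  then show ?thesis
    using M_nz by simp
qed

text \<open>The vector \<open>B = \<theta> J x + J \<eta>\<close>, which appears in the geodesic coefficients below, is tangent to the
  indicatrix.\<close>

lemma f_B: "f2 * (\<theta> * x1 + n1) = f1 * (\<theta> * x2 + n2)"
proof -
  have "M * (f2 * (\<theta> * x1 + n1)) = M * (f1 * (\<theta> * x2 + n2))"
    using Mf by algebra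
  then show ?thesis
    using M_nz by simp
qed

text \<open>Both F_x and F_y carry the denominator M. Expressing F_x through F_y absorbs it, so from
  here on only D has to be cleared.\<close>

lemma X_eq:
  "D * X1 = x1 * (F - \<epsilon> * F * (f2 * x1 - f1 * x2)) + d * f1 - \<epsilon> * F * D * f2"
  "D * X2 = x2 * (F - \<epsilon> * F * (f2 * x1 - f1 * x2)) + d * f2 + \<epsilon> * F * D * f1"
proof -
  have X1': "D * M * X1 = - \<epsilon> * F * D * n2 + d * y1 + x1 * (D * F\<^sup>2 + \<theta> * d)"
    using X1 F_eq D L w n1 n2 d \<theta>D by algebra
  have "M * (D * X1) = M * (x1 * (F - \<epsilon> * F * (f2 * x1 - f1 * x2)) + d * f1 - \<epsilon> * F * D * f2)"
    using X1' Mf M_eq D d y_eq \<theta>D by algebra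
  then show "D * X1 = x1 * (F - \<epsilon> * F * (f2 * x1 - f1 * x2)) + d * f1 - \<epsilon> * F * D * f2"
    using M_nz by simp
  have X2': "D * M * X2 = \<epsilon> * F * D * n1 + d * y2 + x2 * (D * F\<^sup>2 + \<theta> * d)"
    using X2 F_eq D L w n1 n2 d \<theta>D by algebra
  have "M * (D * X2) = M * (x2 * (F - \<epsilon> * F * (f2 * x1 - f1 * x2)) + d * f2 + \<epsilon> * F * D * f1)"
    using X2' Mf M_eq D d y_eq \<theta>D by algebra
  then show "D * X2 = x2 * (F - \<epsilon> * F * (f2 * x1 - f1 * x2)) + d * f2 + \<epsilon> * F * D * f1"
    using M_nz by simp
qed

text \<open>\<open>N\<^sub>i\<^sub>j\<close> is the derivative of the geodesic coefficient \<open>G\<^sup>i\<close> in \<open>y\<^sup>j\<close>, \<open>t\<^sub>k\<close> that of \<open>\<theta>\<close> in \<open>x\<^sup>k\<close>, and a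
  prime denotes the derivative along the spray, that is in the direction \<open>(y, - 2 G)\<close>.\<close>

definition "B1 = - (\<theta> * x2 + n2)"
definition "B2 = \<theta> * x1 + n1"
definition "N11 = x1 / D * n1 + \<theta> - \<epsilon> * f1 * B1"
definition "N12 = x2 / D * n1 + \<epsilon> * F - \<epsilon> * f2 * B1"
definition "N21 = x1 / D * n2 - \<epsilon> * F - \<epsilon> * f1 * B2"
definition "N22 = x2 / D * n2 + \<theta> - \<epsilon> * f2 * B2"
definition "G1 = \<theta> * y1 + \<epsilon> * F * (\<theta> * x2 + y2) - \<epsilon>\<^sup>2 * F\<^sup>2 * x1 / 2"
definition "G2 = \<theta> * y2 - \<epsilon> * F * (\<theta> * x1 + y1) - \<epsilon>\<^sup>2 * F\<^sup>2 * x2 / 2"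

text \<open>F is constant along the horizontal directions of the connection N. This relation turns
  constancy along the spray into the Euler-Lagrange equation, and later removes F_x from the
  quadratic terms of the curvature.\<close>

lemma X_N: "X1 = N11 * f1 + N21 * f2" "X2 = N12 * f1 + N22 * f2"
proof -
  have DN: "D * N11 = x1 * n1 + d - \<epsilon> * f1 * B1 * D" "D * N12 = x2 * n1 + \<epsilon> * F * D - \<epsilon> * f2 * B1 * D"
    "D * N21 = x1 * n2 - \<epsilon> * F * D - \<epsilon> * f1 * B2 * D" "D * N22 = x2 * n2 + d - \<epsilon> * f2 * B2 * D"
    using D_nz unfolding N11_def N12_def N21_def N22_def \<theta>D[symmetric] by (simp_all add: field_simps)
  have "D * X1 = D * (N11 * f1 + N21 * f2)"
    using X_eq(1) DN(1,3) f_y f_B y_eq B1_def B2_def by algebra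
  then show "X1 = N11 * f1 + N21 * f2"
    using D_nz by simp
  have "D * X2 = D * (N12 * f1 + N22 * f2)"
    using X_eq(2) DN(2,4) f_y f_B y_eq B1_def B2_def by algebra
  then show "X2 = N12 * f1 + N22 * f2"
    using D_nz by simp
qed

text \<open>F is constant along the spray: its derivative in the direction (y, - 2 G) is
  zero.\<close>

lemma X_y: "y1 * X1 + y2 * X2 = 2 * (G1 * f1 + G2 * f2)"
proof -
  have "2 * G1 = 2 * \<theta> * y1 + 2 * \<epsilon> * F * (\<theta> * x2 + y2) - \<epsilon>\<^sup>2 * F\<^sup>2 * x1"
    "2 * G2 = 2 * \<theta> * y2 - 2 * \<epsilon> * F * (\<theta> * x1 + y1) - \<epsilon>\<^sup>2 * F\<^sup>2 * x2"
    unfolding G1_def G2_def by (simp_all add: field_simps)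
  then have "D * (y1 * X1 + y2 * X2) = D * (2 * (G1 * f1 + G2 * f2))"
    using X_eq f_y f_B \<theta>D y_eq d_eq d D by algebra
  then show ?thesis
    using D_nz by simp
qed

text \<open>The part of the trace coming from F_y is -\<epsilon> times F_y(B), which is zero since B
  is tangent to the indicatrix. Hence the trace is 3 \<theta>.\<close>

lemma trace_N: "D * (N11 + N22) = 3 * d"
proof -
  have fB: "f1 * B1 + f2 * B2 = 0"
    using f_B by (simp add: B1_def B2_def algebra_simps)
  have "D * (N11 + N22) = x1 * n1 + x2 * n2 + 2 * d - \<epsilon> * D * (f1 * B1 + f2 * B2)"
    using D_nz unfolding N11_def N22_def \<theta>D[symmetric] by (simp add: field_simps)
  then show ?thesis
    using d_eq by (simp add: fB)
qed

text \<open>No F' appears, since F is constant along the spray: \<eta>' = - 2 G - \<epsilon> F J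
  y.\<close>

definition "n1' = \<epsilon> * F * y2 - 2 * G1"
definition "n2' = - \<epsilon> * F * y1 - 2 * G2"
definition "\<theta>' = (y1\<^sup>2 + y2\<^sup>2 - 2 * (x1 * G1 + x2 * G2) + 2 * \<theta> * d) / D"
definition "B1' = - (\<theta>' * x2 + \<theta> * y2 + n2')"
definition "B2' = \<theta>' * x1 + \<theta> * y1 + n1'"

text \<open>\<eta>' = - 2 \<theta> \<eta> + \<epsilon> F J \<eta>: the Klein geodesic equation seen
  in a frame rotating at rate \<epsilon> F.\<close>

lemma n'_eq: "n1' = - 2 * \<theta> * n1 - \<epsilon> * F * n2" "n2' = - 2 * \<theta> * n2 + \<epsilon> * F * n1"
  unfolding n1'_def n2'_def G1_def G2_def unfolding y_eq by (simp_all add: algebra_simps power2_eq_square)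

lemma \<theta>'_eq: "\<theta>' = (n1\<^sup>2 + n2\<^sup>2) / D"
proof -
  have "y1\<^sup>2 + y2\<^sup>2 - 2 * (x1 * G1 + x2 * G2) + 2 * \<theta> * d = n1\<^sup>2 + n2\<^sup>2"
    unfolding G1_def G2_def unfolding y_eq d_eq by (simp add: algebra_simps power2_eq_square)
  then show ?thesis
    by (simp add: \<theta>'_def)
qed

lemma B'_eq:
  "B1' = - (\<theta>' * x2 - \<theta> * n2 + \<epsilon> * F * (\<theta> * x1 + n1))"
  "B2' = \<theta>' * x1 - \<theta> * n1 - \<epsilon> * F * (\<theta> * x2 + n2)"
  unfolding B1'_def B2'_def n'_eq unfolding y_eq by (simp_all add: algebra_simps)

definition "t1 = (y1 + 2 * \<theta> * x1) / D"
definition "t2 = (y2 + 2 * \<theta> * x2) / D"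
text \<open>Three groups: twice the x-derivative of G; the derivative of N along (y, - 2 G), which
  merges the two middle terms of the curvature formula; and the product N N. In the second group the
  derivative of F_{y^k} has been replaced by F_{x^k}, which is the Euler-Lagrange equation.\<close>

definition "R11 = (2 * t1 * n1 - 2 * \<epsilon> * X1 * B1 - \<epsilon>\<^sup>2 * F\<^sup>2)
  - (t1 * n1 + x1 / D * n1' + \<theta>' - \<epsilon> * X1 * B1 - \<epsilon> * f1 * B1')
  - (N11 * N11 + N12 * N21)"
definition "R12 = (2 * t2 * n1 - 2 * \<epsilon> * X2 * B1 + 2 * \<epsilon> * F * \<theta>)
  - (t2 * n1 + x2 / D * n1' - \<epsilon> * X2 * B1 - \<epsilon> * f2 * B1')
  - (N11 * N12 + N12 * N22)"
definition "R21 = (2 * t1 * n2 - 2 * \<epsilon> * X1 * B2 - 2 * \<epsilon> * F * \<theta>)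
  - (t1 * n2 + x1 / D * n2' - \<epsilon> * X1 * B2 - \<epsilon> * f1 * B2')
  - (N21 * N11 + N22 * N21)"
definition "R22 = (2 * t2 * n2 - 2 * \<epsilon> * X2 * B2 - \<epsilon>\<^sup>2 * F\<^sup>2)
  - (t2 * n2 + x2 / D * n2' + \<theta>' - \<epsilon> * X2 * B2 - \<epsilon> * f2 * B2')
  - (N21 * N12 + N22 * N22)"

lemma curvature_identity:
  "R11 = F * f1 * y1 - F\<^sup>2" "R12 = F * f2 * y1" "R21 = F * f1 * y2" "R22 = F * f2 * y2 - F\<^sup>2"
proof -
  \<comment> \<open>A letter for 1 / D keeps all identities polynomial.\<close>
  define i where "i = 1 / D"
  have div_i: "a / D = a * i" for a
    by (simp add: i_def)
  have iD: "i * D = 1"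
    using D_nz by (simp add: i_def)
  have \<theta>i: "\<theta> = i * (x1 * n1 + x2 * n2)"
    by (simp add: \<theta> i_def d_eq)
  have FF: "F\<^sup>2 = i * (n1\<^sup>2 + n2\<^sup>2) + \<theta>\<^sup>2"
    using F_eq iD \<theta>i d_eq by algebra
  have \<theta>'i: "\<theta>' = i * (n1\<^sup>2 + n2\<^sup>2)"
    by (simp add: \<theta>'_eq i_def)
  have fi: "f1 * F + f1 * \<epsilon> * i * (n2 * x1 - n1 * x2) = i * (n1 + \<theta> * x1)"
    "f2 * F + f2 * \<epsilon> * i * (n2 * x1 - n1 * x2) = i * (n2 + \<theta> * x2)"
    using Mf M_eq iD by algebra+
  have Ni: "N11 = x1 * i * n1 + \<theta> - \<epsilon> * f1 * B1" "N12 = x2 * i * n1 + \<epsilon> * F - \<epsilon> * f2 * B1"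
    "N21 = x1 * i * n2 - \<epsilon> * F - \<epsilon> * f1 * B2" "N22 = x2 * i * n2 + \<theta> - \<epsilon> * f2 * B2"
    by (simp_all add: N11_def N12_def N21_def N22_def i_def)
  have Di: "D = 1 - x1\<^sup>2 - x2\<^sup>2"
    by (rule D)
  have xN: "x1 * N11 + x2 * N21 = 2 * \<theta> * x1 - \<epsilon> * F * x2 - \<epsilon> * f1 * (x2 * n1 - x1 * n2)"
    "x1 * N12 + x2 * N22 = 2 * \<theta> * x2 + \<epsilon> * F * x1 - \<epsilon> * f2 * (x2 * n1 - x1 * n2)"
  proof -
    have "x1 * N11 + x2 * N21 = x1 * (i * (x1 * n1 + x2 * n2)) + \<theta> * x1 - \<epsilon> * F * x2 - \<epsilon> * f1 * (x1 * B1 + x2 * B2)"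
      "x1 * N12 + x2 * N22 = x2 * (i * (x1 * n1 + x2 * n2)) + \<theta> * x2 + \<epsilon> * F * x1 - \<epsilon> * f2 * (x1 * B1 + x2 * B2)"
      unfolding Ni by (simp_all add: algebra_simps)
    then show "x1 * N11 + x2 * N21 = 2 * \<theta> * x1 - \<epsilon> * F * x2 - \<epsilon> * f1 * (x2 * n1 - x1 * n2)"
      "x1 * N12 + x2 * N22 = 2 * \<theta> * x2 + \<epsilon> * F * x1 - \<epsilon> * f2 * (x2 * n1 - x1 * n2)"
      unfolding \<theta>i[symmetric] B1_def B2_def by (simp_all add: algebra_simps)
  qed
  \<comment> \<open>Only the left factor is expanded; its F_y part meets N in the combination F_y N
    = F_x of \<open>X_N\<close>. The resulting terms with X_1, X_2 cancel those of the other two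
    groups.\<close>
  have NN: "N11 * N11 + N12 * N21 = i * n1 * (x1 * N11 + x2 * N21) + \<theta> * N11 + \<epsilon> * F * N21 - \<epsilon> * X1 * B1"
    "N11 * N12 + N12 * N22 = i * n1 * (x1 * N12 + x2 * N22) + \<theta> * N12 + \<epsilon> * F * N22 - \<epsilon> * X2 * B1"
    "N21 * N11 + N22 * N21 = i * n2 * (x1 * N11 + x2 * N21) + \<theta> * N21 - \<epsilon> * F * N11 - \<epsilon> * X1 * B2"
    "N21 * N12 + N22 * N22 = i * n2 * (x1 * N12 + x2 * N22) + \<theta> * N22 - \<epsilon> * F * N12 - \<epsilon> * X2 * B2"
    using X_N Ni by algebra+
  have c: "i * (n1 + \<theta> * x1) + \<epsilon> * f1 * i * (x2 * n1 - x1 * n2) = F * f1"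
    "i * (n2 + \<theta> * x2) + \<epsilon> * f2 * i * (x2 * n1 - x1 * n2) = F * f2"
    using fi by (simp_all add: algebra_simps)
  \<comment> \<open>A Riccati equation along geodesics, \<theta>' = F^2 - \<theta>^2; this is where
    the curvature -1 of the Klein metric enters.\<close>
  have FF': "\<theta>' + \<theta>\<^sup>2 = F\<^sup>2"
    by (simp add: FF \<theta>'i)
  have "R11 = n1 * (i * (n1 + \<theta> * x1) + \<epsilon> * f1 * i * (x2 * n1 - x1 * n2)) - (\<theta>' + \<theta>\<^sup>2) * (1 + \<epsilon> * f1 * x2)"
    unfolding R11_def NN xN unfolding t1_def n'_eq B'_eq Ni B1_def B2_def div_i
    unfolding y_eq by (simp add: algebra_simps power2_eq_square)
  also have "\<dots> = F * f1 * y1 - F\<^sup>2"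
    unfolding c FF' unfolding y_eq by (simp add: algebra_simps power2_eq_square)
  finally show "R11 = F * f1 * y1 - F\<^sup>2" .
  have "R12 = n1 * (i * (n2 + \<theta> * x2) + \<epsilon> * f2 * i * (x2 * n1 - x1 * n2)) - (\<theta>' + \<theta>\<^sup>2) * (\<epsilon> * f2 * x2)"
    unfolding R12_def NN xN unfolding t2_def n'_eq B'_eq Ni B1_def B2_def div_i
    unfolding y_eq by (simp add: algebra_simps power2_eq_square)
  also have "\<dots> = F * f2 * y1"
    unfolding c FF' unfolding y_eq by (simp add: algebra_simps power2_eq_square)
  finally show "R12 = F * f2 * y1" .
  have "R21 = n2 * (i * (n1 + \<theta> * x1) + \<epsilon> * f1 * i * (x2 * n1 - x1 * n2)) + (\<theta>' + \<theta>\<^sup>2) * (\<epsilon> * f1 * x1)"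
    unfolding R21_def NN xN unfolding t1_def n'_eq B'_eq Ni B1_def B2_def div_i
    unfolding y_eq by (simp add: algebra_simps power2_eq_square)
  also have "\<dots> = F * f1 * y2"
    unfolding c FF' unfolding y_eq by (simp add: algebra_simps power2_eq_square)
  finally show "R21 = F * f1 * y2" .
  have "R22 = n2 * (i * (n2 + \<theta> * x2) + \<epsilon> * f2 * i * (x2 * n1 - x1 * n2)) - (\<theta>' + \<theta>\<^sup>2) * (1 - \<epsilon> * f2 * x1)"
    unfolding R22_def NN xN unfolding t2_def n'_eq B'_eq Ni B1_def B2_def div_i
    unfolding y_eq by (simp add: algebra_simps power2_eq_square)
  also have "\<dots> = F * f2 * y2 - F\<^sup>2"
    unfolding c FF' unfolding y_eq by (simp add: algebra_simps power2_eq_square)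
  finally show "R22 = F * f2 * y2 - F\<^sup>2" .
qed

end

section \<open>Geodesic coefficients of a Finsler metric\<close>

lemma frechet_eqI: "(f has_derivative f') (at x) \<Longrightarrow> frechet_derivative f (at x) v = f' v"
  using frechet_derivative_at by metis

lemma frechet_mult:
  fixes f g :: "'a::euclidean_space \<Rightarrow> real"
  assumes "smooth_on f S" "smooth_on g S" "z \<in> S"
  shows "frechet_derivative (\<lambda>z. f z * g z) (at z) v
    = f z * frechet_derivative g (at z) v + frechet_derivative f (at z) v * g z"
  by (rule frechet_eqI[OF has_derivative_mult]) (auto intro: smooth_on_has_derivative assms)

lemma frechet_sum:
  fixes f :: "'b \<Rightarrow> 'a::euclidean_space \<Rightarrow> real"
  assumes "\<And>i. smooth_on (f i) S" "z \<in> S"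
  shows "frechet_derivative (\<lambda>z. \<Sum>i\<in>I. f i z) (at z) v = (\<Sum>i\<in>I. frechet_derivative (f i) (at z) v)"
  by (rule frechet_eqI[OF has_derivative_sum]) (auto intro: smooth_on_has_derivative assms)

lemma frechet_snd_nth:
  "frechet_derivative (\<lambda>z :: (real ^ 'n::finite) \<times> (real ^ 'n). snd z $ i) (at z) v = snd v $ i"
  by (intro frechet_eqI bounded_linear_imp_has_derivative
      bounded_linear_compose[OF bounded_linear_vec_nth bounded_linear_snd])

lemma frechet_cong:
  assumes "smooth_on f S" "open S" "z \<in> S" "\<And>z. z \<in> S \<Longrightarrow> f z = g z"
  shows "frechet_derivative f (at z) v = frechet_derivative g (at z) v"
  by (metis assms differentiable_def frechet_derivative_transform_within_open smooth_on_has_derivative)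

lemma smooth_on_sum:
  fixes f :: "'b \<Rightarrow> 'a::euclidean_space \<Rightarrow> real"
  assumes "open S" "\<And>i. smooth_on (f i) S"
  shows "smooth_on (\<lambda>z. \<Sum>i\<in>I. f i z) S"
  by (induction I rule: infinite_finite_induct) (auto intro: smooth_on_const smooth_on_add assms)

lemma matrix_inv_inverse:
  fixes A :: "'a::semiring_1 ^ 'n ^ 'm"
  assumes "invertible A"
  shows "A ** matrix_inv A = mat 1" and "matrix_inv A ** A = mat 1"
  using someI_ex[OF assms[unfolded invertible_def]] by (simp_all add: matrix_inv_def)

lemma matrix_inv_unique_right:
  fixes A B :: "'a::semiring_1 ^ 'n ^ 'n"
  assumes "A ** B = mat 1" "B ** A = mat 1"
  shows "matrix_inv A = B"
  by (metis assms invertible_def matrix_inv_inverse(2) matrix_mul_assoc matrix_mul_lid matrix_mul_rid)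

text \<open>Homogeneity enters through Euler's relation alone: contractions with y then lower the
  order of the derivatives of F, so the fundamental tensor need not be evaluated.\<close>

locale finsler_chart =
  fixes F :: "(real ^ 'n) \<times> (real ^ 'n::finite) \<Rightarrow> real" and T :: "((real ^ 'n) \<times> (real ^ 'n)) set"
  assumes F_smooth: "smooth_on F T" and T_open: "open T"
    and euler: "\<And>z. z \<in> T \<Longrightarrow> (\<Sum>k\<in>UNIV. snd z $ k * frechet_derivative F (at z) (0, axis k 1)) = F z"
begin

definition Fy :: "'n \<Rightarrow> (real ^ 'n) \<times> (real ^ 'n) \<Rightarrow> real" where
  "Fy k z = frechet_derivative F (at z) (0, axis k 1)"

definition Fx :: "'n \<Rightarrow> (real ^ 'n) \<times> (real ^ 'n) \<Rightarrow> real" where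
  "Fx k z = frechet_derivative F (at z) (axis k 1, 0)"

text \<open>The tensor 1/2 [F^2]_{y^i y^j} expanded by the product rule.\<close>

definition g :: "'n \<Rightarrow> 'n \<Rightarrow> (real ^ 'n) \<times> (real ^ 'n) \<Rightarrow> real" where
  "g i j z = Fy i z * Fy j z + F z * frechet_derivative (Fy i) (at z) (0, axis j 1)"

lemma Fy_smooth: "smooth_on (Fy k) T"
  unfolding Fy_def[abs_def] by (rule smooth_on_frechet_derivative[OF F_smooth])

lemma Fx_smooth: "smooth_on (Fx k) T"
  unfolding Fx_def[abs_def] by (rule smooth_on_frechet_derivative[OF F_smooth])

lemma g_smooth: "smooth_on (g i j) T"
  unfolding g_def[abs_def]
  by (intro smooth_on_add smooth_on_mult T_open Fy_smooth F_smooth smooth_on_frechet_derivative)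

lemma Fy_sym:
  "z \<in> T \<Longrightarrow> frechet_derivative (Fy i) (at z) (0, axis j 1) = frechet_derivative (Fy j) (at z) (0, axis i 1)"
  unfolding Fy_def[abs_def] by (rule smooth_on_frechet_derivative_commute[OF F_smooth T_open])

lemma Fx_Fy:
  "z \<in> T \<Longrightarrow> frechet_derivative (Fy i) (at z) (axis j 1, 0) = frechet_derivative (Fx j) (at z) (0, axis i 1)"
  unfolding Fy_def[abs_def] Fx_def[abs_def]
  by (rule smooth_on_frechet_derivative_commute[OF F_smooth T_open])

lemma euler_Fy: "z \<in> T \<Longrightarrow> (\<Sum>k\<in>UNIV. snd z $ k * Fy k z) = F z"
  using euler by (simp add: Fy_def)

text \<open>Euler's relation differentiated in an arbitrary direction. Vertical directions give y^k
  F_{y^k y^j} = 0, horizontal ones y^k F_{y^k x^j} = F_{x^j}.\<close>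

lemma euler_derivative:
  assumes z: "z \<in> T"
  shows "(\<Sum>k\<in>UNIV. snd z $ k * frechet_derivative (Fy k) (at z) v + snd v $ k * Fy k z)
    = frechet_derivative F (at z) v"
proof -
  have "frechet_derivative F (at z) v = frechet_derivative (\<lambda>z. \<Sum>k\<in>UNIV. snd z $ k * Fy k z) (at z) v"
    by (rule frechet_cong[OF F_smooth T_open z]) (simp add: euler_Fy)
  also have "\<dots> = (\<Sum>k\<in>UNIV. snd z $ k * frechet_derivative (Fy k) (at z) v + snd v $ k * Fy k z)"
    using z by (simp add: frechet_sum[of _ T] frechet_mult[of _ T] smooth_on_mult T_open Fy_smooth
        smooth_on_snd_nth frechet_snd_nth)
  finally show ?thesis
    by simp
qed

lemma euler_Fyy:
  assumes z: "z \<in> T"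
  shows "(\<Sum>k\<in>UNIV. snd z $ k * frechet_derivative (Fy k) (at z) (0, axis j 1)) = 0"
proof -
  have "(\<Sum>k\<in>UNIV. axis j 1 $ k * Fy k z) = Fy j z"
    by (simp add: axis_def if_distrib[of "\<lambda>c. c * _"] cong: if_cong)
  then show ?thesis
    using euler_derivative[OF z, of "(0, axis j 1)"] by (simp add: sum.distrib Fy_def[of j])
qed

lemma euler_Fyx:
  assumes z: "z \<in> T"
  shows "(\<Sum>k\<in>UNIV. snd z $ k * frechet_derivative (Fy k) (at z) (axis j 1, 0)) = Fx j z"
  using euler_derivative[OF z, of "(axis j 1, 0)"] by (simp add: Fx_def)

lemma g_y: "z \<in> T \<Longrightarrow> (\<Sum>p\<in>UNIV. snd z $ p * g p k z) = F z * Fy k z"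
proof -
  assume z: "z \<in> T"
  have "(\<Sum>p\<in>UNIV. snd z $ p * g p k z) = (\<Sum>p\<in>UNIV. snd z $ p * Fy p z) * Fy k z
      + F z * (\<Sum>p\<in>UNIV. snd z $ p * frechet_derivative (Fy p) (at z) (0, axis k 1))"
    by (simp add: g_def sum_distrib_left sum_distrib_right sum.distrib[symmetric] algebra_simps)
  then show ?thesis
    using z by (simp add: euler_Fyy euler_Fy)
qed

text \<open>Along x-directions y is constant, so the identity y^p g_{pk} = F F_{y^k} may be
  differentiated term by term. This is how third derivatives of F disappear from the geodesic
  coefficients.\<close>

lemma g_y_derivative:
  assumes z: "z \<in> T"
  shows "(\<Sum>p\<in>UNIV. snd z $ p * frechet_derivative (g p k) (at z) (axis q 1, 0))
    = F z * frechet_derivative (Fy k) (at z) (axis q 1, 0) + Fx q z * Fy k z"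
proof -
  have "frechet_derivative (\<lambda>z. \<Sum>p\<in>UNIV. snd z $ p * g p k z) (at z) (axis q 1, 0)
      = frechet_derivative (\<lambda>z. F z * Fy k z) (at z) (axis q 1, 0)"
    using z by (intro frechet_cong[of _ T])
      (auto intro!: smooth_on_sum smooth_on_mult smooth_on_snd_nth g_smooth T_open simp: g_y)
  then show ?thesis
    using z by (simp add: frechet_sum[of _ T] frechet_mult[of _ T] smooth_on_mult T_open Fy_smooth
        smooth_on_snd_nth frechet_snd_nth g_smooth F_smooth Fx_def[symmetric])
qed

lemma fundamental_tensor_eq:
  assumes z: "(x, y) \<in> T"
  shows "fundamental_tensor (\<lambda>x y. F (x, y)) x y $ i $ j = g i j (x, y)"
proof -
  have F2: "frechet_derivative (\<lambda>z. (F z)\<^sup>2) (at z) (0, axis i 1) = 2 * F z * Fy i z" if "z \<in> T" for z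
    using frechet_mult[OF F_smooth F_smooth that] by (simp add: power2_eq_square Fy_def)
  have "partial_deriv i (\<lambda>z. (F (x, z))\<^sup>2) y' = 2 * F (x, y') * Fy i (x, y')" if "(x, y') \<in> T" for y'
    using partial_deriv_snd[of "\<lambda>z. (F z)\<^sup>2" T x y'] that F2[OF that]
    by (simp add: smooth_on_power F_smooth T_open)
  then have "partial_deriv j (partial_deriv i (\<lambda>z. (F (x, z))\<^sup>2)) y
      = frechet_derivative (\<lambda>z. 2 * F z * Fy i z) (at (x, y)) (0, axis j 1)"
    using z by (intro partial_deriv_snd[of _ T])
      (auto intro!: smooth_on_mult smooth_on_const T_open F_smooth Fy_smooth)
  also have "\<dots> = 2 * g i j (x, y)"
  proof -
    have "frechet_derivative (\<lambda>z. 2 * (F z * Fy i z)) (at (x, y)) (0, axis j 1)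
        = 2 * g i j (x, y)"
      using frechet_mult[OF smooth_on_const[of 2] smooth_on_mult[OF T_open F_smooth Fy_smooth[of i]] z]
        frechet_mult[OF F_smooth Fy_smooth[of i] z]
      by (simp add: g_def Fy_def[symmetric])
    then show ?thesis
      by (simp add: mult.assoc)
  qed
  finally show ?thesis
    by (simp add: fundamental_tensor_def)
qed

text \<open>The last two assumptions on \<open>G\<close> say that \<open>F\<close> is constant along the spray with coefficients \<open>G\<close>
  and that the spray satisfies the Euler--Lagrange equation of \<open>F\<close>.\<close>

lemma geodesic_coeff_eqI:
  fixes G :: "real ^ 'n"
  assumes z: "(x, y) \<in> T"
    and inv: "invertible (fundamental_tensor (\<lambda>x y. F (x, y)) x y)"
    and SF: "(\<Sum>q\<in>UNIV. y $ q * Fx q (x, y)) = 2 * (\<Sum>q\<in>UNIV. G $ q * Fy q (x, y))"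
    and EL: "\<And>k. (\<Sum>q\<in>UNIV. y $ q * frechet_derivative (Fy k) (at (x, y)) (axis q 1, 0))
      - 2 * (\<Sum>q\<in>UNIV. G $ q * frechet_derivative (Fy k) (at (x, y)) (0, axis q 1)) = Fx k (x, y)"
  shows "geodesic_coeff (\<lambda>x y. F (x, y)) x y = G"
proof -
  let ?z = "(x, y)"
  let ?A = "fundamental_tensor (\<lambda>x y. F (x, y)) x y"
  have dg: "partial_deriv q (\<lambda>z. fundamental_tensor (\<lambda>x y. F (x, y)) z y $ p $ k) x
      = frechet_derivative (g p k) (at ?z) (axis q 1, 0)" for p q k
    using z by (intro partial_deriv_fst[of _ T]) (auto intro: g_smooth T_open simp: fundamental_tensor_eq)
  have 1: "(\<Sum>p\<in>UNIV. \<Sum>q\<in>UNIV. frechet_derivative (g p k) (at ?z) (axis q 1, 0) * y $ p * y $ q)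
      = 2 * (\<Sum>q\<in>UNIV. G $ q * Fy q ?z) * Fy k ?z + F ?z * (Fx k ?z
        + 2 * (\<Sum>q\<in>UNIV. G $ q * frechet_derivative (Fy k) (at ?z) (0, axis q 1)))" for k
  proof -
    have "(\<Sum>p\<in>UNIV. \<Sum>q\<in>UNIV. frechet_derivative (g p k) (at ?z) (axis q 1, 0) * y $ p * y $ q)
      = (\<Sum>q\<in>UNIV. y $ q * (\<Sum>p\<in>UNIV. y $ p * frechet_derivative (g p k) (at ?z) (axis q 1, 0)))"
      by (subst sum.swap) (simp add: sum_distrib_left mult_ac)
    also have "\<dots> = (\<Sum>q\<in>UNIV. y $ q * (F ?z * frechet_derivative (Fy k) (at ?z) (axis q 1, 0)
        + Fx q ?z * Fy k ?z))"
      using g_y_derivative[OF z] by simp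
    also have "\<dots> = F ?z * (\<Sum>q\<in>UNIV. y $ q * frechet_derivative (Fy k) (at ?z) (axis q 1, 0))
        + (\<Sum>q\<in>UNIV. y $ q * Fx q ?z) * Fy k ?z"
      by (simp add: sum_distrib_left sum_distrib_right sum.distrib[symmetric] algebra_simps)
    finally show ?thesis
      using SF EL[of k] by (simp add: algebra_simps)
  qed
  have 2: "(\<Sum>p\<in>UNIV. \<Sum>q\<in>UNIV. frechet_derivative (g p q) (at ?z) (axis k 1, 0) * y $ p * y $ q)
      = 2 * F ?z * Fx k ?z" for k
  proof -
    have "(\<Sum>p\<in>UNIV. \<Sum>q\<in>UNIV. frechet_derivative (g p q) (at ?z) (axis k 1, 0) * y $ p * y $ q)
      = (\<Sum>q\<in>UNIV. y $ q * (\<Sum>p\<in>UNIV. y $ p * frechet_derivative (g p q) (at ?z) (axis k 1, 0)))"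
      by (subst sum.swap) (simp add: sum_distrib_left mult_ac)
    also have "\<dots> = (\<Sum>q\<in>UNIV. y $ q * (F ?z * frechet_derivative (Fy q) (at ?z) (axis k 1, 0)
        + Fx k ?z * Fy q ?z))"
      using g_y_derivative[OF z] by simp
    also have "\<dots> = F ?z * (\<Sum>q\<in>UNIV. y $ q * frechet_derivative (Fy q) (at ?z) (axis k 1, 0))
        + Fx k ?z * (\<Sum>q\<in>UNIV. y $ q * Fy q ?z)"
      by (simp add: sum_distrib_left sum_distrib_right sum.distrib[symmetric] algebra_simps)
    finally show ?thesis
      using euler_Fyx[OF z, of k] euler_Fy[OF z] by simp
  qed
  \<comment> \<open>The bracket in the definition of the geodesic coefficients contracts to 4 g G;
    applying the inverse of g and the factor 1/4 returns G.\<close>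
  have b: "(\<Sum>p\<in>UNIV. \<Sum>q\<in>UNIV. (2 * frechet_derivative (g p k) (at ?z) (axis q 1, 0)
        - frechet_derivative (g p q) (at ?z) (axis k 1, 0)) * y $ p * y $ q) = 4 * (?A *v G) $ k" for k
  proof -
    have "(\<Sum>p\<in>UNIV. \<Sum>q\<in>UNIV. (2 * frechet_derivative (g p k) (at ?z) (axis q 1, 0)
        - frechet_derivative (g p q) (at ?z) (axis k 1, 0)) * y $ p * y $ q)
      = 2 * (\<Sum>p\<in>UNIV. \<Sum>q\<in>UNIV. frechet_derivative (g p k) (at ?z) (axis q 1, 0) * y $ p * y $ q)
        - (\<Sum>p\<in>UNIV. \<Sum>q\<in>UNIV. frechet_derivative (g p q) (at ?z) (axis k 1, 0) * y $ p * y $ q)"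
      by (simp add: sum_distrib_left sum_subtractf[symmetric] algebra_simps)
    also have "\<dots> = 4 * ((\<Sum>q\<in>UNIV. G $ q * Fy q ?z) * Fy k ?z
        + F ?z * (\<Sum>q\<in>UNIV. G $ q * frechet_derivative (Fy k) (at ?z) (0, axis q 1)))"
      unfolding 1 2 by (simp add: algebra_simps)
    also have "\<dots> = 4 * (\<Sum>q\<in>UNIV. g k q ?z * G $ q)"
      by (simp add: g_def sum_distrib_left sum_distrib_right sum.distrib[symmetric] algebra_simps)
    finally show ?thesis
      by (simp add: matrix_vector_mult_def fundamental_tensor_eq[OF z])
  qed
  have "geodesic_coeff (\<lambda>x y. F (x, y)) x y $ i = G $ i" for i
  proof -
    have "geodesic_coeff (\<lambda>x y. F (x, y)) x y $ i = 1 / 4 * (\<Sum>k\<in>UNIV. matrix_inv ?A $ i $ k *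
        (\<Sum>p\<in>UNIV. \<Sum>q\<in>UNIV. (2 * frechet_derivative (g p k) (at ?z) (axis q 1, 0)
        - frechet_derivative (g p q) (at ?z) (axis k 1, 0)) * y $ p * y $ q))"
      unfolding geodesic_coeff_def dg by (simp add: sum_distrib_left mult.assoc)
    also have "\<dots> = (\<Sum>k\<in>UNIV. matrix_inv ?A $ i $ k * (?A *v G) $ k)"
      unfolding b by (simp add: sum_distrib_left)
    also have "\<dots> = (matrix_inv ?A *v (?A *v G)) $ i"
      by (simp add: matrix_vector_mult_def)
    also have "\<dots> = G $ i"
      using matrix_inv_inverse(2)[OF inv] by (simp add: matrix_vector_mul_assoc)
    finally show ?thesis .
  qed
  then show ?thesis
    by (simp add: vec_eq_iff)
qed

text \<open>Differentiating y^q F_{x^q} = 2 G^q F_{y^q} in y^k produces the Euler-Lagrange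
  expression, except that F_{x^k} stands on the left and 2 (G^j)_{y^k} F_{y^j} on the right. By the
  last assumption the latter is 2 F_{x^k}, and exactly one F_{x^k} is left over.\<close>

lemma euler_lagrangeI:
  fixes G :: "(real ^ 'n) \<times> (real ^ 'n) \<Rightarrow> real ^ 'n"
  assumes z: "z \<in> T" and G_smooth: "\<And>j. smooth_on (\<lambda>z. G z $ j) T"
    and SF: "\<And>z. z \<in> T \<Longrightarrow> (\<Sum>q\<in>UNIV. snd z $ q * Fx q z) = 2 * (\<Sum>q\<in>UNIV. G z $ q * Fy q z)"
    and NF: "Fx k z = (\<Sum>j\<in>UNIV. frechet_derivative (\<lambda>z. G z $ j) (at z) (0, axis k 1) * Fy j z)"
  shows "(\<Sum>q\<in>UNIV. snd z $ q * frechet_derivative (Fy k) (at z) (axis q 1, 0))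
      - 2 * (\<Sum>q\<in>UNIV. G z $ q * frechet_derivative (Fy k) (at z) (0, axis q 1)) = Fx k z"
proof -
  let ?v = "(0, axis k 1) :: (real ^ 'n) \<times> (real ^ 'n)"
  have "frechet_derivative (\<lambda>z. \<Sum>q\<in>UNIV. snd z $ q * Fx q z) (at z) ?v
      = frechet_derivative (\<lambda>z. \<Sum>q\<in>UNIV. 2 * (G z $ q * Fy q z)) (at z) ?v"
    using z SF by (intro frechet_cong[of _ T])
      (auto intro!: smooth_on_sum smooth_on_mult smooth_on_snd_nth T_open Fx_smooth simp: sum_distrib_left)
  moreover have "frechet_derivative (\<lambda>z. \<Sum>q\<in>UNIV. snd z $ q * Fx q z) (at z) ?v
      = (\<Sum>q\<in>UNIV. snd z $ q * frechet_derivative (Fx q) (at z) ?v + axis k 1 $ q * Fx q z)"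
    using z by (simp add: frechet_sum[of _ T] frechet_mult[of _ T] smooth_on_mult T_open Fx_smooth
        smooth_on_snd_nth frechet_snd_nth)
  moreover have "(\<Sum>q\<in>UNIV. axis k 1 $ q * Fx q z) = Fx k z"
    by (simp add: axis_def if_distrib[of "\<lambda>c. c * _"] cong: if_cong)
  moreover have "frechet_derivative (\<lambda>z. \<Sum>q\<in>UNIV. 2 * (G z $ q * Fy q z)) (at z) ?v
      = (\<Sum>q\<in>UNIV. 2 * (G z $ q * frechet_derivative (Fy q) (at z) ?v
          + frechet_derivative (\<lambda>z. G z $ q) (at z) ?v * Fy q z))"
    using z by (subst frechet_sum[of _ T])
      (auto intro!: smooth_on_mult smooth_on_const T_open Fy_smooth G_smooth
        simp: frechet_mult[OF smooth_on_const smooth_on_mult[OF T_open G_smooth Fy_smooth]]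
          frechet_mult[OF G_smooth Fy_smooth])
  ultimately show ?thesis
    using NF z by (simp add: sum.distrib sum_distrib_left[symmetric] Fx_Fy Fy_sym[of z k])
qed

lemma fundamental_tensor_quadratic:
  assumes "(x, y) \<in> T"
  shows "w \<bullet> (fundamental_tensor (\<lambda>x y. F (x, y)) x y *v w) = (\<Sum>i\<in>UNIV. \<Sum>j\<in>UNIV. w $ i * g i j (x, y) * w $ j)"
  by (simp add: inner_vec_def matrix_vector_mult_def fundamental_tensor_eq[OF assms] sum_distrib_left mult_ac)

end

lemma pos_def_invertible:
  fixes A :: "real ^ 'n ^ 'n::finite"
  assumes "\<And>w. w \<noteq> 0 \<Longrightarrow> w \<bullet> (A *v w) > 0"
  shows "invertible A"
  unfolding invertible_left_inverse matrix_left_invertible_ker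
  by (metis assms inner_zero_right less_irrefl)

section \<open>The spray of the Randers metric\<close>

lemma rotation_field_nth [simp]: "rotation_field x $ 1 = - (x $ 2)" "rotation_field x $ 2 = x $ 1"
  by (simp_all add: rotation_field_def)

abbreviation nav_dy :: "real \<Rightarrow> 2 \<Rightarrow> (real ^ 2) \<times> (real ^ 2) \<Rightarrow> real" where
  "nav_dy \<epsilon> k z \<equiv> frechet_derivative (randers_F \<epsilon>) (at z) (0, axis k 1)"

abbreviation nav_dx :: "real \<Rightarrow> 2 \<Rightarrow> (real ^ 2) \<times> (real ^ 2) \<Rightarrow> real" where
  "nav_dx \<epsilon> k z \<equiv> frechet_derivative (randers_F \<epsilon>) (at z) (axis k 1, 0)"

text \<open>The four equations for the derivatives are the implicit differentiation along the
  coordinate directions in y and in x; M is nonzero because it equals L \<alpha>.\<close>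

lemma nav_pointI:
  fixes x y :: "real ^ 2" and \<epsilon> :: real
  defines "D \<equiv> 1 - (x $ 1)\<^sup>2 - (x $ 2)\<^sup>2"
    and "L \<equiv> 1 - (1 + \<epsilon>\<^sup>2) * ((x $ 1)\<^sup>2 + (x $ 2)\<^sup>2)"
    and "w \<equiv> x $ 1 * y $ 2 - x $ 2 * y $ 1"
    and "F \<equiv> randers_F \<epsilon> (x, y)"
    and "d \<equiv> x $ 1 * y $ 1 + x $ 2 * y $ 2"
  assumes z: "(x, y) \<in> nav_tangent \<epsilon>"
  shows "nav_point (x $ 1) (x $ 2) (y $ 1) (y $ 2) \<epsilon> F (nav_dy \<epsilon> 1 (x, y)) (nav_dy \<epsilon> 2 (x, y))
    (nav_dx \<epsilon> 1 (x, y)) (nav_dx \<epsilon> 2 (x, y)) D L w (L * F + \<epsilon> * w) d (d / D)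
    (y $ 1 + \<epsilon> * F * x $ 2) (y $ 2 - \<epsilon> * F * x $ 1)"
proof
  have x: "x \<in> nav_domain \<epsilon>" and y: "y \<noteq> 0"
    using z by (auto simp: nav_tangent_def)
  show "D \<noteq> 0"
    using nav_domain_pos[OF x] by (simp add: D_def)
  show "L * F + \<epsilon> * w \<noteq> 0"
    using randers_F_quadratic(2)[OF x, of y] nav_domain_pos[OF x] randers_alpha_pos[OF x y]
    by (simp add: L_def F_def w_def)
  show "D * L * F\<^sup>2 + 2 * \<epsilon> * D * w * F = (y $ 1)\<^sup>2 + (y $ 2)\<^sup>2 - w\<^sup>2"
    using randers_F_quadratic(1)[OF x, of y] by (simp add: D_def L_def w_def F_def)
  note line = randers_F_line(2)[OF z, folded D_def L_def w_def F_def]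
  show "D * (L * F + \<epsilon> * w) * nav_dy \<epsilon> 1 (x, y) - \<epsilon> * F * D * x $ 2 = y $ 1 + w * x $ 2"
    using line[of 0 "axis 1 1"] by (simp add: axis_def algebra_simps)
  show "D * (L * F + \<epsilon> * w) * nav_dy \<epsilon> 2 (x, y) + \<epsilon> * F * D * x $ 1 = y $ 2 - w * x $ 1"
    using line[of 0 "axis 2 1"] by (simp add: axis_def algebra_simps)
  show "D * (L * F + \<epsilon> * w) * nav_dx \<epsilon> 1 (x, y) - x $ 1 * (L + D * (1 + \<epsilon>\<^sup>2)) * F\<^sup>2
      + \<epsilon> * F * (D * y $ 2 - 2 * x $ 1 * w) = - w * y $ 2"
    using line[of "axis 1 1" 0] by (simp add: axis_def algebra_simps)
  show "D * (L * F + \<epsilon> * w) * nav_dx \<epsilon> 2 (x, y) - x $ 2 * (L + D * (1 + \<epsilon>\<^sup>2)) * F\<^sup>2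
      - \<epsilon> * F * (D * y $ 1 + 2 * x $ 2 * w) = w * y $ 1"
    using line[of "axis 2 1" 0] by (simp add: axis_def algebra_simps)
qed (simp_all add: D_def L_def w_def d_def)

definition nav_theta :: "(real ^ 2) \<times> (real ^ 2) \<Rightarrow> real" where
  "nav_theta z = (fst z $ 1 * snd z $ 1 + fst z $ 2 * snd z $ 2) / (1 - (fst z $ 1)\<^sup>2 - (fst z $ 2)\<^sup>2)"

definition nav_eta :: "real \<Rightarrow> (real ^ 2) \<times> (real ^ 2) \<Rightarrow> real ^ 2" where
  "nav_eta \<epsilon> z = snd z - (\<epsilon> * randers_F \<epsilon> z) *\<^sub>R rotation_field (fst z)"

definition nav_B :: "real \<Rightarrow> (real ^ 2) \<times> (real ^ 2) \<Rightarrow> real ^ 2" where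
  "nav_B \<epsilon> z = nav_theta z *\<^sub>R rotation_field (fst z) + rotation_field (nav_eta \<epsilon> z)"

text \<open>The geodesics of \<open>F\<close> are the images of the Klein geodesics, which satisfy \<open>x'' = - 2 \<theta> x'\<close>, under
  the flow of \<open>\<epsilon> J x\<close>; differentiating twice gives the spray.\<close>

definition nav_spray :: "real \<Rightarrow> (real ^ 2) \<times> (real ^ 2) \<Rightarrow> real ^ 2" where
  "nav_spray \<epsilon> z = nav_theta z *\<^sub>R snd z
    - (\<epsilon> * randers_F \<epsilon> z) *\<^sub>R (nav_theta z *\<^sub>R rotation_field (fst z) + rotation_field (snd z))
    - (\<epsilon>\<^sup>2 * (randers_F \<epsilon> z)\<^sup>2 / 2) *\<^sub>R fst z"

text \<open>The closed form of the derivative of the i-th spray coefficient in y^k. On the slit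
  tangent bundle it is again a smooth function, so it can be differentiated once more for the
  curvature.\<close>

definition nav_connection :: "real \<Rightarrow> 2 \<Rightarrow> 2 \<Rightarrow> (real ^ 2) \<times> (real ^ 2) \<Rightarrow> real" where
  "nav_connection \<epsilon> i k z = fst z $ k / (1 - (fst z $ 1)\<^sup>2 - (fst z $ 2)\<^sup>2) * nav_eta \<epsilon> z $ i
    + (if i = k then nav_theta z else 0) - \<epsilon> * randers_F \<epsilon> z * rotation_field (axis k 1) $ i
    - \<epsilon> * nav_dy \<epsilon> k z * nav_B \<epsilon> z $ i"

lemma smooth_nav_theta: "smooth_on nav_theta (nav_tangent \<epsilon>)"
  unfolding nav_theta_def[abs_def]
  by (intro smooth_on_intros smooth_on_fst_nth smooth_on_snd_nth open_nav_tangent)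
    (use nav_domain_pos(2) in \<open>force simp: nav_tangent_def\<close>)

lemma smooth_nav_eta: "smooth_on (\<lambda>z. nav_eta \<epsilon> z $ i) (nav_tangent \<epsilon>)"
proof -
  have "smooth_on (\<lambda>z. nav_eta \<epsilon> z $ 1) (nav_tangent \<epsilon>)"
    "smooth_on (\<lambda>z. nav_eta \<epsilon> z $ 2) (nav_tangent \<epsilon>)"
    unfolding nav_eta_def[abs_def] vector_minus_component vector_scaleR_component rotation_field_nth real_scaleR_def
    by (intro smooth_on_intros smooth_on_fst_nth smooth_on_snd_nth open_nav_tangent smooth_randers_F)+
  then show ?thesis
    using exhaust_2[of i] by auto
qed

lemma smooth_nav_spray: "smooth_on (\<lambda>z. nav_spray \<epsilon> z $ i) (nav_tangent \<epsilon>)"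
proof -
  have "smooth_on (\<lambda>z. nav_spray \<epsilon> z $ 1) (nav_tangent \<epsilon>)"
    "smooth_on (\<lambda>z. nav_spray \<epsilon> z $ 2) (nav_tangent \<epsilon>)"
    unfolding nav_spray_def[abs_def] vector_minus_component vector_add_component vector_scaleR_component
      rotation_field_nth real_scaleR_def
    by (intro smooth_on_intros smooth_on_fst_nth smooth_on_snd_nth open_nav_tangent smooth_randers_F
        smooth_nav_theta, simp)+
  then show ?thesis
    using exhaust_2[of i] by auto
qed

lemma smooth_nav_connection: "smooth_on (nav_connection \<epsilon> i k) (nav_tangent \<epsilon>)"
proof -
  have B: "smooth_on (\<lambda>z. nav_B \<epsilon> z $ i) (nav_tangent \<epsilon>)"
  proof -
    have "smooth_on (\<lambda>z. nav_B \<epsilon> z $ 1) (nav_tangent \<epsilon>)"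
      "smooth_on (\<lambda>z. nav_B \<epsilon> z $ 2) (nav_tangent \<epsilon>)"
      unfolding nav_B_def[abs_def] vector_add_component vector_scaleR_component rotation_field_nth real_scaleR_def
      by (intro smooth_on_intros smooth_on_fst_nth smooth_on_snd_nth open_nav_tangent smooth_nav_eta
          smooth_nav_theta)+
    then show ?thesis
      using exhaust_2[of i] by auto
  qed
  have T: "smooth_on (\<lambda>z. if i = k then nav_theta z else 0) (nav_tangent \<epsilon>)"
    by (cases "i = k") (simp_all add: smooth_nav_theta smooth_on_const)
  show ?thesis
    unfolding nav_connection_def[abs_def]
    by (intro smooth_on_intros smooth_on_fst_nth smooth_on_snd_nth open_nav_tangent smooth_nav_eta B T
        smooth_randers_F smooth_on_frechet_derivative)
      (use nav_domain_pos(2) in \<open>force simp: nav_tangent_def\<close>)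
qed

lemma frechet_derivative_pair_line:
  fixes f :: "(real ^ 2) \<times> (real ^ 2) \<Rightarrow> real"
  assumes "smooth_on f T" "(x, y) \<in> T"
  shows "((\<lambda>t. f (x + t *\<^sub>R a, y + t *\<^sub>R b)) has_real_derivative
    frechet_derivative f (at (x, y)) (a, b)) (at 0)"
  using frechet_derivative_line[of f _ "(x, y)" 0 "(a, b)"] smooth_on_has_derivative[OF assms] by auto

lemma nav_theta_derivative:
  assumes z: "(x, y) \<in> nav_tangent \<epsilon>"
  shows "frechet_derivative nav_theta (at (x, y)) (a, b)
    = (a $ 1 * y $ 1 + a $ 2 * y $ 2 + x $ 1 * b $ 1 + x $ 2 * b $ 2
        + 2 * nav_theta (x, y) * (x $ 1 * a $ 1 + x $ 2 * a $ 2)) / (1 - (x $ 1)\<^sup>2 - (x $ 2)\<^sup>2)"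
    (is "_ = ?d")
proof -
  define D where "D = 1 - (x $ 1)\<^sup>2 - (x $ 2)\<^sup>2"
  have nz: "D \<noteq> 0"
    using z nav_domain_pos(2)[of x] by (auto simp: nav_tangent_def D_def)
  define d where "d = x $ 1 * y $ 1 + x $ 2 * y $ 2"
  define num where "num = (\<lambda>t. (x $ 1 + t * a $ 1) * (y $ 1 + t * b $ 1) + (x $ 2 + t * a $ 2) * (y $ 2 + t * b $ 2))"
  define den where "den = (\<lambda>t. 1 - (x $ 1 + t * a $ 1)\<^sup>2 - (x $ 2 + t * a $ 2)\<^sup>2)"
  have num: "(num has_real_derivative (a $ 1 * y $ 1 + a $ 2 * y $ 2 + x $ 1 * b $ 1 + x $ 2 * b $ 2)) (at 0)"
    unfolding num_def by (auto intro!: derivative_eq_intros simp: algebra_simps)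
  have den: "(den has_real_derivative - 2 * (x $ 1 * a $ 1 + x $ 2 * a $ 2)) (at 0)"
    unfolding den_def by (auto intro!: derivative_eq_intros simp: algebra_simps)
  have at0: "num 0 = d" "den 0 = D"
    by (simp_all add: num_def den_def d_def D_def)
  have "((\<lambda>t. num t / den t) has_real_derivative
      ((a $ 1 * y $ 1 + a $ 2 * y $ 2 + x $ 1 * b $ 1 + x $ 2 * b $ 2) * den 0
        - num 0 * (- 2 * (x $ 1 * a $ 1 + x $ 2 * a $ 2))) / (den 0 * den 0)) (at 0)"
    using nz by (intro DERIV_divide num den) (simp add: at0)
  moreover have "(\<lambda>t. num t / den t) = (\<lambda>t. nav_theta (x + t *\<^sub>R a, y + t *\<^sub>R b))"
    by (simp add: nav_theta_def num_def den_def)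
  moreover have "(c * den 0 - num 0 * (- 2 * e)) / (den 0 * den 0) = (c + 2 * nav_theta (x, y) * e) / D" for c e
  proof -
    have "nav_theta (x, y) = d / D"
      by (simp add: nav_theta_def d_def D_def)
    then show ?thesis
      using nz unfolding at0 by (simp add: divide_simps) (simp add: algebra_simps)
  qed
  ultimately have "((\<lambda>t. nav_theta (x + t *\<^sub>R a, y + t *\<^sub>R b)) has_real_derivative ?d) (at 0)"
    by (simp only: D_def)
  then show ?thesis
    by (rule DERIV_unique[OF frechet_derivative_pair_line[OF smooth_nav_theta z]])
qed

text \<open>Regarded as a function of \<theta>, F, x and y, the spray has partial derivative \<eta>
  in \<theta>, and -\<epsilon> B in F because J J x = - x.\<close>

lemma nav_spray_derivative:
  fixes x y a b :: "real ^ 2" and \<epsilon> :: real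
  defines "\<theta>' \<equiv> frechet_derivative nav_theta (at (x, y)) (a, b)"
    and "F' \<equiv> frechet_derivative (randers_F \<epsilon>) (at (x, y)) (a, b)"
    and "F \<equiv> randers_F \<epsilon> (x, y)" and "\<theta> \<equiv> nav_theta (x, y)"
    and "\<eta> \<equiv> nav_eta \<epsilon> (x, y)" and "B \<equiv> nav_B \<epsilon> (x, y)"
  assumes z: "(x, y) \<in> nav_tangent \<epsilon>"
  shows "frechet_derivative (\<lambda>z. nav_spray \<epsilon> z $ 1) (at (x, y)) (a, b)
      = \<theta>' * \<eta> $ 1 + \<theta> * b $ 1 - \<epsilon> * F' * B $ 1 + \<epsilon> * F * (\<theta> * a $ 2 + b $ 2) - \<epsilon>\<^sup>2 * F\<^sup>2 * a $ 1 / 2"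
    and "frechet_derivative (\<lambda>z. nav_spray \<epsilon> z $ 2) (at (x, y)) (a, b)
      = \<theta>' * \<eta> $ 2 + \<theta> * b $ 2 - \<epsilon> * F' * B $ 2 - \<epsilon> * F * (\<theta> * a $ 1 + b $ 1) - \<epsilon>\<^sup>2 * F\<^sup>2 * a $ 2 / 2"
proof -
  define f where "f = (\<lambda>t. randers_F \<epsilon> (x + t *\<^sub>R a, y + t *\<^sub>R b))"
  define th where "th = (\<lambda>t. nav_theta (x + t *\<^sub>R a, y + t *\<^sub>R b))"
  have d: "(f has_real_derivative F') (at 0)" "(th has_real_derivative \<theta>') (at 0)"
    unfolding f_def th_def F'_def \<theta>'_def
    by (rule frechet_derivative_pair_line[OF smooth_randers_F z]
        frechet_derivative_pair_line[OF smooth_nav_theta z])+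
  have at0: "f 0 = F" "th 0 = \<theta>"
    by (simp_all add: f_def th_def F_def \<theta>_def)
  have \<eta>: "\<eta> $ 1 = y $ 1 + \<epsilon> * F * x $ 2" "\<eta> $ 2 = y $ 2 - \<epsilon> * F * x $ 1"
    by (simp_all add: \<eta>_def nav_eta_def F_def)
  have B: "B $ 1 = - (\<theta> * x $ 2 + \<eta> $ 2)" "B $ 2 = \<theta> * x $ 1 + \<eta> $ 1"
    by (simp_all add: B_def nav_B_def \<theta>_def \<eta>_def)
  have "((\<lambda>t. nav_spray \<epsilon> (x + t *\<^sub>R a, y + t *\<^sub>R b) $ 1) has_real_derivative
      \<theta>' * \<eta> $ 1 + \<theta> * b $ 1 - \<epsilon> * F' * B $ 1 + \<epsilon> * F * (\<theta> * a $ 2 + b $ 2) - \<epsilon>\<^sup>2 * F\<^sup>2 * a $ 1 / 2) (at 0)"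
    unfolding nav_spray_def fst_conv snd_conv vector_add_component vector_scaleR_component
      vector_minus_component rotation_field_nth real_scaleR_def f_def[symmetric] th_def[symmetric]
      f_def[THEN fun_cong, symmetric] th_def[THEN fun_cong, symmetric]
    by (rule derivative_eq_intros d refl | (simp; fail))+ (simp add: at0 \<eta> B algebra_simps power2_eq_square)
  then show "frechet_derivative (\<lambda>z. nav_spray \<epsilon> z $ 1) (at (x, y)) (a, b)
      = \<theta>' * \<eta> $ 1 + \<theta> * b $ 1 - \<epsilon> * F' * B $ 1 + \<epsilon> * F * (\<theta> * a $ 2 + b $ 2) - \<epsilon>\<^sup>2 * F\<^sup>2 * a $ 1 / 2"
    using frechet_derivative_pair_line[OF smooth_nav_spray z] DERIV_unique by blast
  have "((\<lambda>t. nav_spray \<epsilon> (x + t *\<^sub>R a, y + t *\<^sub>R b) $ 2) has_real_derivative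
      \<theta>' * \<eta> $ 2 + \<theta> * b $ 2 - \<epsilon> * F' * B $ 2 - \<epsilon> * F * (\<theta> * a $ 1 + b $ 1) - \<epsilon>\<^sup>2 * F\<^sup>2 * a $ 2 / 2) (at 0)"
    unfolding nav_spray_def fst_conv snd_conv vector_add_component vector_scaleR_component
      vector_minus_component rotation_field_nth real_scaleR_def
      f_def[THEN fun_cong, symmetric] th_def[THEN fun_cong, symmetric]
    by (rule derivative_eq_intros d refl | (simp; fail))+ (simp add: at0 \<eta> B algebra_simps power2_eq_square)
  then show "frechet_derivative (\<lambda>z. nav_spray \<epsilon> z $ 2) (at (x, y)) (a, b)
      = \<theta>' * \<eta> $ 2 + \<theta> * b $ 2 - \<epsilon> * F' * B $ 2 - \<epsilon> * F * (\<theta> * a $ 1 + b $ 1) - \<epsilon>\<^sup>2 * F\<^sup>2 * a $ 2 / 2"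
    using frechet_derivative_pair_line[OF smooth_nav_spray z] DERIV_unique by blast
qed

lemma nav_connection_derivative:
  fixes x y a b :: "real ^ 2" and \<epsilon> :: real and i k :: 2
  defines "\<theta>' \<equiv> frechet_derivative nav_theta (at (x, y)) (a, b)"
    and "F' \<equiv> frechet_derivative (randers_F \<epsilon>) (at (x, y)) (a, b)"
    and "f' \<equiv> frechet_derivative (nav_dy \<epsilon> k) (at (x, y)) (a, b)"
    and "F \<equiv> randers_F \<epsilon> (x, y)" and "D \<equiv> 1 - (x $ 1)\<^sup>2 - (x $ 2)\<^sup>2"
  defines "\<eta>' \<equiv> b - (\<epsilon> * F') *\<^sub>R rotation_field x - (\<epsilon> * F) *\<^sub>R rotation_field a"
  defines "B' \<equiv> \<theta>' *\<^sub>R rotation_field x + nav_theta (x, y) *\<^sub>R rotation_field a + rotation_field \<eta>'"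
  assumes z: "(x, y) \<in> nav_tangent \<epsilon>"
  shows "frechet_derivative (nav_connection \<epsilon> i k) (at (x, y)) (a, b)
      = (a $ k + 2 * (x $ k / D) * (x $ 1 * a $ 1 + x $ 2 * a $ 2)) / D * nav_eta \<epsilon> (x, y) $ i
        + x $ k / D * \<eta>' $ i + (if i = k then \<theta>' else 0) - \<epsilon> * F' * rotation_field (axis k 1) $ i
        - \<epsilon> * (f' * nav_B \<epsilon> (x, y) $ i + nav_dy \<epsilon> k (x, y) * B' $ i)"
proof -
  let ?l = "\<lambda>t. (x + t *\<^sub>R a, y + t *\<^sub>R b)"
  have nz: "D \<noteq> 0"
    using z nav_domain_pos(2)[of x] by (auto simp: nav_tangent_def D_def)
  have dF: "((\<lambda>t. randers_F \<epsilon> (?l t)) has_real_derivative F') (at 0)"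
    unfolding F'_def by (rule frechet_derivative_pair_line[OF smooth_randers_F z])
  have d\<theta>: "((\<lambda>t. nav_theta (?l t)) has_real_derivative \<theta>') (at 0)"
    unfolding \<theta>'_def by (rule frechet_derivative_pair_line[OF smooth_nav_theta z])
  have df: "((\<lambda>t. nav_dy \<epsilon> k (?l t)) has_real_derivative f') (at 0)"
    unfolding f'_def
    by (rule frechet_derivative_pair_line[OF smooth_on_frechet_derivative[OF smooth_randers_F] z])
  have d\<eta>: "((\<lambda>t. nav_eta \<epsilon> (?l t) $ j) has_real_derivative \<eta>' $ j) (at 0)" for j
  proof -
    have "((\<lambda>t. nav_eta \<epsilon> (?l t) $ 1) has_real_derivative \<eta>' $ 1) (at 0)"
      "((\<lambda>t. nav_eta \<epsilon> (?l t) $ 2) has_real_derivative \<eta>' $ 2) (at 0)"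
      unfolding nav_eta_def fst_conv snd_conv vector_add_component vector_scaleR_component
        vector_minus_component rotation_field_nth real_scaleR_def
      by ((rule derivative_eq_intros dF refl)+, simp add: \<eta>'_def F_def algebra_simps)+
    then show ?thesis
      using exhaust_2[of j] by auto
  qed
  have dB: "((\<lambda>t. nav_B \<epsilon> (?l t) $ j) has_real_derivative B' $ j) (at 0)" for j
  proof -
    have "((\<lambda>t. nav_B \<epsilon> (?l t) $ 1) has_real_derivative B' $ 1) (at 0)"
      "((\<lambda>t. nav_B \<epsilon> (?l t) $ 2) has_real_derivative B' $ 2) (at 0)"
      unfolding nav_B_def fst_conv snd_conv vector_add_component vector_scaleR_component
        vector_minus_component rotation_field_nth real_scaleR_def
      by ((rule derivative_eq_intros d\<theta> d\<eta> refl)+, simp add: B'_def algebra_simps)+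
    then show ?thesis
      using exhaust_2[of j] by auto
  qed
  define den where "den = (\<lambda>t. 1 - (x $ 1 + t * a $ 1)\<^sup>2 - (x $ 2 + t * a $ 2)\<^sup>2)"
  have den: "(den has_real_derivative - 2 * (x $ 1 * a $ 1 + x $ 2 * a $ 2)) (at 0)" "den 0 = D"
    unfolding den_def by (auto intro!: derivative_eq_intros simp: algebra_simps D_def)
  have "((\<lambda>t. (x $ k + t * a $ k) / den t) has_real_derivative
      (a $ k * den 0 - (x $ k + 0 * a $ k) * (- 2 * (x $ 1 * a $ 1 + x $ 2 * a $ 2))) / (den 0 * den 0)) (at 0)"
    using nz by (intro DERIV_divide den) (auto intro!: derivative_eq_intros simp: den(2))
  also have "(a $ k * den 0 - (x $ k + 0 * a $ k) * (- 2 * (x $ 1 * a $ 1 + x $ 2 * a $ 2))) / (den 0 * den 0)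
      = (a $ k + 2 * (x $ k / D) * (x $ 1 * a $ 1 + x $ 2 * a $ 2)) / D"
    using nz unfolding den(2) by (simp add: divide_simps) (simp add: algebra_simps)
  finally have dq: "((\<lambda>t. (x $ k + t * a $ k) / den t) has_real_derivative
      (a $ k + 2 * (x $ k / D) * (x $ 1 * a $ 1 + x $ 2 * a $ 2)) / D) (at 0)" .
  have d\<delta>: "((\<lambda>t. if i = k then nav_theta (?l t) else 0) has_real_derivative (if i = k then \<theta>' else 0)) (at 0)"
    using d\<theta> by (cases "i = k") auto
  have eq: "(\<lambda>t. nav_connection \<epsilon> i k (?l t)) = (\<lambda>t. (x $ k + t * a $ k) / den t * nav_eta \<epsilon> (?l t) $ i
      + (if i = k then nav_theta (?l t) else 0) - \<epsilon> * randers_F \<epsilon> (?l t) * rotation_field (axis k 1) $ i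
      - \<epsilon> * nav_dy \<epsilon> k (?l t) * nav_B \<epsilon> (?l t) $ i)"
    by (simp add: nav_connection_def den_def)
  have "((\<lambda>t. nav_connection \<epsilon> i k (?l t)) has_real_derivative
      (a $ k + 2 * (x $ k / D) * (x $ 1 * a $ 1 + x $ 2 * a $ 2)) / D * nav_eta \<epsilon> (x, y) $ i
        + x $ k / D * \<eta>' $ i + (if i = k then \<theta>' else 0) - \<epsilon> * F' * rotation_field (axis k 1) $ i
        - \<epsilon> * (f' * nav_B \<epsilon> (x, y) $ i + nav_dy \<epsilon> k (x, y) * B' $ i)) (at 0)"
    unfolding eq
    by (rule DERIV_cong, (rule dF df d\<eta> dB dq d\<delta> DERIV_add DERIV_diff DERIV_mult DERIV_const)+)
      (simp add: den(2) algebra_simps)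
  then show ?thesis
    by (rule DERIV_unique[OF frechet_derivative_pair_line[OF smooth_nav_connection z]])
qed

lemma frechet_pair_expand:
  fixes f :: "(real ^ 'n) \<times> (real ^ 'n::finite) \<Rightarrow> real"
  assumes "smooth_on f T" "z \<in> T"
  shows "frechet_derivative f (at z) (a, b)
    = (\<Sum>j\<in>UNIV. a $ j * frechet_derivative f (at z) (axis j 1, 0))
      + (\<Sum>j\<in>UNIV. b $ j * frechet_derivative f (at z) (0, axis j 1))"
proof -
  have lin: "linear (frechet_derivative f (at z))"
    using smooth_on_has_derivative[OF assms] has_derivative_linear by blast
  have ab: "(a, b) = (\<Sum>j\<in>UNIV. a $ j *\<^sub>R (axis j 1, 0)) + (\<Sum>j\<in>UNIV. b $ j *\<^sub>R (0, axis j 1))"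
  proof -
    have e: "c = (\<Sum>j\<in>UNIV. c $ j *\<^sub>R axis j 1)" for c :: "real ^ 'n"
      using basis_expansion[of c] by (simp add: scalar_mult_eq_scaleR)
    have "(\<Sum>j\<in>UNIV. (a $ j *\<^sub>R axis j 1 :: real ^ 'n, 0 :: real ^ 'n)) = (\<Sum>j\<in>UNIV. a $ j *\<^sub>R axis j 1, 0)"
      "(\<Sum>j\<in>UNIV. (0 :: real ^ 'n, b $ j *\<^sub>R axis j 1 :: real ^ 'n)) = (0, \<Sum>j\<in>UNIV. b $ j *\<^sub>R axis j 1)"
      by (simp_all add: prod_eq_iff fst_sum snd_sum)
    then show ?thesis
      by (simp add: e[symmetric])
  qed
  show ?thesis
    unfolding ab by (simp add: linear_add[OF lin] linear_sum[OF lin] linear_cmul[OF lin] del: scaleR_Pair)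
qed

section \<open>Positivity of F and of its fundamental tensor\<close>

lemma DERIV_line_cong:
  fixes f g :: "'a::real_normed_vector \<Rightarrow> real"
  assumes "open T" "z \<in> T" "\<And>z. z \<in> T \<Longrightarrow> f z = g z"
    and "((\<lambda>t. f (z + t *\<^sub>R v)) has_real_derivative f') (at 0)"
    and "((\<lambda>t. g (z + t *\<^sub>R v)) has_real_derivative g') (at 0)"
  shows "f' = g'"
proof -
  have "\<forall>\<^sub>F t in nhds 0. z + t *\<^sub>R v \<in> T"
    by (rule eventually_line_in_open[OF assms(1,2)])
  then have "\<forall>\<^sub>F t in nhds 0. f (z + t *\<^sub>R v) = g (z + t *\<^sub>R v)"
    by (rule eventually_mono) (rule assms(3))
  then have "((\<lambda>t. g (z + t *\<^sub>R v)) has_real_derivative f') (at 0)"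
    by (rule DERIV_cong_ev[THEN iffD1, OF refl _ refl assms(4)])
  then show ?thesis
    using assms(5) DERIV_unique by blast
qed

text \<open>The quadratic equation has roots of opposite signs because N - w^2 > 0, and L F +
  \<epsilon> w = L \<alpha> > 0 selects the larger root.\<close>

lemma randers_F_pos:
  assumes z: "z \<in> nav_tangent \<epsilon>"
  shows "randers_F \<epsilon> z > 0"
proof -
  obtain x y where xy: "z = (x, y)" "x \<in> nav_domain \<epsilon>" "y \<noteq> 0"
    using z by (auto simp: nav_tangent_def)
  define D where "D = 1 - (x $ 1)\<^sup>2 - (x $ 2)\<^sup>2"
  define L where "L = 1 - (1 + \<epsilon>\<^sup>2) * ((x $ 1)\<^sup>2 + (x $ 2)\<^sup>2)"
  define w where "w = x $ 1 * y $ 2 - x $ 2 * y $ 1"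
  define F where "F = randers_F \<epsilon> (x, y)"
  have pos: "D > 0" "L > 0"
    using nav_domain_pos[OF xy(2)] by (auto simp: D_def L_def)
  have "D * (F * (L * F + 2 * \<epsilon> * w)) = D * L * F\<^sup>2 + 2 * \<epsilon> * D * w * F"
    by (simp add: power2_eq_square algebra_simps)
  also have "\<dots> > 0"
    using randers_F_quadratic(1)[OF xy(2), of y] randers_formula(5)[OF xy(2,3)]
    by (simp add: D_def L_def F_def w_def)
  finally have 1: "F * (L * F + 2 * \<epsilon> * w) > 0"
    using pos by (simp add: zero_less_mult_iff)
  have "L * F + \<epsilon> * w = L * randers_alpha \<epsilon> x y"
    using randers_F_quadratic(2)[OF xy(2), of y] by (simp add: L_def F_def w_def)
  then have 2: "L * F + \<epsilon> * w > 0"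
    using pos randers_alpha_pos[OF xy(2,3)] by simp
  have "\<not> F \<le> 0"
  proof
    assume "F \<le> 0"
    then have "L * F + 2 * \<epsilon> * w < 0" "L * F \<le> 0"
      using 1 pos by (auto simp: zero_less_mult_iff mult_le_0_iff)
    then show False
      using 2 by simp
  qed
  then show ?thesis
    by (simp add: F_def xy)
qed

lemma randers_F_0: "randers_F \<epsilon> (x, 0) = 0"
  by (simp add: randers_F_def randers_alpha_def randers_beta_def Let_def klein_def)

interpretation nav: finsler_chart "randers_F \<epsilon>" "nav_tangent \<epsilon>" for \<epsilon>
proof
  show "smooth_on (randers_F \<epsilon>) (nav_tangent \<epsilon>)"
    by (rule smooth_randers_F)
  show "open (nav_tangent \<epsilon>)"
    by (rule open_nav_tangent)
  show "(\<Sum>k\<in>UNIV. snd z $ k * nav_dy \<epsilon> k z) = randers_F \<epsilon> z" if "z \<in> nav_tangent \<epsilon>" for z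
    using nav_point.f_y[OF nav_pointI[of "fst z" "snd z" \<epsilon>]] that by (simp add: sum_2 mult.commute)
qed

text \<open>Along a vertical direction \<open>w\<close> the equation \<open>M F\<^bsub>y\<^sup>k\<^esub> = \<eta>\<^sub>k + \<theta> x\<^sub>k\<close> gives the Hessian of \<open>F\<close> as
  \<open>M F\<^sub>w\<^sub>w = Q(\<zeta>, \<zeta>) - D \<phi>\<^sup>2\<close>, where \<open>Q = D h\<close>, \<open>\<phi> = F\<^sub>w\<close> and \<open>\<zeta> = w - \<epsilon> \<phi> J x\<close>. It is nonnegative by the
  Cauchy--Schwarz inequality for \<open>Q\<close>, since \<open>Q(\<eta>, \<zeta>) = D F \<phi>\<close> and \<open>Q(\<eta>, \<eta>) = D F\<^sup>2\<close>.\<close>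

lemma nav_hessian_pos:
  assumes z: "(x, y) \<in> nav_tangent \<epsilon>" and w: "w \<noteq> 0"
  shows "(\<Sum>i\<in>UNIV. \<Sum>j\<in>UNIV. w $ i * nav.g \<epsilon> i j (x, y) * w $ j) > 0"
proof -
  define D where "D = 1 - (x $ 1)\<^sup>2 - (x $ 2)\<^sup>2"
  define L where "L = 1 - (1 + \<epsilon>\<^sup>2) * ((x $ 1)\<^sup>2 + (x $ 2)\<^sup>2)"
  define F where "F = randers_F \<epsilon> (x, y)"
  define M where "M = L * F + \<epsilon> * (x $ 1 * y $ 2 - x $ 2 * y $ 1)"
  define \<phi> where "\<phi> = frechet_derivative (randers_F \<epsilon>) (at (x, y)) (0, w)"
  define f' where "f' = (\<lambda>k. frechet_derivative (nav_dy \<epsilon> k) (at (x, y)) (0, w))"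
  define \<theta> where "\<theta> = nav_theta (x, y)"
  define n1 where "n1 = y $ 1 + \<epsilon> * F * x $ 2"
  define n2 where "n2 = y $ 2 - \<epsilon> * F * x $ 1"
  interpret p: nav_point "x $ 1" "x $ 2" "y $ 1" "y $ 2" \<epsilon> F "nav_dy \<epsilon> 1 (x, y)" "nav_dy \<epsilon> 2 (x, y)"
    "nav_dx \<epsilon> 1 (x, y)" "nav_dx \<epsilon> 2 (x, y)" D L "x $ 1 * y $ 2 - x $ 2 * y $ 1" M
    "x $ 1 * y $ 1 + x $ 2 * y $ 2" \<theta> n1 n2
    using nav_pointI[OF z] by (simp add: D_def L_def F_def M_def \<theta>_def nav_theta_def n1_def n2_def)
  have x: "x \<in> nav_domain \<epsilon>" and y: "y \<noteq> 0"
    using z by (auto simp: nav_tangent_def)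
  have pos: "D > 0" "L > 0" "F > 0" "M > 0"
    using nav_domain_pos[OF x] randers_F_pos[OF z] randers_F_quadratic(2)[OF x, of y] randers_alpha_pos[OF x y]
    by (simp_all add: D_def L_def F_def M_def)
  have \<phi>: "\<phi> = w $ 1 * nav_dy \<epsilon> 1 (x, y) + w $ 2 * nav_dy \<epsilon> 2 (x, y)"
    using frechet_pair_expand[OF smooth_randers_F z, of 0 w] by (simp add: \<phi>_def sum_2)
  have f'_eq: "(L * \<phi> + \<epsilon> * (x $ 1 * w $ 2 - x $ 2 * w $ 1)) * nav_dy \<epsilon> k (x, y) + M * f' k
      = w $ k - \<epsilon> * \<phi> * rotation_field x $ k + (x $ 1 * w $ 1 + x $ 2 * w $ 2) / D * x $ k" for k
  proof (rule DERIV_line_cong[OF open_nav_tangent z])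
    let ?lhs = "\<lambda>z. ((1 - (1 + \<epsilon>\<^sup>2) * ((fst z $ 1)\<^sup>2 + (fst z $ 2)\<^sup>2)) * randers_F \<epsilon> z
        + \<epsilon> * (fst z $ 1 * snd z $ 2 - fst z $ 2 * snd z $ 1)) * nav_dy \<epsilon> k z"
    let ?rhs = "\<lambda>z. snd z $ k - \<epsilon> * randers_F \<epsilon> z * rotation_field (fst z) $ k + nav_theta z * fst z $ k"
    show "?lhs z = ?rhs z" if "z \<in> nav_tangent \<epsilon>" for z
      using nav_point.Mf[OF nav_pointI[of "fst z" "snd z" \<epsilon>]] that exhaust_2[of k]
      by (auto simp: nav_theta_def)
    have dF: "((\<lambda>t. randers_F \<epsilon> (x, y + t *\<^sub>R w)) has_real_derivative \<phi>) (at 0)"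
      using frechet_derivative_pair_line[OF smooth_randers_F z, of 0 w] by (simp add: \<phi>_def)
    have df: "((\<lambda>t. nav_dy \<epsilon> k (x, y + t *\<^sub>R w)) has_real_derivative f' k) (at 0)"
      using frechet_derivative_pair_line[OF smooth_on_frechet_derivative[OF smooth_randers_F] z, where a = 0 and b = w]
      by (simp add: f'_def)
    have d\<theta>: "((\<lambda>t. nav_theta (x, y + t *\<^sub>R w)) has_real_derivative (x $ 1 * w $ 1 + x $ 2 * w $ 2) / D) (at 0)"
      using frechet_derivative_pair_line[OF smooth_nav_theta z, of 0 w] nav_theta_derivative[OF z, of 0 w]
      by (simp add: D_def)
    show "((\<lambda>t. ?lhs ((x, y) + t *\<^sub>R (0, w))) has_real_derivative
        (L * \<phi> + \<epsilon> * (x $ 1 * w $ 2 - x $ 2 * w $ 1)) * nav_dy \<epsilon> k (x, y) + M * f' k) (at 0)"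
      unfolding scaleR_Pair add_Pair scaleR_zero_right add_0_right fst_conv snd_conv vector_add_component
        vector_scaleR_component real_scaleR_def
      by (rule DERIV_cong, (rule dF df DERIV_add DERIV_diff DERIV_mult DERIV_const DERIV_ident)+)
        (simp add: L_def M_def F_def algebra_simps)
    show "((\<lambda>t. ?rhs ((x, y) + t *\<^sub>R (0, w))) has_real_derivative
        w $ k - \<epsilon> * \<phi> * rotation_field x $ k + (x $ 1 * w $ 1 + x $ 2 * w $ 2) / D * x $ k) (at 0)"
      unfolding scaleR_Pair add_Pair scaleR_zero_right add_0_right fst_conv snd_conv vector_add_component
        vector_scaleR_component real_scaleR_def
      by (rule DERIV_cong, (rule dF d\<theta> DERIV_add DERIV_diff DERIV_mult DERIV_const DERIV_ident)+)
        (simp add: algebra_simps)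
  qed
  define H where "H = w $ 1 * f' 1 + w $ 2 * f' 2"
  have g: "(\<Sum>i\<in>UNIV. \<Sum>j\<in>UNIV. w $ i * nav.g \<epsilon> i j (x, y) * w $ j) = \<phi>\<^sup>2 + F * H"
  proof -
    have "f' k = w $ 1 * frechet_derivative (nav_dy \<epsilon> k) (at (x, y)) (0, axis 1 1)
        + w $ 2 * frechet_derivative (nav_dy \<epsilon> k) (at (x, y)) (0, axis 2 1)" for k
      using frechet_pair_expand[OF smooth_on_frechet_derivative[OF smooth_randers_F] z, where a = 0 and b = w]
      by (simp add: f'_def sum_2)
    then show ?thesis
      by (simp add: sum_2 nav.g_def nav.Fy_def[abs_def] \<phi> H_def F_def power2_eq_square algebra_simps)
  qed
  define s where "s = x $ 1 * w $ 1 + x $ 2 * w $ 2"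
  define z1 where "z1 = w $ 1 + \<epsilon> * \<phi> * x $ 2"
  define z2 where "z2 = w $ 2 - \<epsilon> * \<phi> * x $ 1"
  define Q where "Q = z1\<^sup>2 + z2\<^sup>2 + s\<^sup>2 / D"
  have MH: "M * H = Q - D * \<phi>\<^sup>2"
  proof -
    have "D * (M * H) = D * (z1\<^sup>2 + z2\<^sup>2 - D * \<phi>\<^sup>2) + s\<^sup>2"
    proof -
      define c where "c = L * \<phi> + \<epsilon> * (x $ 1 * w $ 2 - x $ 2 * w $ 1)"
      have e: "D * (c * nav_dy \<epsilon> k (x, y) + M * f' k)
          = D * (w $ k - \<epsilon> * \<phi> * rotation_field x $ k) + s * x $ k" for k
        unfolding c_def f'_eq using pos by (simp add: s_def field_simps)
      have "D * (c * \<phi> + M * H) = w $ 1 * (D * (c * nav_dy \<epsilon> 1 (x, y) + M * f' 1))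
          + w $ 2 * (D * (c * nav_dy \<epsilon> 2 (x, y) + M * f' 2))"
        by (simp add: \<phi> H_def algebra_simps)
      also have "\<dots> = D * ((w $ 1)\<^sup>2 + (w $ 2)\<^sup>2 - \<epsilon> * \<phi> * (x $ 1 * w $ 2 - x $ 2 * w $ 1)) + s\<^sup>2"
        unfolding e by (simp add: s_def power2_eq_square algebra_simps)
      also have "(w $ 1)\<^sup>2 + (w $ 2)\<^sup>2 - \<epsilon> * \<phi> * (x $ 1 * w $ 2 - x $ 2 * w $ 1)
          = z1\<^sup>2 + z2\<^sup>2 - D * \<phi>\<^sup>2 + c * \<phi>"
        by (simp add: z1_def z2_def D_def c_def L_def power2_eq_square algebra_simps)
      finally show ?thesis
        by (simp add: algebra_simps)
    qed
    then show ?thesis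
      using pos by (simp add: Q_def field_simps)
  qed
  have CS: "D * \<phi>\<^sup>2 \<le> Q"
  proof -
    have "D * F * \<phi> = n1 * z1 + n2 * z2 + \<theta> * s"
      using p.Mf p.M_eq \<phi> z1_def z2_def s_def by algebra
    moreover have "D * F\<^sup>2 = n1\<^sup>2 + n2\<^sup>2 + D * \<theta>\<^sup>2"
      unfolding p.F_eq p.\<theta>D[symmetric] by (simp add: power2_eq_square algebra_simps)
    \<comment> \<open>Lagrange's identity, multiplied by D, for the vectors (n1, n2, sqrt D
      \<theta>) and (z1, z2, s / sqrt D): their squared lengths are D F^2 and Q, and their inner
      product is D F \<phi>.\<close>
    ultimately have "(D * F\<^sup>2) * (D * (z1\<^sup>2 + z2\<^sup>2) + s\<^sup>2) - D * (D * F * \<phi>)\<^sup>2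
        = D * (n1 * z2 - n2 * z1)\<^sup>2 + (n1 * s - D * \<theta> * z1)\<^sup>2 + (n2 * s - D * \<theta> * z2)\<^sup>2"
      by algebra
    then have "0 \<le> (D * F\<^sup>2) * (D * (z1\<^sup>2 + z2\<^sup>2) + s\<^sup>2) - D * (D * F * \<phi>)\<^sup>2"
      using pos by simp
    also have "\<dots> = (D * D * F\<^sup>2) * (Q - D * \<phi>\<^sup>2)"
      using pos by (simp add: Q_def field_simps power2_eq_square)
    finally have "(D * D * F\<^sup>2) * 0 \<le> (D * D * F\<^sup>2) * (Q - D * \<phi>\<^sup>2)"
      by simp
    moreover have "D * D * F\<^sup>2 > 0"
      using pos by simp
    ultimately have "0 \<le> Q - D * \<phi>\<^sup>2"
      by (rule mult_left_le_imp_le)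
    then show ?thesis
      by simp
  qed
  then have "H \<ge> 0"
    using MH pos mult_left_le_imp_le[of M 0 H] by simp
  show ?thesis
  \<comment> \<open>H itself may vanish, as it does in the direction y. If \<phi> is nonzero,
    \<phi>^2 gives strictness; if \<phi> = 0 then \<zeta> = w, so Q > 0 and hence H > 0.\<close>
  proof (cases "\<phi> = 0")
    case True
    have "Q > 0"
      unfolding Q_def z1_def z2_def True using w pos
      by (auto simp: vec2_nonzero_iff intro!: add_pos_nonneg)
    then have "H > 0"
      using MH pos True zero_less_mult_pos[of M H] by simp
    then show ?thesis
      using g pos True by simp
  next
    case False
    then show ?thesis
      using g pos \<open>H \<ge> 0\<close> by (simp add: add_pos_nonneg)
  qed
qed

section \<open>Geodesics and curvature\<close>

lemma axis_2_nth [simp]: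
  "axis (1::2) (c::real) $ 1 = c" "axis (1::2) (c::real) $ 2 = 0"
  "axis (2::2) (c::real) $ 1 = 0" "axis (2::2) (c::real) $ 2 = c"
  by (simp_all add: axis_def)

locale nav_tangent_point =
  fixes \<epsilon> :: real and x y :: "real ^ 2"
  assumes z: "(x, y) \<in> nav_tangent \<epsilon>"
begin

sublocale p: nav_point "x $ 1" "x $ 2" "y $ 1" "y $ 2" \<epsilon> "randers_F \<epsilon> (x, y)"
    "nav_dy \<epsilon> 1 (x, y)" "nav_dy \<epsilon> 2 (x, y)" "nav_dx \<epsilon> 1 (x, y)" "nav_dx \<epsilon> 2 (x, y)"
    "1 - (x $ 1)\<^sup>2 - (x $ 2)\<^sup>2" "1 - (1 + \<epsilon>\<^sup>2) * ((x $ 1)\<^sup>2 + (x $ 2)\<^sup>2)"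
    "x $ 1 * y $ 2 - x $ 2 * y $ 1"
    "(1 - (1 + \<epsilon>\<^sup>2) * ((x $ 1)\<^sup>2 + (x $ 2)\<^sup>2)) * randers_F \<epsilon> (x, y) + \<epsilon> * (x $ 1 * y $ 2 - x $ 2 * y $ 1)"
    "x $ 1 * y $ 1 + x $ 2 * y $ 2" "nav_theta (x, y)" "nav_eta \<epsilon> (x, y) $ 1" "nav_eta \<epsilon> (x, y) $ 2"
  using nav_pointI[OF z] by (simp add: nav_theta_def nav_eta_def)

lemma nav_B_eq: "nav_B \<epsilon> (x, y) $ 1 = p.B1" "nav_B \<epsilon> (x, y) $ 2 = p.B2"
  by (simp_all add: nav_B_def p.B1_def p.B2_def)

lemma nav_connection_eq:
  "nav_connection \<epsilon> 1 1 (x, y) = p.N11" "nav_connection \<epsilon> 1 2 (x, y) = p.N12"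
  "nav_connection \<epsilon> 2 1 (x, y) = p.N21" "nav_connection \<epsilon> 2 2 (x, y) = p.N22"
  by (simp_all add: nav_connection_def p.N11_def p.N12_def p.N21_def p.N22_def nav_B_eq)

lemma nav_spray_eq: "nav_spray \<epsilon> (x, y) $ 1 = p.G1" "nav_spray \<epsilon> (x, y) $ 2 = p.G2"
  by (simp_all add: nav_spray_def p.G1_def p.G2_def algebra_simps)

lemma nav_spray_dy:
  "frechet_derivative (\<lambda>z. nav_spray \<epsilon> z $ i) (at (x, y)) (0, axis k 1) = nav_connection \<epsilon> i k (x, y)"
proof -
  have "\<forall>i k. frechet_derivative (\<lambda>z. nav_spray \<epsilon> z $ i) (at (x, y)) (0, axis k 1) = nav_connection \<epsilon> i k (x, y)"
    unfolding forall_2 nav_spray_derivative[OF z] nav_theta_derivative[OF z]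
    by (simp add: nav_connection_def algebra_simps)
  then show ?thesis
    by blast
qed

lemma nav_spray_dx:
  fixes k :: 2
  defines "t \<equiv> (y $ k + 2 * nav_theta (x, y) * x $ k) / (1 - (x $ 1)\<^sup>2 - (x $ 2)\<^sup>2)"
  shows "frechet_derivative (\<lambda>z. nav_spray \<epsilon> z $ 1) (at (x, y)) (axis k 1, 0)
      = t * nav_eta \<epsilon> (x, y) $ 1 - \<epsilon> * nav_dx \<epsilon> k (x, y) * p.B1
        + \<epsilon> * randers_F \<epsilon> (x, y) * nav_theta (x, y) * axis k 1 $ 2 - \<epsilon>\<^sup>2 * (randers_F \<epsilon> (x, y))\<^sup>2 * axis k 1 $ 1 / 2"
    and "frechet_derivative (\<lambda>z. nav_spray \<epsilon> z $ 2) (at (x, y)) (axis k 1, 0)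
      = t * nav_eta \<epsilon> (x, y) $ 2 - \<epsilon> * nav_dx \<epsilon> k (x, y) * p.B2
        - \<epsilon> * randers_F \<epsilon> (x, y) * nav_theta (x, y) * axis k 1 $ 1 - \<epsilon>\<^sup>2 * (randers_F \<epsilon> (x, y))\<^sup>2 * axis k 1 $ 2 / 2"
proof -
  have "axis k 1 $ 1 * y $ 1 + axis k 1 $ 2 * y $ 2 = y $ k" "x $ 1 * axis k 1 $ 1 + x $ 2 * axis k 1 $ 2 = x $ k"
    using exhaust_2[of k] by auto
  then have "frechet_derivative nav_theta (at (x, y)) (axis k 1, 0) = t"
    unfolding nav_theta_derivative[OF z] t_def by (simp add: algebra_simps)
  then show "frechet_derivative (\<lambda>z. nav_spray \<epsilon> z $ 1) (at (x, y)) (axis k 1, 0)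
      = t * nav_eta \<epsilon> (x, y) $ 1 - \<epsilon> * nav_dx \<epsilon> k (x, y) * p.B1
        + \<epsilon> * randers_F \<epsilon> (x, y) * nav_theta (x, y) * axis k 1 $ 2 - \<epsilon>\<^sup>2 * (randers_F \<epsilon> (x, y))\<^sup>2 * axis k 1 $ 1 / 2"
    "frechet_derivative (\<lambda>z. nav_spray \<epsilon> z $ 2) (at (x, y)) (axis k 1, 0)
      = t * nav_eta \<epsilon> (x, y) $ 2 - \<epsilon> * nav_dx \<epsilon> k (x, y) * p.B2
        - \<epsilon> * randers_F \<epsilon> (x, y) * nav_theta (x, y) * axis k 1 $ 1 - \<epsilon>\<^sup>2 * (randers_F \<epsilon> (x, y))\<^sup>2 * axis k 1 $ 2 / 2"
    unfolding nav_spray_derivative[OF z] by (simp_all add: nav_B_eq)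
qed

lemma spray_F: "(\<Sum>q\<in>UNIV. y $ q * nav.Fx \<epsilon> q (x, y)) = 2 * (\<Sum>q\<in>UNIV. nav_spray \<epsilon> (x, y) $ q * nav.Fy \<epsilon> q (x, y))"
  using p.X_y by (simp add: sum_2 nav.Fx_def nav.Fy_def nav_spray_eq)

lemma Fx_connection: "nav.Fx \<epsilon> k (x, y) = (\<Sum>j\<in>UNIV. nav_connection \<epsilon> j k (x, y) * nav.Fy \<epsilon> j (x, y))"
  using p.X_N exhaust_2[of k] by (auto simp: sum_2 nav.Fx_def nav.Fy_def nav_connection_eq)

end

lemma nav_tangent_pointI: "z \<in> nav_tangent \<epsilon> \<Longrightarrow> nav_tangent_point \<epsilon> (fst z) (snd z)"
  by (simp add: nav_tangent_point_def)

context nav_tangent_point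
begin

lemma euler_lagrange:
  "(\<Sum>q\<in>UNIV. y $ q * frechet_derivative (nav.Fy \<epsilon> k) (at (x, y)) (axis q 1, 0))
    - 2 * (\<Sum>q\<in>UNIV. nav_spray \<epsilon> (x, y) $ q * frechet_derivative (nav.Fy \<epsilon> k) (at (x, y)) (0, axis q 1))
    = nav.Fx \<epsilon> k (x, y)"
  using nav.euler_lagrangeI[OF z, of "nav_spray \<epsilon>" k] nav_tangent_point.spray_F[OF nav_tangent_pointI]
  by (simp add: smooth_nav_spray nav_spray_dy Fx_connection)

lemma fundamental_tensor_pos:
  "w \<noteq> 0 \<Longrightarrow> w \<bullet> (fundamental_tensor (\<lambda>x y. randers_F \<epsilon> (x, y)) x y *v w) > 0"
  unfolding nav.fundamental_tensor_quadratic[OF z] by (rule nav_hessian_pos[OF z])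

lemma geodesic_coeff_eq: "geodesic_coeff (\<lambda>x y. randers_F \<epsilon> (x, y)) x y = nav_spray \<epsilon> (x, y)"
  using spray_F euler_lagrange
  by (intro nav.geodesic_coeff_eqI[OF z] pos_def_invertible fundamental_tensor_pos) auto

lemma F_along_spray: "frechet_derivative (randers_F \<epsilon>) (at (x, y)) (y, - 2 *\<^sub>R nav_spray \<epsilon> (x, y)) = 0"
  using frechet_pair_expand[OF smooth_randers_F z, of y "- 2 *\<^sub>R nav_spray \<epsilon> (x, y)"] spray_F
  by (simp add: sum_2 nav.Fx_def nav.Fy_def)

lemma Fy_along_spray:
  "frechet_derivative (nav_dy \<epsilon> k) (at (x, y)) (y, - 2 *\<^sub>R nav_spray \<epsilon> (x, y)) = nav_dx \<epsilon> k (x, y)"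
  using frechet_pair_expand[OF nav.Fy_smooth z, of k y "- 2 *\<^sub>R nav_spray \<epsilon> (x, y)"] euler_lagrange[of k]
  by (simp add: sum_2 nav.Fx_def nav.Fy_def[abs_def])

text \<open>The second derivatives of F in the derivative of N occur only as the derivative of
  F_{y^k} along the spray, which is F_{x^k}; the terms with the derivative of F itself
  vanish.\<close>

lemma connection_along_spray:
  fixes i k :: 2
  defines "f' \<equiv> nav_dx \<epsilon> k (x, y)" and "f \<equiv> nav_dy \<epsilon> k (x, y)"
    and "D \<equiv> 1 - (x $ 1)\<^sup>2 - (x $ 2)\<^sup>2"
  shows "frechet_derivative (nav_connection \<epsilon> i k) (at (x, y)) (y, - 2 *\<^sub>R nav_spray \<epsilon> (x, y))
    = (y $ k + 2 * nav_theta (x, y) * x $ k) / D * nav_eta \<epsilon> (x, y) $ i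
      + x $ k / D * (if i = 1 then p.n1' else p.n2') + (if i = k then p.\<theta>' else 0)
      - \<epsilon> * (f' * nav_B \<epsilon> (x, y) $ i + f * (if i = 1 then p.B1' else p.B2'))"
proof -
  have th: "frechet_derivative nav_theta (at (x, y)) (y, - 2 *\<^sub>R nav_spray \<epsilon> (x, y)) = p.\<theta>'"
    unfolding nav_theta_derivative[OF z] p.\<theta>'_def
    by (simp add: nav_spray_eq power2_eq_square algebra_simps)
  define \<eta>' where "\<eta>' = - 2 *\<^sub>R nav_spray \<epsilon> (x, y) - (\<epsilon> * 0) *\<^sub>R rotation_field x
      - (\<epsilon> * randers_F \<epsilon> (x, y)) *\<^sub>R rotation_field y"
  define B' where "B' = p.\<theta>' *\<^sub>R rotation_field x + nav_theta (x, y) *\<^sub>R rotation_field y + rotation_field \<eta>'"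
  have \<eta>': "\<eta>' $ i = (if i = 1 then p.n1' else p.n2')" for i
    using exhaust_2[of i] by (auto simp: \<eta>'_def p.n1'_def p.n2'_def nav_spray_eq)
  have B': "B' $ i = (if i = 1 then p.B1' else p.B2')" for i
    using exhaust_2[of i] by (auto simp: B'_def \<eta>' p.B1'_def p.B2'_def)
  have q: "(y $ k + 2 * (x $ k / D) * (x $ 1 * y $ 1 + x $ 2 * y $ 2)) / D
      = (y $ k + 2 * nav_theta (x, y) * x $ k) / D"
    by (simp add: nav_theta_def D_def)
  show ?thesis
    unfolding nav_connection_derivative[OF z, of i k y "- 2 *\<^sub>R nav_spray \<epsilon> (x, y)", folded D_def,
        unfolded F_along_spray Fy_along_spray th, folded \<eta>'_def, folded B'_def] q \<eta>' B' f_def f'_def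
    by simp
qed

lemma curvature:
  "riemann_curvature (\<lambda>x y. randers_F \<epsilon> (x, y)) i k x y
    = - ((randers_F \<epsilon> (x, y))\<^sup>2 * (if i = k then 1 else 0) - randers_F \<epsilon> (x, y) * nav_dy \<epsilon> k (x, y) * y $ i)"
proof -
  let ?G = "\<lambda>i x y. geodesic_coeff (\<lambda>x y. randers_F \<epsilon> (x, y)) x y $ i"
  have G: "?G i x y = nav_spray \<epsilon> (x, y) $ i" if "(x, y) \<in> nav_tangent \<epsilon>" for i x y
    using nav_tangent_point.geodesic_coeff_eq[of \<epsilon> x y] that by (simp add: nav_tangent_point_def)
  have Gx: "partial_deriv k (\<lambda>z. ?G i z y) x
      = frechet_derivative (\<lambda>z. nav_spray \<epsilon> z $ i) (at (x, y)) (axis k 1, 0)"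
    by (rule partial_deriv_fst[OF smooth_nav_spray open_nav_tangent z]) (rule G)
  have Gy: "partial_deriv k (?G i x) y = nav_connection \<epsilon> i k (x, y)" if "(x, y) \<in> nav_tangent \<epsilon>" for i k x y
    using partial_deriv_snd[OF smooth_nav_spray open_nav_tangent that G]
      nav_tangent_point.nav_spray_dy[of \<epsilon> x y] that by (simp add: nav_tangent_point_def)
  have Gyx: "partial_deriv j (\<lambda>z. partial_deriv k (?G i z) y) x
      = frechet_derivative (nav_connection \<epsilon> i k) (at (x, y)) (axis j 1, 0)" for j
    by (rule partial_deriv_fst[OF smooth_nav_connection open_nav_tangent z]) (rule Gy)
  have Gyy: "partial_deriv j (partial_deriv k (?G i x)) y
      = frechet_derivative (nav_connection \<epsilon> i k) (at (x, y)) (0, axis j 1)" for j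
    by (rule partial_deriv_snd[OF smooth_nav_connection open_nav_tangent z]) (rule Gy)
  \<comment> \<open>The two middle terms of the curvature combine into minus the derivative of N in
    the single direction (y, - 2 G).\<close>
  have "riemann_curvature (\<lambda>x y. randers_F \<epsilon> (x, y)) i k x y
      = 2 * frechet_derivative (\<lambda>z. nav_spray \<epsilon> z $ i) (at (x, y)) (axis k 1, 0)
        - frechet_derivative (nav_connection \<epsilon> i k) (at (x, y)) (y, - 2 *\<^sub>R nav_spray \<epsilon> (x, y))
        - (\<Sum>j\<in>UNIV. nav_connection \<epsilon> i j (x, y) * nav_connection \<epsilon> j k (x, y))"
    (is "_ = ?R i k")
    unfolding riemann_curvature_def Let_def Gx Gyx Gyy Gy[OF z] G[OF z]
      frechet_pair_expand[OF smooth_nav_connection z, of i k y "- 2 *\<^sub>R nav_spray \<epsilon> (x, y)"]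
    by (simp add: sum_2)
  also have "\<dots> = - ((randers_F \<epsilon> (x, y))\<^sup>2 * (if i = k then 1 else 0) - randers_F \<epsilon> (x, y) * nav_dy \<epsilon> k (x, y) * y $ i)"
  proof -
    consider "i = 1" "k = 1" | "i = 1" "k = 2" | "i = 2" "k = 1" | "i = 2" "k = 2"
      using exhaust_2[of i] exhaust_2[of k] by blast
    then show ?thesis
    proof cases
      case 1
      have "?R i k = p.R11"
        unfolding p.R11_def p.t1_def connection_along_spray nav_spray_dx nav_connection_eq nav_B_eq sum_2 1 axis_2_nth
        by (simp add: algebra_simps)
      then show ?thesis
        unfolding p.curvature_identity using 1 by simp
    next
      case 2
      have "?R i k = p.R12"
        unfolding p.R12_def p.t2_def connection_along_spray nav_spray_dx nav_connection_eq nav_B_eq sum_2 2 axis_2_nth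
        by (simp add: algebra_simps)
      then show ?thesis
        unfolding p.curvature_identity using 2 by simp
    next
      case 3
      have "?R i k = p.R21"
        unfolding p.R21_def p.t1_def connection_along_spray nav_spray_dx nav_connection_eq nav_B_eq sum_2 3 axis_2_nth
        by (simp add: algebra_simps)
      then show ?thesis
        unfolding p.curvature_identity using 3 by simp
    next
      case 4
      have "?R i k = p.R22"
        unfolding p.R22_def p.t2_def connection_along_spray nav_spray_dx nav_connection_eq nav_B_eq sum_2 4 axis_2_nth
        by (simp add: algebra_simps)
      then show ?thesis
        unfolding p.curvature_identity using 4 by simp
    qed
  qed
  finally show ?thesis .
qed

end

lemma randers_constant_curvature:
  "has_constant_curvature_on (nav_domain \<epsilon>) (\<lambda>x y. randers_F \<epsilon> (x, y)) (- 1)"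
  unfolding has_constant_curvature_on_def
proof (intro ballI allI impI)
  fix x y :: "real ^ 2" and i k :: 2
  assume "x \<in> nav_domain \<epsilon>" "y \<noteq> 0"
  then have z: "(x, y) \<in> nav_tangent \<epsilon>"
    by (simp add: nav_tangent_def)
  have "partial_deriv k (\<lambda>y. randers_F \<epsilon> (x, y)) y = nav_dy \<epsilon> k (x, y)"
    by (rule partial_deriv_snd[OF smooth_randers_F open_nav_tangent z]) (rule refl)
  then show "riemann_curvature (\<lambda>x y. randers_F \<epsilon> (x, y)) i k x y = - 1 * ((randers_F \<epsilon> (x, y))\<^sup>2 * (if i = k then 1 else 0)
      - randers_F \<epsilon> (x, y) * partial_deriv k (\<lambda>y. randers_F \<epsilon> (x, y)) y * y $ i)"
    using nav_tangent_point.curvature[of \<epsilon> x y i k] z by (simp add: nav_tangent_point_def)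
qed

section \<open>The S-curvature\<close>

text \<open>Let P(t) = D L t^2 + 2 \<epsilon> D w t - (N - w^2). Then P(F) = 0 and P(1) = D^2 (1 -
  h(y - \<epsilon> J x, y - \<epsilon> J x)), so P(1) - P(F) has the factor 1 - F. The cofactor D (L
  + L F + 2 \<epsilon> w) is positive, since F (L F + 2 \<epsilon> w) = (N - w^2) / D.\<close>

lemma klein_wind_shift:
  fixes x y :: "real ^ 2"
  assumes x: "x \<in> nav_domain \<epsilon>"
  obtains c where "c > 0" and "klein x (y - \<epsilon> *\<^sub>R rotation_field x) (y - \<epsilon> *\<^sub>R rotation_field x)
    = 1 - c * (1 - randers_F \<epsilon> (x, y))"
proof -
  define D where "D = 1 - (x $ 1)\<^sup>2 - (x $ 2)\<^sup>2"
  define L where "L = 1 - (1 + \<epsilon>\<^sup>2) * ((x $ 1)\<^sup>2 + (x $ 2)\<^sup>2)"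
  define w where "w = x $ 1 * y $ 2 - x $ 2 * y $ 1"
  define N where "N = (y $ 1)\<^sup>2 + (y $ 2)\<^sup>2"
  define F where "F = randers_F \<epsilon> (x, y)"
  have pos: "D > 0" "L > 0"
    using nav_domain_pos[OF x] by (auto simp: D_def L_def)
  have quad: "D * L * F\<^sup>2 + 2 * \<epsilon> * D * w * F = N - w\<^sup>2"
    using randers_F_quadratic(1)[OF x, of y] by (simp add: D_def L_def F_def w_def N_def)
  have "L * F + 2 * \<epsilon> * w \<ge> 0"
  proof (cases "y = 0")
    case True
    then show ?thesis
      by (simp add: F_def randers_F_0 w_def)
  next
    case False
    then have "F > 0"
      using randers_F_pos[of "(x, y)" \<epsilon>] x by (simp add: F_def nav_tangent_def)
    moreover have "(D * F) * (L * F + 2 * \<epsilon> * w) = N - w\<^sup>2"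
      using quad by (simp add: power2_eq_square algebra_simps)
    moreover have "N - w\<^sup>2 \<ge> 0"
      using randers_formula(4)[OF x, of y] by (simp add: N_def w_def)
    ultimately show ?thesis
      using pos mult_left_le_imp_le[of "D * F" 0 "L * F + 2 * \<epsilon> * w"] by simp
  qed
  then have c: "D * (L + (L * F + 2 * \<epsilon> * w)) / D\<^sup>2 > 0"
    using pos by (intro mult_pos_pos divide_pos_pos add_pos_nonneg) auto
  have "klein x (y - \<epsilon> *\<^sub>R rotation_field x) (y - \<epsilon> *\<^sub>R rotation_field x)
      = (N - w\<^sup>2 - 2 * \<epsilon> * D * w + \<epsilon>\<^sup>2 * (1 - D) * D) / D\<^sup>2"
    by (simp add: klein_diag D_def N_def w_def power2_eq_square algebra_simps)
  also have "N - w\<^sup>2 - 2 * \<epsilon> * D * w + \<epsilon>\<^sup>2 * (1 - D) * D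
      = D\<^sup>2 - D * (L + (L * F + 2 * \<epsilon> * w)) * (1 - F)"
    unfolding quad[symmetric] by (simp add: D_def L_def power2_eq_square algebra_simps)
  also have "\<dots> / D\<^sup>2 = 1 - D * (L + (L * F + 2 * \<epsilon> * w)) / D\<^sup>2 * (1 - F)"
    using pos by (simp add: diff_divide_distrib)
  finally show thesis
    using that[OF c] by (simp add: F_def)
qed

lemma randers_F_less_1_iff:
  assumes "x \<in> nav_domain \<epsilon>"
  shows "randers_F \<epsilon> (x, y) < 1 \<longleftrightarrow>
    klein x (y - \<epsilon> *\<^sub>R rotation_field x) (y - \<epsilon> *\<^sub>R rotation_field x) < 1"
  by (rule klein_wind_shift[OF assms, of y]) (simp add: zero_less_mult_iff)

lemma randers_F_eq_1_iff:
  assumes "x \<in> nav_domain \<epsilon>"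
  shows "randers_F \<epsilon> (x, y) = 1 \<longleftrightarrow>
    klein x (y - \<epsilon> *\<^sub>R rotation_field x) (y - \<epsilon> *\<^sub>R rotation_field x) = 1"
  by (rule klein_wind_shift[OF assms, of y]) auto

lemma klein_unit_ball:
  fixes x :: "real ^ 2"
  assumes D: "1 - (x $ 1)\<^sup>2 - (x $ 2)\<^sup>2 > 0"
  obtains A :: "real ^ 2 ^ 2"
  where "{u. klein x u u < 1} = (*v) A ` ball 0 1"
    and "det A = (1 - (x $ 1)\<^sup>2 - (x $ 2)\<^sup>2) * sqrt (1 - (x $ 1)\<^sup>2 - (x $ 2)\<^sup>2)"
proof -
  define D where "D = 1 - (x $ 1)\<^sup>2 - (x $ 2)\<^sup>2"
  define c where "c = 1 - (x $ 2)\<^sup>2"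
  have pos: "D > 0" "c > 0"
    using D zero_le_power2[of "x $ 1"] unfolding D_def c_def by linarith+
  \<comment> \<open>Completing the square in the first coordinate: c D^2 h(u, u) = (c u_1 + x_1 x_2
    u_2)^2 + D u_2^2. The triangular matrix with entries p, q, r inverts the normalization of these
    two squares.\<close>
  define p where "p = D / sqrt c"
  define r where "r = sqrt (c * D)"
  define q where "q = - (x $ 1 * x $ 2 / c) * r"
  define A :: "real ^ 2 ^ 2" where "A = vector [vector [p, q], vector [0, r]]"
  have A: "(A *v v) $ 1 = p * v $ 1 + q * v $ 2" "(A *v v) $ 2 = r * v $ 2" for v
    by (simp_all add: A_def matrix_vector_mult_def sum_2)
  have nz: "p \<noteq> 0" "r \<noteq> 0"
    using pos by (simp_all add: p_def r_def)
  have sq: "p\<^sup>2 = D\<^sup>2 / c" "r\<^sup>2 = c * D"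
    using pos by (simp_all add: p_def r_def power_divide)
  have norm: "klein x (A *v v) (A *v v) = (norm v)\<^sup>2" for v
  proof -
    define u where "u = A *v v"
    have "c * u $ 1 + x $ 1 * x $ 2 * u $ 2 = c * p * v $ 1"
      using pos by (simp add: u_def A q_def field_simps)
    then have "(c * u $ 1 + x $ 1 * x $ 2 * u $ 2)\<^sup>2 = c * D\<^sup>2 * (v $ 1)\<^sup>2"
      using pos by (simp add: power_mult_distrib sq) (simp add: power2_eq_square)
    moreover have "(u $ 2)\<^sup>2 = c * D * (v $ 2)\<^sup>2"
      by (simp add: u_def A power_mult_distrib sq)
    moreover have "c * ((u $ 1)\<^sup>2 + (u $ 2)\<^sup>2 - (x $ 1 * u $ 2 - x $ 2 * u $ 1)\<^sup>2)
        = (c * u $ 1 + x $ 1 * x $ 2 * u $ 2)\<^sup>2 + D * (u $ 2)\<^sup>2"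
      by (simp add: c_def D_def power2_eq_square algebra_simps)
    ultimately have "c * ((u $ 1)\<^sup>2 + (u $ 2)\<^sup>2 - (x $ 1 * u $ 2 - x $ 2 * u $ 1)\<^sup>2)
        = c * (D\<^sup>2 * ((v $ 1)\<^sup>2 + (v $ 2)\<^sup>2))"
      by (simp add: power2_eq_square algebra_simps)
    then show ?thesis
      using pos by (simp add: klein_diag norm_sq_2 D_def[symmetric] u_def)
  qed
  have surj: "\<exists>v. u = A *v v" for u
    by (rule exI[of _ "vector [(u $ 1 - q * (u $ 2 / r)) / p, u $ 2 / r]"])
      (use nz in \<open>simp add: vec_eq_iff forall_2 A\<close>)
  have "{u. klein x u u < 1} = (*v) A ` ball 0 1"
  proof safe
    fix u assume u: "klein x u u < 1"
    obtain v where v: "u = A *v v"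
      using surj by blast
    then have "(norm v)\<^sup>2 < 1"
      using u norm by simp
    then show "u \<in> (*v) A ` ball 0 1"
      unfolding v by (intro imageI) (simp add: power_less_one_iff)
  next
    fix v :: "real ^ 2" assume "v \<in> ball 0 1"
    then show "klein x (A *v v) (A *v v) < 1"
      by (simp add: norm power_less_one_iff)
  qed
  moreover have "det A = D * sqrt D"
    using pos by (simp add: det_2 A_def p_def r_def real_sqrt_mult)
  ultimately show thesis
    using that by (simp add: D_def)
qed

lemma bh_density_randers:
  assumes x: "x \<in> nav_domain \<epsilon>"
  shows "bh_density (\<lambda>x y. randers_F \<epsilon> (x, y)) x
    = 1 / ((1 - (x $ 1)\<^sup>2 - (x $ 2)\<^sup>2) * sqrt (1 - (x $ 1)\<^sup>2 - (x $ 2)\<^sup>2))"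
proof -
  define D where "D = 1 - (x $ 1)\<^sup>2 - (x $ 2)\<^sup>2"
  have D: "D > 0"
    using nav_domain_pos(2)[OF x] by (simp add: D_def)
  obtain A :: "real ^ 2 ^ 2" where A: "{u. klein x u u < 1} = (*v) A ` ball 0 1" "det A = D * sqrt D"
    using klein_unit_ball[of x] D by (auto simp: D_def)
  have "{y. randers_F \<epsilon> (x, y) < 1} = (+) (\<epsilon> *\<^sub>R rotation_field x) ` {u. klein x u u < 1}"
  proof safe
    fix y assume "randers_F \<epsilon> (x, y) < 1"
    then show "y \<in> (+) (\<epsilon> *\<^sub>R rotation_field x) ` {u. klein x u u < 1}"
      using randers_F_less_1_iff[OF x, of y]
      by (intro image_eqI[of _ _ "y - \<epsilon> *\<^sub>R rotation_field x"]) auto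
  next
    fix u assume "klein x u u < 1"
    then show "randers_F \<epsilon> (x, \<epsilon> *\<^sub>R rotation_field x + u) < 1"
      using randers_F_less_1_iff[OF x] by simp
  qed
  then have "measure lebesgue {y. randers_F \<epsilon> (x, y) < 1} = measure lebesgue ((*v) A ` ball 0 1)"
    by (simp add: measure_translation A)
  also have "\<dots> = \<bar>det A\<bar> * measure lebesgue (ball (0 :: real ^ 2) 1)"
    by (subst measure_linear_image) (auto simp: matrix_of_matrix_vector_mul)
  also have "\<dots> = D * sqrt D * measure lebesgue (ball (0 :: real ^ 2) 1)"
    using D by (simp add: A)
  finally show ?thesis
    using D content_ball_pos[of 1 "0 :: real ^ 2"]
    by (simp add: bh_density_def D_def[symmetric])
qed

text \<open>The density is \<sigma> = D^(-3/2), whose logarithmic derivative along y is 3 <x, y> /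
  D, the trace of the connection.\<close>

lemma randers_s_curvature:
  assumes x: "x \<in> nav_domain \<epsilon>" and y: "y \<noteq> 0"
  shows "s_curvature (\<lambda>x y. randers_F \<epsilon> (x, y)) x y = 0"
proof -
  define D where "D = 1 - (x $ 1)\<^sup>2 - (x $ 2)\<^sup>2"
  have D: "D > 0"
    using nav_domain_pos(2)[OF x] by (simp add: D_def)
  have z: "(x, y) \<in> nav_tangent \<epsilon>"
    using x y by (simp add: nav_tangent_def)
  interpret nav_tangent_point \<epsilon> x y
    by unfold_locales (rule z)
  have N: "partial_deriv i (\<lambda>y. geodesic_coeff (\<lambda>x y. randers_F \<epsilon> (x, y)) x y $ i) y
      = nav_connection \<epsilon> i i (x, y)" for i
    unfolding nav_spray_dy[symmetric]
    by (rule partial_deriv_snd[OF smooth_nav_spray open_nav_tangent z])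
      (simp add: nav_tangent_point.geodesic_coeff_eq[of \<epsilon>] nav_tangent_point_def)
  have \<sigma>: "partial_deriv i (bh_density (\<lambda>x y. randers_F \<epsilon> (x, y))) x = 3 * x $ i / (D\<^sup>2 * sqrt D)" for i
  proof -
    have "partial_deriv i (bh_density (\<lambda>x y. randers_F \<epsilon> (x, y))) x
      = partial_deriv i (\<lambda>x. 1 / ((1 - (x $ 1)\<^sup>2 - (x $ 2)\<^sup>2) * sqrt (1 - (x $ 1)\<^sup>2 - (x $ 2)\<^sup>2))) x"
      by (rule partial_deriv_cong[OF open_nav_domain x]) (rule bh_density_randers)
    also have "\<dots> = 3 * x $ i / (D\<^sup>2 * sqrt D)"
    proof (rule partial_deriv_eqI)
      define den where "den = (\<lambda>t. 1 - ((x + t *\<^sub>R axis i 1) $ 1)\<^sup>2 - ((x + t *\<^sub>R axis i 1) $ 2)\<^sup>2)"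
      have den0: "den 0 = D"
        by (simp add: den_def D_def)
      have "(den has_real_derivative - 2 * x $ i) (at 0)"
        unfolding den_def using exhaust_2[of i] by (auto intro!: derivative_eq_intros)
      moreover from this have "((\<lambda>t. sqrt (den t)) has_real_derivative (inverse (sqrt (den 0)) / 2) * (- 2 * x $ i)) (at 0)"
        using D by (intro DERIV_chain2[OF DERIV_real_sqrt]) (simp_all add: den0)
      ultimately have "((\<lambda>t. 1 / (den t * sqrt (den t))) has_real_derivative
          (0 * (den 0 * sqrt (den 0)) - 1 * ((- 2 * x $ i) * sqrt (den 0)
            + ((inverse (sqrt (den 0)) / 2) * (- 2 * x $ i)) * den 0))
          / ((den 0 * sqrt (den 0)) * (den 0 * sqrt (den 0)))) (at 0)"
        using D by (intro DERIV_divide DERIV_mult DERIV_const) (simp_all add: den0)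
      moreover have "(0 * (den 0 * sqrt (den 0)) - 1 * ((- 2 * x $ i) * sqrt (den 0)
            + ((inverse (sqrt (den 0)) / 2) * (- 2 * x $ i)) * den 0))
          / ((den 0 * sqrt (den 0)) * (den 0 * sqrt (den 0))) = 3 * x $ i / (D\<^sup>2 * sqrt D)"
      proof -
        define q where "q = sqrt D"
        have "q > 0" "D = q * q"
          using D by (simp_all add: q_def)
        then show ?thesis
          unfolding den0 q_def[symmetric] by (simp add: divide_simps power2_eq_square)
      qed
      ultimately show "((\<lambda>t. 1 / ((1 - ((x + t *\<^sub>R axis i 1) $ 1)\<^sup>2 - ((x + t *\<^sub>R axis i 1) $ 2)\<^sup>2)
          * sqrt (1 - ((x + t *\<^sub>R axis i 1) $ 1)\<^sup>2 - ((x + t *\<^sub>R axis i 1) $ 2)\<^sup>2)))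
          has_real_derivative 3 * x $ i / (D\<^sup>2 * sqrt D)) (at 0)"
        by (simp only: den_def)
    qed
    finally show ?thesis .
  qed
  have "y $ i / bh_density (\<lambda>x y. randers_F \<epsilon> (x, y)) x
      * partial_deriv i (bh_density (\<lambda>x y. randers_F \<epsilon> (x, y))) x = 3 * x $ i * y $ i / D" for i
    unfolding \<sigma> bh_density_randers[OF x] D_def[symmetric] using D by (simp add: divide_simps power2_eq_square)
  moreover have "D * (p.N11 + p.N22) = 3 * (x $ 1 * y $ 1 + x $ 2 * y $ 2)"
    unfolding D_def by (rule p.trace_N)
  then have "p.N11 + p.N22 = 3 * (x $ 1 * y $ 1 + x $ 2 * y $ 2) / D"
    using D by (simp add: nonzero_eq_divide_eq mult.commute)
  ultimately show ?thesis
    by (simp add: s_curvature_def N sum_2 nav_connection_eq add_divide_distrib algebra_simps)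
qed

section \<open>The Randers property\<close>

text \<open>The Gram matrix of \<alpha>: eliminating w by Lagrange's identity turns \<alpha>^2 into
  a multiple of |y|^2 plus a multiple of <x, y>^2.\<close>

definition nav_metric :: "real \<Rightarrow> real ^ 2 \<Rightarrow> real ^ 2 ^ 2" where
  "nav_metric \<epsilon> x = (\<chi> i j. ((1 - (x $ 1)\<^sup>2 - (x $ 2)\<^sup>2)\<^sup>2 * (if i = j then 1 else 0)
      + (1 - \<epsilon>\<^sup>2 - (x $ 1)\<^sup>2 - (x $ 2)\<^sup>2) * x $ i * x $ j)
    / ((1 - (x $ 1)\<^sup>2 - (x $ 2)\<^sup>2) * (1 - (1 + \<epsilon>\<^sup>2) * ((x $ 1)\<^sup>2 + (x $ 2)\<^sup>2))\<^sup>2))"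

lemma nav_metric_quadratic:
  fixes x y :: "real ^ 2" and \<epsilon> :: real
  defines "D \<equiv> 1 - (x $ 1)\<^sup>2 - (x $ 2)\<^sup>2"
    and "L \<equiv> 1 - (1 + \<epsilon>\<^sup>2) * ((x $ 1)\<^sup>2 + (x $ 2)\<^sup>2)"
    and "w \<equiv> x $ 1 * y $ 2 - x $ 2 * y $ 1"
    and "N \<equiv> (y $ 1)\<^sup>2 + (y $ 2)\<^sup>2"
  shows "y \<bullet> (nav_metric \<epsilon> x *v y) = (\<epsilon>\<^sup>2 * w\<^sup>2 * D + (N - w\<^sup>2) * L) / (D * L\<^sup>2)"
proof -
  have "y \<bullet> (nav_metric \<epsilon> x *v y)
      = (D\<^sup>2 * N + (1 - \<epsilon>\<^sup>2 - (x $ 1)\<^sup>2 - (x $ 2)\<^sup>2) * (x $ 1 * y $ 1 + x $ 2 * y $ 2)\<^sup>2) / (D * L\<^sup>2)"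
    unfolding inner_vec_def matrix_vector_mult_def nav_metric_def sum_2 D_def[symmetric] L_def[symmetric]
    by (simp add: N_def add_divide_distrib[symmetric] power2_eq_square algebra_simps)
  also have "D\<^sup>2 * N + (1 - \<epsilon>\<^sup>2 - (x $ 1)\<^sup>2 - (x $ 2)\<^sup>2) * (x $ 1 * y $ 1 + x $ 2 * y $ 2)\<^sup>2
      = \<epsilon>\<^sup>2 * w\<^sup>2 * D + (N - w\<^sup>2) * L"
    by (simp add: D_def L_def N_def w_def power2_eq_square algebra_simps)
  finally show ?thesis .
qed

lemma riemannian_norm_randers_alpha: "riemannian_norm_on (nav_domain \<epsilon>) (randers_alpha \<epsilon>)"
  unfolding riemannian_norm_on_def
proof (intro exI[of _ "nav_metric \<epsilon>"] conjI allI ballI impI)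
  show "smooth_on (\<lambda>x. nav_metric \<epsilon> x $ i $ j) (nav_domain \<epsilon>)" for i j
    unfolding nav_metric_def vec_lambda_beta
    by (intro smooth_on_intros smooth_on_nth open_nav_domain) (auto dest: nav_domain_pos)
next
  fix x y :: "real ^ 2" assume x: "x \<in> nav_domain \<epsilon>"
  show "transpose (nav_metric \<epsilon> x) = nav_metric \<epsilon> x"
    by (simp add: vec_eq_iff transpose_def nav_metric_def mult_ac)
  show "0 < y \<bullet> (nav_metric \<epsilon> x *v y)" if "y \<noteq> 0"
    unfolding nav_metric_quadratic by (rule randers_formula(3)[OF x that])
  show "randers_alpha \<epsilon> x y = sqrt (y \<bullet> (nav_metric \<epsilon> x *v y))"
    unfolding nav_metric_quadratic by (rule randers_formula(1)[OF x])
qed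

lemma one_form_randers_beta: "one_form_on (nav_domain \<epsilon>) (randers_beta \<epsilon>)"
  unfolding one_form_on_def
proof (intro exI conjI ballI allI)
  let ?L = "\<lambda>x :: real ^ 2. 1 - (1 + \<epsilon>\<^sup>2) * ((x $ 1)\<^sup>2 + (x $ 2)\<^sup>2)"
  let ?b = "\<lambda>x :: real ^ 2. (\<epsilon> * x $ 2 / ?L x) *\<^sub>R axis 1 1 + (- (\<epsilon> * x $ 1) / ?L x) *\<^sub>R axis 2 (1 :: real) :: real ^ 2"
  have "smooth_on (\<lambda>x. \<epsilon> * x $ 2 / ?L x) (nav_domain \<epsilon>)" "smooth_on (\<lambda>x. - (\<epsilon> * x $ 1) / ?L x) (nav_domain \<epsilon>)"
    by (intro smooth_on_intros smooth_on_nth open_nav_domain; use nav_domain_pos(1) in force)+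
  then show "smooth_on ?b (nav_domain \<epsilon>)"
    by (intro smooth_on_add open_nav_domain
        smooth_on_compose_bounded_linear[OF bounded_linear_scaleR_left])
  show "randers_beta \<epsilon> x y = ?b x \<bullet> y" if "x \<in> nav_domain \<epsilon>" for x y
    using randers_formula(2)[OF that, of y] nav_domain_pos(1)[OF that]
    by (simp add: inner_vec_def sum_2 diff_divide_distrib[symmetric]) (simp add: divide_simps algebra_simps)
qed

text \<open>The witness q = sqrt (\<epsilon>^2 |x|^2 / D) is the Klein length of the wind \<epsilon>
  J x. A bound uniform in y is wanted, since a supremum of numbers below 1 could still be 1.\<close>

lemma randers_beta_bound:
  assumes x: "x \<in> nav_domain \<epsilon>"
  obtains q where "q < 1" "\<And>y. randers_beta \<epsilon> x y \<le> q * randers_alpha \<epsilon> x y"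
proof
  define s where "s = (x $ 1)\<^sup>2 + (x $ 2)\<^sup>2"
  define D where "D = 1 - (x $ 1)\<^sup>2 - (x $ 2)\<^sup>2"
  define L where "L = 1 - (1 + \<epsilon>\<^sup>2) * ((x $ 1)\<^sup>2 + (x $ 2)\<^sup>2)"
  have pos: "D > 0" "L > 0"
    using nav_domain_pos[OF x] by (simp_all add: D_def L_def)
  \<comment> \<open>The difference D - \<epsilon>^2 s is L.\<close>
  have "\<epsilon>\<^sup>2 * s < D"
    using pos by (simp add: D_def L_def s_def algebra_simps)
  then show "sqrt (\<epsilon>\<^sup>2 * s / D) < 1"
    using pos by (simp add: real_sqrt_lt_1_iff)
  fix y :: "real ^ 2"
  define w where "w = x $ 1 * y $ 2 - x $ 2 * y $ 1"
  define N where "N = (y $ 1)\<^sup>2 + (y $ 2)\<^sup>2"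
  define A where "A = (\<epsilon>\<^sup>2 * w\<^sup>2 * D + (N - w\<^sup>2) * L) / (D * L\<^sup>2)"
  have alpha: "randers_alpha \<epsilon> x y = sqrt A"
    using randers_formula(1)[OF x, of y] by (simp add: A_def D_def L_def w_def N_def)
  have beta: "randers_beta \<epsilon> x y = - (\<epsilon> * w / L)"
    using randers_formula(2)[OF x, of y] by (simp add: L_def w_def)
  have "\<epsilon>\<^sup>2 * s / D * A - (\<epsilon> * w / L)\<^sup>2 = (\<epsilon> * (x $ 1 * y $ 1 + x $ 2 * y $ 2))\<^sup>2 / (D\<^sup>2 * L)"
  proof -
    have "s * (\<epsilon>\<^sup>2 * w\<^sup>2 * D + (N - w\<^sup>2) * L) - w\<^sup>2 * D\<^sup>2 = (x $ 1 * y $ 1 + x $ 2 * y $ 2)\<^sup>2 * L"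
      by (simp add: s_def w_def N_def D_def L_def power2_eq_square algebra_simps)
    then have "\<epsilon>\<^sup>2 * (s * (\<epsilon>\<^sup>2 * w\<^sup>2 * D + (N - w\<^sup>2) * L) - w\<^sup>2 * D\<^sup>2) / (D\<^sup>2 * L\<^sup>2)
        = \<epsilon>\<^sup>2 * ((x $ 1 * y $ 1 + x $ 2 * y $ 2)\<^sup>2 * L) / (D\<^sup>2 * L\<^sup>2)"
      by simp
    also have "\<dots> = (\<epsilon> * (x $ 1 * y $ 1 + x $ 2 * y $ 2))\<^sup>2 / (D\<^sup>2 * L)"
      using pos by (simp add: power_mult_distrib power2_eq_square mult_ac)
    finally show ?thesis
      using pos by (simp add: A_def diff_divide_distrib right_diff_distrib power_mult_distrib power_divide power2_eq_square mult_ac)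
  qed
  also have "\<dots> \<ge> 0"
    using pos by simp
  finally have "(\<epsilon> * w / L)\<^sup>2 \<le> \<epsilon>\<^sup>2 * s / D * A"
    by simp
  then have "\<bar>\<epsilon> * w / L\<bar> \<le> sqrt (\<epsilon>\<^sup>2 * s / D * A)"
    by (intro real_le_rsqrt) (simp only: power2_abs)
  then show "randers_beta \<epsilon> x y \<le> sqrt (\<epsilon>\<^sup>2 * s / D) * randers_alpha \<epsilon> x y"
    unfolding alpha beta real_sqrt_mult by linarith
qed

lemma randers_F_homogeneous:
  assumes "x \<in> nav_domain \<epsilon>" "c > 0"
  shows "randers_F \<epsilon> (x, c *\<^sub>R y) = c * randers_F \<epsilon> (x, y)"
proof -
  have lin: "klein x u (c *\<^sub>R v) = c * klein x u v" "klein x (c *\<^sub>R u) v = c * klein x u v" for u v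
    by (simp_all add: klein_def algebra_simps)
  define v where "v = rotation_field x"
  have "\<epsilon>\<^sup>2 * (c * klein x v y)\<^sup>2 + c * (c * klein x y y) * (1 - \<epsilon>\<^sup>2 * klein x v v)
      = c\<^sup>2 * (\<epsilon>\<^sup>2 * (klein x v y)\<^sup>2 + klein x y y * (1 - \<epsilon>\<^sup>2 * klein x v v))"
    by (simp add: power2_eq_square algebra_simps)
  then have "sqrt (\<epsilon>\<^sup>2 * (c * klein x v y)\<^sup>2 + c * (c * klein x y y) * (1 - \<epsilon>\<^sup>2 * klein x v v))
      = c * sqrt (\<epsilon>\<^sup>2 * (klein x v y)\<^sup>2 + klein x y y * (1 - \<epsilon>\<^sup>2 * klein x v v))"
    using assms(2) by (simp add: real_sqrt_mult)
  then show ?thesis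
    by (simp add: randers_F_def randers_alpha_def randers_beta_def Let_def lin v_def[symmetric]
        mult.assoc right_diff_distrib)
qed

lemma randers_metric:
  "randers_metric_on (nav_domain \<epsilon>) (randers_alpha \<epsilon>) (randers_beta \<epsilon>)"
  unfolding randers_metric_on_def
proof (intro conjI ballI)
  show "riemannian_norm_on (nav_domain \<epsilon>) (randers_alpha \<epsilon>)"
    by (rule riemannian_norm_randers_alpha)
  show "one_form_on (nav_domain \<epsilon>) (randers_beta \<epsilon>)"
    by (rule one_form_randers_beta)
next
  fix x :: "real ^ 2" assume x: "x \<in> nav_domain \<epsilon>"
  obtain q where q: "q < 1" "\<And>y. randers_beta \<epsilon> x y \<le> q * randers_alpha \<epsilon> x y"
    using randers_beta_bound[OF x] by blast
  have "(SUP y\<in>- {0}. randers_beta \<epsilon> x y / randers_alpha \<epsilon> x y) \<le> q"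
  proof (rule cSUP_least)
    have "axis 1 (1 :: real) \<noteq> (0 :: real ^ 2)"
      by simp
    then show "- {0 :: real ^ 2} \<noteq> {}"
      by blast
    show "randers_beta \<epsilon> x y / randers_alpha \<epsilon> x y \<le> q" if "y \<in> - {0}" for y
      using q(2)[of y] randers_alpha_pos[OF x, of y] that by (simp add: pos_divide_le_eq)
  qed
  then show "(SUP y\<in>- {0}. randers_beta \<epsilon> x y / randers_alpha \<epsilon> x y) < 1"
    using q(1) by simp
next
  have F: "(\<lambda>x y. randers_alpha \<epsilon> x y + randers_beta \<epsilon> x y) = (\<lambda>x y. randers_F \<epsilon> (x, y))"
    by (simp add: randers_F_def)
  have "randers_F \<epsilon> (x, y) \<ge> 0" if "x \<in> nav_domain \<epsilon>" for x y
    using randers_F_pos[of "(x, y)" \<epsilon>] randers_F_0[of \<epsilon> x] that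
    by (cases "y = 0") (auto simp: nav_tangent_def intro: less_imp_le)
  moreover have "(\<lambda>(x, y). randers_F \<epsilon> (x, y)) = randers_F \<epsilon>"
    by auto
  ultimately show "finsler_metric_on (nav_domain \<epsilon>) (\<lambda>x y. randers_alpha \<epsilon> x y + randers_beta \<epsilon> x y)"
    unfolding F finsler_metric_on_def
    using smooth_randers_F[of \<epsilon>] randers_F_homogeneous
      nav_tangent_point.fundamental_tensor_pos[of \<epsilon>]
    by (auto simp: nav_tangent_def nav_tangent_point_def)
qed

section \<open>Projective flatness\<close>

text \<open>The first and second derivatives of the constant function f(c(s)): df(c') = 0, and
  df(c'') + Hess f(c', c') = 0. Expanding df(c') in coordinates before differentiating again
  requires c' to be differentiable at t only.\<close>

lemma level_curve_second_order:
  fixes f :: "real ^ 'n::finite \<Rightarrow> real" and c c' :: "real \<Rightarrow> real ^ 'n" and a :: "real ^ 'n"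
  assumes f: "smooth_on f W" and I: "open I" "t \<in> I" and c: "c ` I \<subseteq> W"
    and c': "\<And>s. s \<in> I \<Longrightarrow> (c has_vector_derivative c' s) (at s)"
    and a: "(c' has_vector_derivative a) (at t)"
    and const: "\<And>s. s \<in> I \<Longrightarrow> f (c s) = f (c t)"
  shows "frechet_derivative f (at (c t)) (c' t) = 0"
    and "frechet_derivative f (at (c t)) a + (\<Sum>i\<in>UNIV. c' t $ i *
      frechet_derivative (\<lambda>z. frechet_derivative f (at z) (axis i 1)) (at (c t)) (c' t)) = 0"
proof -
  have line: "((\<lambda>s. g (c s)) has_real_derivative frechet_derivative g (at (c s)) (c' s)) (at s)"
    if g: "smooth_on g W" and s: "s \<in> I" for g :: "real ^ 'n \<Rightarrow> real" and s
  proof -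
    have der: "(g has_derivative frechet_derivative g (at (c s))) (at (c s))"
      using smooth_on_has_derivative[OF g] c s by blast
    have "((\<lambda>s. g (c s)) has_derivative (\<lambda>h. frechet_derivative g (at (c s)) (h *\<^sub>R c' s))) (at s)"
      using has_derivative_compose[OF c'[OF s, unfolded has_vector_derivative_def] der] .
    then show ?thesis
      using linear_cmul[OF has_derivative_linear[OF der]]
      by (simp add: has_field_derivative_def mult.commute[of _ "frechet_derivative g (at (c s)) (c' s)"])
  qed
  have const_near: "\<forall>\<^sub>F r in nhds s. r \<in> I" if "s \<in> I" for s
    using I(1) that by (rule eventually_nhds_in_open)
  have zero: "frechet_derivative f (at (c s)) (c' s) = 0" if s: "s \<in> I" for s
  proof (rule DERIV_unique[OF line[OF f s]])
    show "((\<lambda>s. f (c s)) has_real_derivative 0) (at s)"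
    proof (rule DERIV_cong_ev[THEN iffD1, OF refl _ refl DERIV_const])
      show "\<forall>\<^sub>F r in nhds s. f (c t) = f (c r)"
        using const_near[OF s] by (rule eventually_mono) (use const in simp)
    qed
  qed
  then show "frechet_derivative f (at (c t)) (c' t) = 0"
    using I by blast
  have expand: "frechet_derivative f (at z) v = (\<Sum>i\<in>UNIV. v $ i * frechet_derivative f (at z) (axis i 1))"
    if "z \<in> W" for z v
  proof -
    have lin: "linear (frechet_derivative f (at z))"
      using smooth_on_has_derivative[OF f that] has_derivative_linear by blast
    have "v = (\<Sum>i\<in>UNIV. v $ i *\<^sub>R axis i 1)"
      using basis_expansion[of v] by (simp add: scalar_mult_eq_scaleR)
    then have "frechet_derivative f (at z) v = frechet_derivative f (at z) (\<Sum>i\<in>UNIV. v $ i *\<^sub>R axis i 1)"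
      by simp
    then show ?thesis
      by (simp add: linear_sum[OF lin] linear_cmul[OF lin])
  qed
  have ct: "c s \<in> W" if "s \<in> I" for s
    using c that by blast
  have ai: "((\<lambda>s. c' s $ i) has_real_derivative a $ i) (at t)" for i
    using bounded_linear.has_vector_derivative[OF bounded_linear_vec_nth a]
    by (simp add: has_real_derivative_iff_has_vector_derivative)
  have "((\<lambda>s. \<Sum>i\<in>UNIV. c' s $ i * frechet_derivative f (at (c s)) (axis i 1)) has_real_derivative
      (\<Sum>i\<in>UNIV. a $ i * frechet_derivative f (at (c t)) (axis i 1) + frechet_derivative (\<lambda>z. frechet_derivative f (at z) (axis i 1))
        (at (c t)) (c' t) * c' t $ i)) (at t)"
    by (intro DERIV_sum DERIV_mult ai line[OF smooth_on_frechet_derivative[OF f]] I)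
  moreover have "((\<lambda>s. \<Sum>i\<in>UNIV. c' s $ i * frechet_derivative f (at (c s)) (axis i 1)) has_real_derivative 0) (at t)"
  proof (rule DERIV_cong_ev[THEN iffD1, OF refl _ refl DERIV_const])
    show "\<forall>\<^sub>F s in nhds t. 0 = (\<Sum>i\<in>UNIV. c' s $ i * frechet_derivative f (at (c s)) (axis i 1))"
      using const_near[OF I(2)] by (rule eventually_mono) (use zero expand ct in metis)
  qed
  ultimately have "(\<Sum>i\<in>UNIV. a $ i * frechet_derivative f (at (c t)) (axis i 1) + frechet_derivative (\<lambda>z. frechet_derivative f (at z) (axis i 1))
        (at (c t)) (c' t) * c' t $ i) = 0"
    by (rule DERIV_unique)
  then show "frechet_derivative f (at (c t)) a + (\<Sum>i\<in>UNIV. c' t $ i *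
      frechet_derivative (\<lambda>z. frechet_derivative f (at z) (axis i 1)) (at (c t)) (c' t)) = 0"
    using expand[OF ct[OF I(2)], of a] by (simp add: sum.distrib mult.commute)
qed

text \<open>The Klein geodesic through the origin with initial velocity \<open>\<sigma> e\<^sub>1\<close>, carried along by the rotation.\<close>

definition spiral :: "real \<Rightarrow> real \<Rightarrow> real \<Rightarrow> real ^ 2" where
  "spiral \<epsilon> \<sigma> t = vector [\<sigma> * tanh t * cos (\<epsilon> * t), \<sigma> * tanh t * sin (\<epsilon> * t)]"

definition spiral' :: "real \<Rightarrow> real \<Rightarrow> real \<Rightarrow> real ^ 2" where
  "spiral' \<epsilon> \<sigma> t = vector
    [\<sigma> * ((1 - (tanh t)\<^sup>2) * cos (\<epsilon> * t) - \<epsilon> * tanh t * sin (\<epsilon> * t)),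
     \<sigma> * ((1 - (tanh t)\<^sup>2) * sin (\<epsilon> * t) + \<epsilon> * tanh t * cos (\<epsilon> * t))]"

definition spiral'' :: "real \<Rightarrow> real \<Rightarrow> real \<Rightarrow> real ^ 2" where
  "spiral'' \<epsilon> \<sigma> t = vector
    [- \<sigma> * (2 * tanh t * (1 - (tanh t)\<^sup>2) * cos (\<epsilon> * t) + 2 * \<epsilon> * (1 - (tanh t)\<^sup>2) * sin (\<epsilon> * t)
        + \<epsilon>\<^sup>2 * tanh t * cos (\<epsilon> * t)),
     - \<sigma> * (2 * tanh t * (1 - (tanh t)\<^sup>2) * sin (\<epsilon> * t) - 2 * \<epsilon> * (1 - (tanh t)\<^sup>2) * cos (\<epsilon> * t)
        + \<epsilon>\<^sup>2 * tanh t * sin (\<epsilon> * t))]"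

lemma spiral_nth [simp]:
  "spiral \<epsilon> \<sigma> t $ 1 = \<sigma> * tanh t * cos (\<epsilon> * t)" "spiral \<epsilon> \<sigma> t $ 2 = \<sigma> * tanh t * sin (\<epsilon> * t)"
  "spiral' \<epsilon> \<sigma> t $ 1 = \<sigma> * ((1 - (tanh t)\<^sup>2) * cos (\<epsilon> * t) - \<epsilon> * tanh t * sin (\<epsilon> * t))"
  "spiral' \<epsilon> \<sigma> t $ 2 = \<sigma> * ((1 - (tanh t)\<^sup>2) * sin (\<epsilon> * t) + \<epsilon> * tanh t * cos (\<epsilon> * t))"
  "spiral'' \<epsilon> \<sigma> t $ 1 = - \<sigma> * (2 * tanh t * (1 - (tanh t)\<^sup>2) * cos (\<epsilon> * t)
    + 2 * \<epsilon> * (1 - (tanh t)\<^sup>2) * sin (\<epsilon> * t) + \<epsilon>\<^sup>2 * tanh t * cos (\<epsilon> * t))"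
  "spiral'' \<epsilon> \<sigma> t $ 2 = - \<sigma> * (2 * tanh t * (1 - (tanh t)\<^sup>2) * sin (\<epsilon> * t)
    - 2 * \<epsilon> * (1 - (tanh t)\<^sup>2) * cos (\<epsilon> * t) + \<epsilon>\<^sup>2 * tanh t * sin (\<epsilon> * t))"
  by (simp_all add: spiral_def spiral'_def spiral''_def)

lemma has_vector_derivative_vec_2:
  fixes f :: "real \<Rightarrow> real ^ 2"
  assumes "((\<lambda>t. f t $ 1) has_real_derivative d $ 1) (at t)"
    and "((\<lambda>t. f t $ 2) has_real_derivative d $ 2) (at t)"
  shows "(f has_vector_derivative d) (at t)"
proof -
  have e: "v = v $ 1 *\<^sub>R axis 1 1 + v $ 2 *\<^sub>R axis 2 1" for v :: "real ^ 2"
    by (simp add: vec_eq_iff forall_2)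
  have "((\<lambda>t. f t $ 1 *\<^sub>R axis 1 1 + f t $ 2 *\<^sub>R axis 2 1) has_vector_derivative
      d $ 1 *\<^sub>R axis 1 1 + d $ 2 *\<^sub>R (axis 2 1 :: real ^ 2)) (at t)"
    by (intro has_vector_derivative_add
        bounded_linear.has_vector_derivative[OF bounded_linear_scaleR_left]
        assms[unfolded has_real_derivative_iff_has_vector_derivative])
  then show ?thesis
    by (simp add: e[symmetric])
qed

lemma spiral_derivative:
  "(spiral \<epsilon> \<sigma> has_vector_derivative spiral' \<epsilon> \<sigma> t) (at t)"
  "(spiral' \<epsilon> \<sigma> has_vector_derivative spiral'' \<epsilon> \<sigma> t) (at t)"
proof -
  have dtanh: "(tanh has_real_derivative 1 - (tanh t)\<^sup>2) (at t)"
    by (rule derivative_eq_intros refl | simp)+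
  have dcos: "((\<lambda>t. cos (\<epsilon> * t)) has_real_derivative - \<epsilon> * sin (\<epsilon> * t)) (at t)"
    by (auto intro!: derivative_eq_intros)
  have dsin: "((\<lambda>t. sin (\<epsilon> * t)) has_real_derivative \<epsilon> * cos (\<epsilon> * t)) (at t)"
    by (auto intro!: derivative_eq_intros)
  note rules = DERIV_mult DERIV_diff DERIV_add DERIV_const dtanh dcos dsin DERIV_power
  show "(spiral \<epsilon> \<sigma> has_vector_derivative spiral' \<epsilon> \<sigma> t) (at t)"
    by (rule has_vector_derivative_vec_2; simp only: spiral_nth; rule DERIV_cong, (rule rules)+)
      (simp_all add: algebra_simps)
  show "(spiral' \<epsilon> \<sigma> has_vector_derivative spiral'' \<epsilon> \<sigma> t) (at t)"
    by (rule has_vector_derivative_vec_2; simp only: spiral_nth; rule DERIV_cong, (rule rules)+)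
      (simp_all add: algebra_simps power2_eq_square)
qed

text \<open>Velocity minus wind has Klein length 1, so F = 1 along the curve by
  \<open>randers_F_eq_1_iff\<close>, without evaluating the root; also \<theta> = tanh t. With these
  values the spray is explicit.\<close>

lemma spiral_geodesic:
  assumes \<sigma>: "\<bar>\<sigma>\<bar> = 1" and I: "\<And>t. t \<in> I \<Longrightarrow> spiral \<epsilon> \<sigma> t \<in> nav_domain \<epsilon>"
  shows "geodesic_on (\<lambda>x y. randers_F \<epsilon> (x, y)) I (spiral \<epsilon> \<sigma>)"
  unfolding geodesic_on_def
proof (intro exI ballI conjI)
  fix t assume t: "t \<in> I"
  define x where "x = spiral \<epsilon> \<sigma> t"
  define y where "y = spiral' \<epsilon> \<sigma> t"
  define \<tau> where "\<tau> = tanh t"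
  define c where "c = cos (\<epsilon> * t)"
  define s where "s = sin (\<epsilon> * t)"
  have cs: "c\<^sup>2 + s\<^sup>2 = 1"
    by (simp add: c_def s_def)
  have \<sigma>2: "\<sigma>\<^sup>2 = 1"
    using \<sigma> by (metis power2_abs one_power2)
  have \<tau>: "1 - \<tau>\<^sup>2 > 0"
    using tanh_real_lt_1[of t] tanh_real_gt_neg1[of t] by (simp add: \<tau>_def abs_square_less_1)
  have x: "x $ 1 = \<sigma> * \<tau> * c" "x $ 2 = \<sigma> * \<tau> * s"
    by (simp_all add: x_def \<tau>_def c_def s_def)
  have y: "y $ 1 = \<sigma> * ((1 - \<tau>\<^sup>2) * c - \<epsilon> * \<tau> * s)" "y $ 2 = \<sigma> * ((1 - \<tau>\<^sup>2) * s + \<epsilon> * \<tau> * c)"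
    by (simp_all add: y_def \<tau>_def c_def s_def)
  have xx: "1 - (x $ 1)\<^sup>2 - (x $ 2)\<^sup>2 = 1 - \<tau>\<^sup>2"
    using \<sigma>2 cs x by algebra
  have dom: "x \<in> nav_domain \<epsilon>"
    using I[OF t] by (simp add: x_def)
  have y_norm: "(y $ 1)\<^sup>2 + (y $ 2)\<^sup>2 = (1 - \<tau>\<^sup>2)\<^sup>2 + \<epsilon>\<^sup>2 * \<tau>\<^sup>2"
    using \<sigma>2 cs y by algebra
  have y_nz: "y \<noteq> 0"
    unfolding vec2_nonzero_iff y_norm using \<tau> by (intro add_pos_nonneg) auto
  have "klein x (y - \<epsilon> *\<^sub>R rotation_field x) (y - \<epsilon> *\<^sub>R rotation_field x) = 1"
  proof -
    have \<eta>: "(y - \<epsilon> *\<^sub>R rotation_field x) $ 1 = \<sigma> * (1 - \<tau>\<^sup>2) * c"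
      "(y - \<epsilon> *\<^sub>R rotation_field x) $ 2 = \<sigma> * (1 - \<tau>\<^sup>2) * s"
      by (simp_all add: x y algebra_simps)
    have "(\<sigma> * (1 - \<tau>\<^sup>2) * c)\<^sup>2 + (\<sigma> * (1 - \<tau>\<^sup>2) * s)\<^sup>2
        - (x $ 1 * (\<sigma> * (1 - \<tau>\<^sup>2) * s) - x $ 2 * (\<sigma> * (1 - \<tau>\<^sup>2) * c))\<^sup>2 = (1 - \<tau>\<^sup>2)\<^sup>2"
      using \<sigma>2 cs x by algebra
    then show ?thesis
      unfolding klein_diag \<eta> xx using \<tau> by simp
  qed
  then have F: "randers_F \<epsilon> (x, y) = 1"
    using randers_F_eq_1_iff[OF dom] by simp
  have \<theta>: "nav_theta (x, y) = \<tau>"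
  proof -
    have "x $ 1 * y $ 1 + x $ 2 * y $ 2 = \<tau> * (1 - \<tau>\<^sup>2)"
      using \<sigma>2 cs x y by algebra
    then show ?thesis
      using \<tau> by (simp add: nav_theta_def xx)
  qed
  have "nav_tangent_point \<epsilon> x y"
    using dom y_nz by (simp add: nav_tangent_point_def nav_tangent_def)
  then have G: "geodesic_coeff (\<lambda>x y. randers_F \<epsilon> (x, y)) x y = nav_spray \<epsilon> (x, y)"
    by (rule nav_tangent_point.geodesic_coeff_eq)
  have "- 2 *\<^sub>R nav_spray \<epsilon> (x, y) = spiral'' \<epsilon> \<sigma> t"
    unfolding vec_eq_iff forall_2 nav_spray_def
    by (simp add: F \<theta> spiral''_def \<tau>_def[symmetric] c_def[symmetric] s_def[symmetric])
      (simp add: x y algebra_simps power2_eq_square)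
  then show "(spiral' \<epsilon> \<sigma> has_vector_derivative
      - 2 *\<^sub>R geodesic_coeff (\<lambda>x y. randers_F \<epsilon> (x, y)) (spiral \<epsilon> \<sigma> t) (spiral' \<epsilon> \<sigma> t)) (at t)"
    using spiral_derivative(2)[of \<epsilon> \<sigma> t] G by (simp add: x_def y_def)
  show "spiral' \<epsilon> \<sigma> t \<noteq> 0"
    using y_nz by (simp add: y_def)
qed (rule spiral_derivative)

lemma collinear_image_normal:
  fixes S :: "(real ^ 2) set"
  assumes "collinear S"
  obtains n :: "real ^ 2" where "n \<noteq> 0" "\<And>p q. p \<in> S \<Longrightarrow> q \<in> S \<Longrightarrow> n \<bullet> p = n \<bullet> q"
proof -
  obtain u where u: "\<And>p q. p \<in> S \<Longrightarrow> q \<in> S \<Longrightarrow> \<exists>k. p - q = k *\<^sub>R u"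
    using assms by (auto simp: collinear_def)
  \<comment> \<open>If u = 0 the set has at most one point, the rotated u would vanish, and any
    nonzero vector serves.\<close>
  define n where "n = (if u = 0 then axis 1 1 else rotation_field u)"
  have "n \<noteq> 0"
    by (auto simp: n_def vec_eq_iff forall_2)
  moreover have "n \<bullet> u = 0"
    by (auto simp: n_def inner_vec_def sum_2)
  then have "n \<bullet> p = n \<bullet> q" if "p \<in> S" "q \<in> S" for p q
    using u[OF that] inner_diff_right[of n p q] by auto
  ultimately show thesis
    using that by blast
qed

lemma normals_parallel:
  fixes m n v :: "real ^ 2"
  assumes "v \<noteq> 0" "n \<noteq> 0" "m \<noteq> 0" "n \<bullet> v = 0" "m \<bullet> v = 0"
  obtains k where "n = k *\<^sub>R m"
proof -
  have eq: "n $ 1 * v $ 1 + n $ 2 * v $ 2 = 0" "m $ 1 * v $ 1 + m $ 2 * v $ 2 = 0"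
    using assms(4,5) by (simp_all add: inner_vec_def sum_2)
  have "n $ 1 * m $ 2 - n $ 2 * m $ 1 = 0"
  proof -
    have "(n $ 1 * m $ 2 - n $ 2 * m $ 1) * v $ 1 = 0" "(n $ 1 * m $ 2 - n $ 2 * m $ 1) * v $ 2 = 0"
      using eq by algebra+
    then show ?thesis
      using assms(1) by (auto simp: vec_eq_iff forall_2)
  qed
  then have "n $ 1 * ((m $ 1)\<^sup>2 + (m $ 2)\<^sup>2) = (n $ 1 * m $ 1 + n $ 2 * m $ 2) * m $ 1"
    "n $ 2 * ((m $ 1)\<^sup>2 + (m $ 2)\<^sup>2) = (n $ 1 * m $ 1 + n $ 2 * m $ 2) * m $ 2"
    by algebra+
  moreover have "(m $ 1)\<^sup>2 + (m $ 2)\<^sup>2 > 0"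
    using assms(3) by (simp add: vec2_nonzero_iff)
  ultimately have "n = ((n $ 1 * m $ 1 + n $ 2 * m $ 2) / ((m $ 1)\<^sup>2 + (m $ 2)\<^sup>2)) *\<^sub>R m"
    unfolding vec_eq_iff forall_2 by (auto simp: eq_divide_eq)
  then show thesis
    by (rule that)
qed

text \<open>The spirals with \<sigma> = 1 and \<sigma> = -1 leave the origin with velocity \<sigma>
  e1 and acceleration 2 \<epsilon> \<sigma> e2. If \<phi> straightens both, the normals of the two
  lines are parallel, as both annihilate d\<phi>(e1). The second-order conditions for the common
  normal n differ only in the sign of \<epsilon>, so n is also orthogonal to d\<phi>(e2), which
  contradicts the invertibility of d\<phi>.\<close>

lemma randers_not_locally_projectively_flat:
  assumes "\<epsilon> \<noteq> 0"
  shows "\<not> locally_projectively_flat_on (nav_domain \<epsilon>) (\<lambda>x y. randers_F \<epsilon> (x, y))"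
proof
  assume "locally_projectively_flat_on (nav_domain \<epsilon>) (\<lambda>x y. randers_F \<epsilon> (x, y))"
  moreover have "0 \<in> nav_domain \<epsilon>"
    by (simp add: nav_domain_def)
  ultimately obtain W \<phi> where W: "0 \<in> W" "W \<subseteq> nav_domain \<epsilon>" and coord: "coordinate_system_on W \<phi>"
    and flat: "\<forall>I c. open I \<and> is_interval I \<and> c ` I \<subseteq> W
      \<and> geodesic_on (\<lambda>x y. randers_F \<epsilon> (x, y)) I c \<longrightarrow> collinear (\<phi> ` c ` I)"
    unfolding locally_projectively_flat_on_def by (elim ballE exE conjE) blast+
  obtain \<psi> where "open W" and \<phi>: "smooth_on \<phi> W" and "open (\<phi> ` W)"
    and \<psi>: "smooth_on \<psi> (\<phi> ` W)" "\<And>x. x \<in> W \<Longrightarrow> \<psi> (\<phi> x) = x"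
    using coord by (auto simp: coordinate_system_on_def)
  define d\<phi> where "d\<phi> = frechet_derivative \<phi> (at 0)"
  have d\<phi>: "(\<phi> has_derivative d\<phi>) (at 0)"
    unfolding d\<phi>_def by (rule smooth_on_has_derivative[OF \<phi> W(1)])
  have "linear d\<phi>"
    using d\<phi> has_derivative_linear by blast
  \<comment> \<open>By the chain rule, the derivative of the smooth inverse \<psi> is a left inverse
    of d\<phi>.\<close>
  have "inj d\<phi>"
  proof -
    have "(\<psi> has_derivative frechet_derivative \<psi> (at (\<phi> 0))) (at (\<phi> 0))"
      using \<psi>(1) W(1) by (auto intro: smooth_on_has_derivative)
    from has_derivative_compose[OF d\<phi> this]
    have "((\<lambda>x. \<psi> (\<phi> x)) has_derivative (\<lambda>v. frechet_derivative \<psi> (at (\<phi> 0)) (d\<phi> v))) (at 0)" .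
    then have "((\<lambda>x. x) has_derivative (\<lambda>v. frechet_derivative \<psi> (at (\<phi> 0)) (d\<phi> v))) (at 0)"
      by (rule has_derivative_transform_within_open[OF _ \<open>open W\<close> W(1)]) (rule \<psi>(2))
    then have "(\<lambda>v. frechet_derivative \<psi> (at (\<phi> 0)) (d\<phi> v)) = (\<lambda>v. v)"
      using has_derivative_unique has_derivative_ident by blast
    then show ?thesis
      by (intro inj_on_inverseI[of _ "frechet_derivative \<psi> (at (\<phi> 0))"]) (rule fun_cong)
  qed
  obtain \<delta> where "\<delta> > 0" and \<delta>: "\<And>t \<sigma>. \<bar>t\<bar> < \<delta> \<Longrightarrow> \<bar>\<sigma>\<bar> = 1 \<Longrightarrow> spiral \<epsilon> \<sigma> t \<in> W"
  proof -
    have "\<forall>\<^sub>F t in nhds 0. spiral \<epsilon> \<sigma> t \<in> W" for \<sigma>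
    proof -
      have "isCont (spiral \<epsilon> \<sigma>) 0"
        using spiral_derivative(1) has_vector_derivative_continuous by blast
      moreover have "spiral \<epsilon> \<sigma> 0 = 0"
        by (simp add: vec_eq_iff forall_2)
      ultimately have "(spiral \<epsilon> \<sigma> \<longlongrightarrow> 0) (nhds 0)"
        using isCont_def tendsto_at_iff_tendsto_nhds by metis
      then show ?thesis
        using \<open>open W\<close> W(1) topological_tendstoD by blast
    qed
    then have "\<forall>\<^sub>F t in nhds 0. spiral \<epsilon> 1 t \<in> W \<and> spiral \<epsilon> (- 1) t \<in> W"
      by (intro eventually_conj)
    then obtain \<delta> where "\<delta> > 0" "\<And>t. dist t 0 < \<delta> \<Longrightarrow> spiral \<epsilon> 1 t \<in> W \<and> spiral \<epsilon> (- 1) t \<in> W"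
      unfolding eventually_nhds_metric by blast
    then show thesis
      using that[of \<delta>] by (auto simp: abs_eq_iff' dist_real_def)
  qed
  define I where "I = {-\<delta><..<\<delta>}"
  have I: "open I" "0 \<in> I" "is_interval I"
    using \<open>\<delta> > 0\<close> by (auto simp: I_def is_interval_def)
  have sub: "spiral \<epsilon> \<sigma> ` I \<subseteq> W" if "\<bar>\<sigma>\<bar> = 1" for \<sigma>
    using \<delta> that by (auto simp: I_def abs_less_iff)
  have "\<exists>n. n \<noteq> 0 \<and> (\<forall>t\<in>I. n \<bullet> \<phi> (spiral \<epsilon> \<sigma> t) = n \<bullet> \<phi> (spiral \<epsilon> \<sigma> 0))" if "\<bar>\<sigma>\<bar> = 1" for \<sigma>
  proof -
    have "collinear (\<phi> ` spiral \<epsilon> \<sigma> ` I)"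
      using sub[OF that] W(2) by (intro flat[rule_format] conjI I spiral_geodesic that) auto
    then show ?thesis
      using collinear_image_normal I(2) by (metis imageI)
  qed
  then obtain m n where n: "n \<noteq> 0" "\<And>t. t \<in> I \<Longrightarrow> n \<bullet> \<phi> (spiral \<epsilon> 1 t) = n \<bullet> \<phi> (spiral \<epsilon> 1 0)"
    and m: "m \<noteq> 0" "\<And>t. t \<in> I \<Longrightarrow> m \<bullet> \<phi> (spiral \<epsilon> (- 1) t) = m \<bullet> \<phi> (spiral \<epsilon> (- 1) 0)"
    by (metis abs_minus_cancel abs_one)
  have spiral0: "spiral \<epsilon> \<sigma> 0 = 0" "spiral' \<epsilon> \<sigma> 0 = \<sigma> *\<^sub>R axis 1 1" "spiral'' \<epsilon> \<sigma> 0 = (2 * \<epsilon> * \<sigma>) *\<^sub>R axis 2 1" for \<sigma>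
    by (simp_all add: vec_eq_iff forall_2)
  have smooth: "smooth_on (\<lambda>z. k \<bullet> \<phi> z) W" for k
    by (rule smooth_on_compose_bounded_linear[OF bounded_linear_inner_right \<open>open W\<close> \<phi>])
  have d: "frechet_derivative (\<lambda>z. k \<bullet> \<phi> z) (at 0) v = k \<bullet> d\<phi> v" for k v
    by (rule frechet_eqI[OF bounded_linear.has_derivative[OF bounded_linear_inner_right d\<phi>]])
  note second_order = level_curve_second_order[OF smooth I(1,2) sub spiral_derivative(1,2), unfolded spiral0 d]
  have "n \<bullet> d\<phi> (axis 1 1) = 0"
    using second_order(1)[of 1 n] n(2) by (simp add: spiral0)
  moreover have "m \<bullet> d\<phi> (axis 1 1) = 0"
    using second_order(1)[of "- 1" m] m(2) linear_neg[OF \<open>linear d\<phi>\<close>] by (simp add: spiral0)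
  moreover have "d\<phi> (axis 1 1) \<noteq> 0"
    using \<open>inj d\<phi>\<close> \<open>linear d\<phi>\<close> by (metis axis_eq_0_iff linear_injective_0 zero_neq_one)
  ultimately obtain k where k: "n = k *\<^sub>R m"
    using normals_parallel n(1) m(1) by blast
  define H where "H = frechet_derivative (\<lambda>z. frechet_derivative (\<lambda>z. n \<bullet> \<phi> z) (at z) (axis 1 1)) (at 0)"
  have "(2 * \<epsilon>) * (n \<bullet> d\<phi> (axis 2 1)) + H (axis 1 1) = 0"
    using second_order(2)[of 1 n] n(2) linear_cmul[OF \<open>linear d\<phi>\<close>] by (simp add: spiral0 sum_2 H_def)
  \<comment> \<open>Since n = k m, the function n \<bullet> \<phi> is constant along the second
    spiral too. Its Hessian term keeps its sign, being quadratic in the velocity - e1.\<close>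
  moreover have "- (2 * \<epsilon>) * (n \<bullet> d\<phi> (axis 2 1)) + H (axis 1 1) = 0"
  proof -
    have "linear H"
      unfolding H_def
      using smooth_on_has_derivative[OF smooth_on_frechet_derivative[OF smooth] W(1)] has_derivative_linear by blast
    then show ?thesis
      using second_order(2)[of "- 1" n] m(2) linear_cmul[OF \<open>linear d\<phi>\<close>] linear_neg[OF \<open>linear H\<close>] linear_neg[OF \<open>linear d\<phi>\<close>]
      by (simp add: spiral0 sum_2 H_def k)
  qed
  ultimately have "\<epsilon> * (n \<bullet> d\<phi> (axis 2 1)) = 0"
    by linarith
  then have e2: "n \<bullet> d\<phi> (axis 2 1) = 0"
    using assms by simp
  have "n \<bullet> d\<phi> v = 0" for v
  proof -
    have "v = v $ 1 *\<^sub>R axis 1 1 + v $ 2 *\<^sub>R axis 2 1"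
      by (simp add: vec_eq_iff forall_2)
    then have "d\<phi> v = v $ 1 *\<^sub>R d\<phi> (axis 1 1) + v $ 2 *\<^sub>R d\<phi> (axis 2 1)"
      using linear_add[OF \<open>linear d\<phi>\<close>] linear_cmul[OF \<open>linear d\<phi>\<close>] by metis
    then show ?thesis
      using e2 \<open>n \<bullet> d\<phi> (axis 1 1) = 0\<close> by (simp add: inner_add_right)
  qed
  moreover obtain v where "d\<phi> v = n"
    using linear_injective_imp_surjective[OF \<open>linear d\<phi>\<close> \<open>inj d\<phi>\<close>] by (metis surjD)
  ultimately show False
    using n(1) by (metis inner_eq_zero_iff)
qed

section \<open>The Gauss curvature of the Riemannian part\<close>

definition sq :: "real ^ 2 \<Rightarrow> real" where
  "sq x = (x $ 1)\<^sup>2 + (x $ 2)\<^sup>2"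

text \<open>By rotational symmetry \<open>a\<^sub>i\<^sub>j = A \<delta>\<^sub>i\<^sub>j + C x\<^sub>i x\<^sub>j\<close> and
  \<open>\<Gamma>\<^sup>k\<^sub>i\<^sub>j = t (x\<^sub>i \<delta>\<^sub>j\<^sub>k + x\<^sub>j \<delta>\<^sub>i\<^sub>k) + x\<^sub>k (p \<delta>\<^sub>i\<^sub>j + q x\<^sub>i x\<^sub>j)\<close> with functions of \<open>s = |x|\<^sup>2\<close>; here \<open>\<kappa> = 1 + \<epsilon>\<^sup>2\<close>.\<close>

definition met_A :: "real \<Rightarrow> real \<Rightarrow> real" where
  "met_A \<kappa> s = (1 - s) / (1 - \<kappa> * s)\<^sup>2"

definition met_C :: "real \<Rightarrow> real \<Rightarrow> real" where
  "met_C \<kappa> s = (2 - \<kappa> - s) / ((1 - s) * (1 - \<kappa> * s)\<^sup>2)"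

definition chr_t :: "real \<Rightarrow> real \<Rightarrow> real" where
  "chr_t \<kappa> s = (2 * \<kappa> - 1 - \<kappa> * s) / ((1 - s) * (1 - \<kappa> * s))"

definition chr_p :: "real \<Rightarrow> real \<Rightarrow> real" where
  "chr_p \<kappa> s = (\<kappa> - 1) * ((\<kappa> + 2) * s - 3) / (1 - \<kappa> * s)\<^sup>2"

definition chr_q :: "real \<Rightarrow> real \<Rightarrow> real" where
  "chr_q \<kappa> s = (\<kappa> - 1) * (2 * \<kappa> - 5 + (\<kappa> + 2) * s) / ((1 - s) * (1 - \<kappa> * s)\<^sup>2)"

abbreviation kron :: "2 \<Rightarrow> 2 \<Rightarrow> real" where
  "kron i j \<equiv> (if i = j then 1 else 0)"

lemma nav_domain_sq: "x \<in> nav_domain \<epsilon> \<longleftrightarrow> (1 + \<epsilon>\<^sup>2) * sq x < 1"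
  by (simp add: nav_domain_def sq_def)

lemma nav_domain_sq_pos:
  assumes "x \<in> nav_domain \<epsilon>"
  shows "1 - (1 + \<epsilon>\<^sup>2) * sq x > 0" "1 - sq x > 0"
  using nav_domain_pos[OF assms] by (simp_all add: sq_def)

lemma metric_coeff_randers_alpha:
  assumes x: "x \<in> nav_domain \<epsilon>"
  shows "metric_coeff (randers_alpha \<epsilon>) x $ i $ j
    = met_A (1 + \<epsilon>\<^sup>2) (sq x) * kron i j + met_C (1 + \<epsilon>\<^sup>2) (sq x) * (x $ i * x $ j)"
proof -
  define Q where "Q = (\<lambda>y. y \<bullet> (nav_metric \<epsilon> x *v y))"
  have "(randers_alpha \<epsilon> x y)\<^sup>2 = Q y" for y
  proof (cases "y = 0")
    case True
    then show ?thesis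
      by (simp add: randers_alpha_def Let_def klein_def Q_def)
  next
    case False
    have "randers_alpha \<epsilon> x y = sqrt (Q y)" "Q y > 0"
      unfolding Q_def nav_metric_quadratic by (rule randers_formula(1)[OF x] randers_formula(3)[OF x False])+
    then show ?thesis
      by simp
  qed
  then have "metric_coeff (randers_alpha \<epsilon>) x $ i $ j = (Q (axis i 1 + axis j 1) - Q (axis i 1 - axis j 1)) / 4"
    by (simp add: metric_coeff_def)
  also have "\<dots> = nav_metric \<epsilon> x $ i $ j"
  proof -
    have sym: "nav_metric \<epsilon> x $ 2 $ 1 = nav_metric \<epsilon> x $ 1 $ 2"
      by (simp add: nav_metric_def mult_ac)
    have "\<forall>i j. (Q (axis i 1 + axis j 1) - Q (axis i 1 - axis j 1)) / 4 = nav_metric \<epsilon> x $ i $ j"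
      unfolding forall_2 Q_def inner_vec_def matrix_vector_mult_def sum_2
      by (simp add: sym)
    then show ?thesis
      by blast
  qed
  also have "\<dots> = met_A (1 + \<epsilon>\<^sup>2) (sq x) * kron i j + met_C (1 + \<epsilon>\<^sup>2) (sq x) * (x $ i * x $ j)"
  proof -
    have D: "1 - (x $ 1)\<^sup>2 - (x $ 2)\<^sup>2 = 1 - sq x"
      by (simp add: sq_def)
    have E: "1 - \<epsilon>\<^sup>2 - (x $ 1)\<^sup>2 - (x $ 2)\<^sup>2 = 2 - (1 + \<epsilon>\<^sup>2) - sq x"
      by (simp add: sq_def)
    show ?thesis
      unfolding nav_metric_def vec_lambda_beta D E sq_def[symmetric] met_A_def met_C_def
      using nav_domain_sq_pos[OF x] by (simp add: add_divide_distrib power2_eq_square mult.assoc)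
  qed
  finally show ?thesis .
qed

lemma partial_deriv_sq:
  assumes "(f has_real_derivative f') (at (sq x))"
  shows "((\<lambda>t. f (sq (x + t *\<^sub>R axis l 1))) has_real_derivative 2 * x $ l * f') (at 0)"
proof -
  have "((\<lambda>t. sq (x + t *\<^sub>R axis l 1)) has_real_derivative 2 * x $ l) (at 0)"
    unfolding sq_def using exhaust_2[of l] by (auto intro!: derivative_eq_intros)
  from DERIV_chain2[OF _ this, of f f'] assms show ?thesis
    by (simp add: mult.commute)
qed

lemma partial_deriv_nth:
  "((\<lambda>t. (x + t *\<^sub>R axis l 1) $ i) has_real_derivative kron i l) (at 0)" for x :: "real ^ 2"
  by (auto intro!: derivative_eq_intros simp: axis_def)

lemma partial_deriv_metric:
  assumes x: "x \<in> nav_domain \<epsilon>"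
    and A: "(met_A (1 + \<epsilon>\<^sup>2) has_real_derivative A') (at (sq x))"
    and C: "(met_C (1 + \<epsilon>\<^sup>2) has_real_derivative C') (at (sq x))"
  shows "partial_deriv l (\<lambda>z. metric_coeff (randers_alpha \<epsilon>) z $ i $ j) x
    = 2 * x $ l * A' * kron i j + 2 * x $ l * C' * (x $ i * x $ j)
      + met_C (1 + \<epsilon>\<^sup>2) (sq x) * (kron i l * x $ j + kron j l * x $ i)"
proof -
  have "partial_deriv l (\<lambda>z. metric_coeff (randers_alpha \<epsilon>) z $ i $ j) x
    = partial_deriv l (\<lambda>x. met_A (1 + \<epsilon>\<^sup>2) (sq x) * kron i j + met_C (1 + \<epsilon>\<^sup>2) (sq x) * (x $ i * x $ j)) x"
    by (rule partial_deriv_cong[OF open_nav_domain x]) (rule metric_coeff_randers_alpha)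
  also have "\<dots> = 2 * x $ l * A' * kron i j + 2 * x $ l * C' * (x $ i * x $ j)
      + met_C (1 + \<epsilon>\<^sup>2) (sq x) * (kron i l * x $ j + kron j l * x $ i)"
    by (rule partial_deriv_eqI, rule DERIV_cong,
        (rule DERIV_add DERIV_mult DERIV_const partial_deriv_sq[OF A] partial_deriv_sq[OF C] partial_deriv_nth)+)
      (simp only: scaleR_zero_left add_0_right, simp add: algebra_simps)
  finally show ?thesis .
qed

text \<open>The inverse metric again has the form a \<delta> + m x x^T. With primes for derivatives
  in s this gives t = a A', p = (C - A') (a + m s) and q = C' (a + m s) + 2 m A'.\<close>

lemma christoffel_randers_alpha:
  assumes x: "x \<in> nav_domain \<epsilon>"
  defines "\<kappa> \<equiv> 1 + \<epsilon>\<^sup>2" and "s \<equiv> sq x"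
  shows "christoffel (randers_alpha \<epsilon>) k i j x
    = chr_t \<kappa> s * (x $ i * kron j k + x $ j * kron i k)
      + x $ k * (chr_p \<kappa> s * kron i j + chr_q \<kappa> s * (x $ i * x $ j))"
proof -
  define D where "D = 1 - s"
  define L where "L = 1 - \<kappa> * s"
  have pos: "D > 0" "L > 0"
    using nav_domain_sq_pos[OF x] by (simp_all add: D_def L_def \<kappa>_def s_def)
  define A where "A = met_A \<kappa> s"
  define C where "C = met_C \<kappa> s"
  define A' where "A' = (2 * \<kappa> - 1 - \<kappa> * s) / L ^ 3"
  define C' where "C' = ((2 - \<kappa> - s) * (L + 2 * \<kappa> * D) - D * L) / (D\<^sup>2 * L ^ 3)"
  have A: "(met_A \<kappa> has_real_derivative A') (at s)"
    unfolding met_A_def A'_def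
    by (rule derivative_eq_intros refl | use pos in \<open>simp add: D_def L_def; fail\<close>)+
      (use pos in \<open>simp add: L_def[symmetric] divide_simps power2_eq_square power3_eq_cube\<close>,
       simp add: L_def algebra_simps)
  have C: "(met_C \<kappa> has_real_derivative C') (at s)"
    unfolding met_C_def C'_def
    by (rule derivative_eq_intros refl | use pos in \<open>simp add: D_def L_def; fail\<close>)+
      (use pos in \<open>simp add: L_def[symmetric] D_def[symmetric] divide_simps power2_eq_square power3_eq_cube\<close>,
       simp add: algebra_simps)
  \<comment> \<open>Coefficients of the inverse of A \<delta> + C x x^T: a = 1 / A, and m is fixed
    by A m + C (a + m s) = 0. The factor a + m s, the eigenvalue of the inverse on x, simplifies to
    D L.\<close>
  define a where "a = L\<^sup>2 / D"
  define m where "m = L * (\<kappa> - 2 + s) / D"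
  define t where "t = chr_t \<kappa> s"
  define p where "p = chr_p \<kappa> s"
  define q where "q = chr_q \<kappa> s"
  have s_eq: "s = x $ 1 * x $ 1 + x $ 2 * x $ 2"
    by (simp add: s_def sq_def power2_eq_square)
  have Aa: "A * a = 1"
    using pos by (simp add: A_def met_A_def a_def D_def L_def)
  have DL: "a + m * s = D * L"
  proof -
    have "L + (\<kappa> - 2 + s) * s = D * D"
      by (simp add: D_def L_def algebra_simps)
    then have "L * (L + (\<kappa> - 2 + s) * s) / D = L * (D * D) / D"
      by simp
    then show ?thesis
      using pos by (simp add: a_def m_def power2_eq_square add_divide_distrib distrib_left mult_ac)
  qed
  have C_eq: "C = (2 - \<kappa> - s) / (D * L\<^sup>2)"
    by (simp add: C_def met_C_def D_def L_def)
  have Cm: "A * m + C * (a + m * s) = 0"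
  proof -
    have "A * m = (\<kappa> - 2 + s) / L"
      using pos by (simp add: A_def met_A_def D_def[symmetric] L_def[symmetric] m_def power2_eq_square)
    moreover have "C * (D * L) = - ((\<kappa> - 2 + s) / L)"
      unfolding C_eq using pos by (simp add: power2_eq_square minus_divide_left)
    ultimately show ?thesis
      unfolding DL by simp
  qed
  have t_eq: "a * A' = t"
    unfolding a_def A'_def t_def chr_t_def D_def[symmetric] L_def[symmetric] using pos
    by (simp add: divide_simps power2_eq_square power3_eq_cube)
  have p_eq: "(C - A') * (a + m * s) = p"
  proof -
    have "(2 - \<kappa> - s) * L - (2 * \<kappa> - 1 - \<kappa> * s) * D = (\<kappa> - 1) * ((\<kappa> + 2) * s - 3)"
      by (simp add: D_def L_def algebra_simps power2_eq_square)
    then have "p = ((2 - \<kappa> - s) * L - (2 * \<kappa> - 1 - \<kappa> * s) * D) / L\<^sup>2"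
      by (simp add: p_def chr_p_def L_def)
    then show ?thesis
      unfolding DL C_eq A'_def using pos
      by (simp add: divide_simps power2_eq_square power3_eq_cube)
  qed
  have q_eq: "C' * (a + m * s) + 2 * m * A' = q"
  proof -
    have "(2 - \<kappa> - s) * (L + 2 * \<kappa> * D) - D * L + 2 * (\<kappa> - 2 + s) * (2 * \<kappa> - 1 - \<kappa> * s)
        = (\<kappa> - 1) * (2 * \<kappa> - 5 + (\<kappa> + 2) * s)"
      by (simp add: D_def L_def algebra_simps power2_eq_square)
    then have "q = ((2 - \<kappa> - s) * (L + 2 * \<kappa> * D) - D * L + 2 * (\<kappa> - 2 + s) * (2 * \<kappa> - 1 - \<kappa> * s)) / (D * L\<^sup>2)"
      by (simp add: q_def chr_q_def D_def L_def)
    moreover have "C' * (D * L) = ((2 - \<kappa> - s) * (L + 2 * \<kappa> * D) - D * L) / (D * L\<^sup>2)"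
      unfolding C'_def using pos by (simp add: divide_simps power2_eq_square power3_eq_cube)
    moreover have "2 * m * A' = 2 * (\<kappa> - 2 + s) * (2 * \<kappa> - 1 - \<kappa> * s) / (D * L\<^sup>2)"
      unfolding m_def A'_def using pos by (simp add: divide_simps power2_eq_square power3_eq_cube)
    ultimately show ?thesis
      unfolding DL by (simp only: add_divide_distrib)
  qed
  define I :: "real ^ 2 ^ 2" where "I = (\<chi> i j. a * kron i j + m * (x $ i * x $ j))"
  have coeff: "metric_coeff (randers_alpha \<epsilon>) x $ i $ j = A * kron i j + C * (x $ i * x $ j)" for i j
    unfolding metric_coeff_randers_alpha[OF x] A_def C_def \<kappa>_def s_def ..
  have "matrix_inv (metric_coeff (randers_alpha \<epsilon>) x) = I"
  proof (rule matrix_inv_unique_right)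
    have z: "A * m + C * a + C * m * (x $ 1 * x $ 1 + x $ 2 * x $ 2) = 0"
      using Cm by (simp add: s_eq algebra_simps)
    have "(metric_coeff (randers_alpha \<epsilon>) x ** I) $ i $ j = A * a * kron i j
        + (A * m + C * a + C * m * (x $ 1 * x $ 1 + x $ 2 * x $ 2)) * (x $ i * x $ j)"
      "(I ** metric_coeff (randers_alpha \<epsilon>) x) $ i $ j = A * a * kron i j
        + (A * m + C * a + C * m * (x $ 1 * x $ 1 + x $ 2 * x $ 2)) * (x $ i * x $ j)" for i j
      using exhaust_2[of i] exhaust_2[of j]
      by (auto simp: matrix_matrix_mult_def sum_2 coeff I_def algebra_simps)
    then show "metric_coeff (randers_alpha \<epsilon>) x ** I = mat 1" "I ** metric_coeff (randers_alpha \<epsilon>) x = mat 1"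
      by (simp_all add: vec_eq_iff mat_def Aa z)
  qed
  moreover have "partial_deriv l (\<lambda>z. metric_coeff (randers_alpha \<epsilon>) z $ i $ j) x
    = 2 * x $ l * A' * kron i j + 2 * x $ l * C' * (x $ i * x $ j) + C * (kron i l * x $ j + kron j l * x $ i)" for i j l
    using partial_deriv_metric[OF x A[unfolded \<kappa>_def s_def] C[unfolded \<kappa>_def s_def]]
    by (simp add: C_def \<kappa>_def s_def)
  ultimately have "christoffel (randers_alpha \<epsilon>) k i j x
      = a * A' * (x $ i * kron j k + x $ j * kron i k)
        + x $ k * ((C - A') * (a + m * s) * kron i j + (C' * (a + m * s) + 2 * m * A') * (x $ i * x $ j))"
    unfolding christoffel_def sum_2 s_eq I_def vec_lambda_beta
    using exhaust_2[of i] exhaust_2[of j] exhaust_2[of k] by (auto simp: algebra_simps)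
  then show ?thesis
    unfolding t_eq p_eq q_eq t_def p_def q_def .
qed

text \<open>The Gauss curvature of \<alpha> as a function of s = |x|^2, with \<kappa> = 1 +
  \<epsilon>^2. For \<kappa> = 1 and s < 1 it collapses to -1.\<close>

definition alpha_curvature :: "real \<Rightarrow> real \<Rightarrow> real" where
  "alpha_curvature \<kappa> s = - ((5 * \<kappa> - 4 + \<kappa> * (\<kappa> - 2) * s) / (1 - \<kappa> * s))"

text \<open>In dimension two R(e1, e2) e2 must equal K (a_22 e1 - a_12 e2). With a = A \<delta> + C
  x x^T this amounts to two scalar equations in s, one for K A and one for K C; each is cleared of D
  and L and checked as a polynomial identity.\<close>

lemma gauss_curvature_randers_alpha:
  assumes x: "x \<in> nav_domain \<epsilon>"
  shows "gauss_curvature (randers_alpha \<epsilon>) x = alpha_curvature (1 + \<epsilon>\<^sup>2) (sq x)"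
proof -
  define \<kappa> where "\<kappa> = 1 + \<epsilon>\<^sup>2"
  define s where "s = sq x"
  define D where "D = 1 - s"
  define L where "L = 1 - \<kappa> * s"
  have pos: "D > 0" "L > 0"
    using nav_domain_sq_pos[OF x] by (simp_all add: D_def L_def \<kappa>_def s_def)
  define A where "A = met_A \<kappa> s"
  define C where "C = met_C \<kappa> s"
  define t where "t = chr_t \<kappa> s"
  define p where "p = chr_p \<kappa> s"
  define q where "q = chr_q \<kappa> s"
  define K where "K = alpha_curvature \<kappa> s"
  define t' where "t' = ((2 * \<kappa> - 1 - \<kappa> * s) * (L + \<kappa> * D) - \<kappa> * D * L) / (D\<^sup>2 * L\<^sup>2)"
  define p' where "p' = (\<kappa> - 1) * ((\<kappa> + 2) * L + 2 * \<kappa> * ((\<kappa> + 2) * s - 3)) / L ^ 3"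
  have t': "(chr_t \<kappa> has_real_derivative t') (at s)"
    unfolding chr_t_def t'_def
    by (rule derivative_eq_intros refl | use pos in \<open>simp add: D_def L_def; fail\<close>)+
      (use pos in \<open>simp add: L_def[symmetric] D_def[symmetric] divide_simps power2_eq_square power3_eq_cube\<close>,
       simp add: algebra_simps)
  have p': "(chr_p \<kappa> has_real_derivative p') (at s)"
    unfolding chr_p_def p'_def
    by (rule derivative_eq_intros refl | use pos in \<open>simp add: D_def L_def; fail\<close>)+
      (use pos in \<open>simp add: L_def[symmetric] D_def[symmetric] divide_simps power2_eq_square power3_eq_cube\<close>,
       simp add: algebra_simps)
  \<comment> \<open>Existence is enough: the term with q' is x_k x_l x_i x_j, totally symmetric, and
    cancels when the two derivatives of the Christoffel symbols are subtracted.\<close>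
  obtain q' where q': "(chr_q \<kappa> has_real_derivative q') (at s)"
  proof -
    have "\<exists>q'. (chr_q \<kappa> has_real_derivative q') (at s)"
      unfolding chr_q_def
      by (rule exI, (rule derivative_eq_intros refl | use pos in \<open>simp add: D_def L_def; fail\<close>)+)
    then show thesis
      using that by blast
  qed
  have \<Gamma>: "christoffel (randers_alpha \<epsilon>) k i j x
      = t * (x $ i * kron j k + x $ j * kron i k) + x $ k * (p * kron i j + q * (x $ i * x $ j))" for k i j
    unfolding christoffel_randers_alpha[OF x] t_def p_def q_def \<kappa>_def s_def ..
  have d\<Gamma>: "partial_deriv l (christoffel (randers_alpha \<epsilon>) k i j) x
      = 2 * x $ l * t' * (x $ i * kron j k + x $ j * kron i k) + t * (kron i l * kron j k + kron j l * kron i k)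
        + kron k l * (p * kron i j + q * (x $ i * x $ j))
        + x $ k * (2 * x $ l * p' * kron i j + 2 * x $ l * q' * (x $ i * x $ j)
          + q * (kron i l * x $ j + kron j l * x $ i))" for l k i j
  proof -
    have "partial_deriv l (christoffel (randers_alpha \<epsilon>) k i j) x
      = partial_deriv l (\<lambda>x. chr_t \<kappa> (sq x) * (x $ i * kron j k + x $ j * kron i k)
        + x $ k * (chr_p \<kappa> (sq x) * kron i j + chr_q \<kappa> (sq x) * (x $ i * x $ j))) x"
      unfolding \<kappa>_def
      by (rule partial_deriv_cong[OF open_nav_domain x]) (rule christoffel_randers_alpha)
    also have "\<dots> = 2 * x $ l * t' * (x $ i * kron j k + x $ j * kron i k) + t * (kron i l * kron j k + kron j l * kron i k)
        + kron k l * (p * kron i j + q * (x $ i * x $ j))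
        + x $ k * (2 * x $ l * p' * kron i j + 2 * x $ l * q' * (x $ i * x $ j)
          + q * (kron i l * x $ j + kron j l * x $ i))"
      by (rule partial_deriv_eqI, rule DERIV_cong,
          (rule DERIV_add DERIV_mult DERIV_const partial_deriv_sq[OF t'[unfolded s_def]]
            partial_deriv_sq[OF p'[unfolded s_def]] partial_deriv_sq[OF q'[unfolded s_def]] partial_deriv_nth)+)
        (simp only: scaleR_zero_left add_0_right, simp add: t_def p_def q_def s_def algebra_simps)
    finally show ?thesis .
  qed
  have s_eq: "s = x $ 1 * x $ 1 + x $ 2 * x $ 2"
    by (simp add: s_def sq_def power2_eq_square)
  define T where "T = 2 * \<kappa> - 1 - \<kappa> * s"
  define P where "P = (\<kappa> - 1) * ((\<kappa> + 2) * s - 3)"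
  define Q where "Q = (\<kappa> - 1) * (2 * \<kappa> - 5 + (\<kappa> + 2) * s)"
  define P1 where "P1 = (\<kappa> - 1) * ((\<kappa> + 2) * L + 2 * \<kappa> * ((\<kappa> + 2) * s - 3))"
  define T1 where "T1 = T * (L + \<kappa> * D) - \<kappa> * D * L"
  define k where "k = 5 * \<kappa> - 4 + \<kappa> * (\<kappa> - 2) * s"
  define W where "W = 2 - \<kappa> - \<kappa> * s"
  define u where "u = 2 - \<kappa> - s"
  note letters = T_def P_def Q_def P1_def T1_def k_def W_def u_def D_def L_def
  have fracs: "t = T / (D * L)" "p = P / L\<^sup>2" "q = Q / (D * L\<^sup>2)" "p' = P1 / L ^ 3" "t' = T1 / (D\<^sup>2 * L\<^sup>2)"
    "K = - (k / L)" "A = D / L\<^sup>2" "C = u / (D * L\<^sup>2)"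
    by (simp_all add: t_def chr_t_def p_def chr_p_def q_def chr_q_def p'_def t'_def K_def alpha_curvature_def
        A_def met_A_def C_def met_C_def letters)
  have tpq: "t + p + q * s = W / (D * L)"
  proof -
    have "T * L + P * D + Q * s = W * L"
      by (simp add: letters algebra_simps power2_eq_square)
    then have "(T * L + P * D + Q * s) / (D * L\<^sup>2) = W * L / (D * L\<^sup>2)"
      by simp
    moreover have "t + p + q * s = (T * L + P * D + Q * s) / (D * L\<^sup>2)"
      unfolding fracs using pos by (simp add: add_divide_distrib power2_eq_square)
    ultimately show ?thesis
      using pos by (simp add: power2_eq_square)
  qed
  have KA: "K * A = p - t + s * (2 * p' - q) + p * s * (t + p + q * s)"
  proof -
    have "P * D * L - T * L\<^sup>2 + (2 * s * P1 * D - Q * s * L) + P * s * W = - k * D\<^sup>2"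
      by (simp add: letters algebra_simps power2_eq_square)
    then have "(P * D * L - T * L\<^sup>2 + (2 * s * P1 * D - Q * s * L) + P * s * W) / (D * L ^ 3) = - k * D\<^sup>2 / (D * L ^ 3)"
      by simp
    moreover have "p - t + s * (2 * p' - q) + p * s * (t + p + q * s)
        = (P * D * L - T * L\<^sup>2 + (2 * s * P1 * D - Q * s * L) + P * s * W) / (D * L ^ 3)"
      unfolding tpq unfolding fracs using pos
      by (simp add: add_divide_distrib diff_divide_distrib right_diff_distrib power2_eq_square power3_eq_cube mult_ac)
    ultimately show ?thesis
      unfolding fracs using pos by (simp add: power2_eq_square power3_eq_cube)
  qed
  have KC: "K * C = 2 * q - 2 * t' - 2 * p' + (t - p) * (t + p + q * s)"
  proof -
    have "2 * Q * D * L - 2 * T1 * L - 2 * P1 * D\<^sup>2 + (T * L - P * D) * W = - k * u * D"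
      by (simp add: letters algebra_simps power2_eq_square)
    then have "(2 * Q * D * L - 2 * T1 * L - 2 * P1 * D\<^sup>2 + (T * L - P * D) * W) / (D\<^sup>2 * L ^ 3) = - k * u * D / (D\<^sup>2 * L ^ 3)"
      by simp
    moreover have "2 * q - 2 * t' - 2 * p' + (t - p) * (t + p + q * s)
        = (2 * Q * D * L - 2 * T1 * L - 2 * P1 * D\<^sup>2 + (T * L - P * D) * W) / (D\<^sup>2 * L ^ 3)"
      unfolding tpq unfolding fracs using pos
      by (simp add: add_divide_distrib diff_divide_distrib left_diff_distrib right_diff_distrib power2_eq_square power3_eq_cube mult_ac)
    ultimately show ?thesis
      unfolding fracs using pos by (simp add: power2_eq_square power3_eq_cube)
  qed
  define R where "R = (\<lambda>m. partial_deriv 1 (christoffel (randers_alpha \<epsilon>) m 2 2) x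
      - partial_deriv 2 (christoffel (randers_alpha \<epsilon>) m 1 2) x
      + (\<Sum>l\<in>UNIV. christoffel (randers_alpha \<epsilon>) l 2 2 x * christoffel (randers_alpha \<epsilon>) m 1 l x
                  - christoffel (randers_alpha \<epsilon>) l 1 2 x * christoffel (randers_alpha \<epsilon>) m 2 l x))"
  \<comment> \<open>The components K a_22 and - K a_12; contracting them with the first column of
    the metric gives K det a.\<close>
  have R1: "R 1 = K * A + K * C * (x $ 2 * x $ 2)"
    unfolding KA KC R_def \<Gamma> d\<Gamma> sum_2 s_eq by (simp add: algebra_simps)
  have R2: "R 2 = - (K * C * (x $ 1 * x $ 2))"
    unfolding KC R_def \<Gamma> d\<Gamma> sum_2 s_eq by (simp add: algebra_simps)
  have coeff: "metric_coeff (randers_alpha \<epsilon>) x $ i $ j = A * kron i j + C * (x $ i * x $ j)" for i j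
    unfolding metric_coeff_randers_alpha[OF x] A_def C_def \<kappa>_def s_def ..
  have "gauss_curvature (randers_alpha \<epsilon>) x = (\<Sum>m\<in>UNIV. metric_coeff (randers_alpha \<epsilon>) x $ m $ 1 * R m)
      / det (metric_coeff (randers_alpha \<epsilon>) x)"
    by (simp add: gauss_curvature_def R_def)
  also have "(\<Sum>m\<in>UNIV. metric_coeff (randers_alpha \<epsilon>) x $ m $ 1 * R m) = K * det (metric_coeff (randers_alpha \<epsilon>) x)"
    by (simp add: sum_2 det_2 coeff R1 R2 algebra_simps)
  finally have "gauss_curvature (randers_alpha \<epsilon>) x
      = K * det (metric_coeff (randers_alpha \<epsilon>) x) / det (metric_coeff (randers_alpha \<epsilon>) x)" .
  moreover have "det (metric_coeff (randers_alpha \<epsilon>) x) \<noteq> 0"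
  proof -
    have "det (metric_coeff (randers_alpha \<epsilon>) x) = A * (A + C * s)"
      by (simp add: det_2 coeff s_eq algebra_simps)
    also have "A + C * s = 1 / (D * L)"
    proof -
      have "D\<^sup>2 + u * s = L"
        by (simp add: letters algebra_simps power2_eq_square)
      then have "(D\<^sup>2 + u * s) / (D * L\<^sup>2) = L / (D * L\<^sup>2)"
        by simp
      then show ?thesis
        unfolding fracs using pos by (simp add: add_divide_distrib power2_eq_square)
    qed
    also have "A * \<dots> \<noteq> 0"
      using pos by (simp add: A_def met_A_def D_def L_def)
    finally show ?thesis .
  qed
  ultimately show ?thesis
    by (simp add: K_def \<kappa>_def s_def)
qed

lemma gauss_curvature_not_constant:
  assumes "\<epsilon> \<noteq> 0"
  shows "\<not> gauss_curvature (randers_alpha \<epsilon>) constant_on nav_domain \<epsilon>"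
proof
  define \<kappa> where "\<kappa> = 1 + \<epsilon>\<^sup>2"
  have \<kappa>: "\<kappa> > 1"
    using assms by (simp add: \<kappa>_def)
  assume "gauss_curvature (randers_alpha \<epsilon>) constant_on nav_domain \<epsilon>"
  then obtain c where c: "\<And>x. x \<in> nav_domain \<epsilon> \<Longrightarrow> gauss_curvature (randers_alpha \<epsilon>) x = c"
    by (auto simp: constant_on_def)
  \<comment> \<open>Chosen so that \<kappa> s = 1/2, well inside the domain. The curvature there is
    - (11 \<kappa> - 10), against - (5 \<kappa> - 4) at the origin.\<close>
  define s where "s = 1 / (2 * \<kappa>)"
  define x :: "real ^ 2" where "x = axis 1 (sqrt s)"
  have "sq x = s"
    using \<kappa> by (simp add: x_def sq_def s_def)
  then have "x \<in> nav_domain \<epsilon>" "0 \<in> nav_domain \<epsilon>"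
    using \<kappa> by (simp_all add: nav_domain_sq \<kappa>_def[symmetric] s_def) (simp add: sq_def)
  then have "alpha_curvature \<kappa> s = alpha_curvature \<kappa> 0"
    using c gauss_curvature_randers_alpha \<open>sq x = s\<close> by (metis \<kappa>_def sq_def zero_index power_zero_numeral add.right_neutral)
  then have "6 * (\<kappa> - 1) = 0"
    using \<kappa> by (simp add: alpha_curvature_def s_def field_simps)
  then show False
    using \<kappa> by simp
qed

lemma gauss_curvature_klein:
  "x \<in> nav_domain 0 \<Longrightarrow> gauss_curvature (randers_alpha 0) x = - 1"
  using nav_domain_sq_pos(2)[of x 0] by (simp add: gauss_curvature_randers_alpha alpha_curvature_def)

theorem theorem1p2:
  fixes \<epsilon> \<rho> :: real and \<alpha> \<beta> F :: "real ^ 2 \<Rightarrow> real ^ 2 \<Rightarrow> real"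
  assumes "\<rho> = 1 / sqrt (1 + \<epsilon>\<^sup>2)"
    and "\<alpha> = randers_alpha \<epsilon>"
    and "\<beta> = randers_beta \<epsilon>"
    and "F = (\<lambda>p y. \<alpha> p y + \<beta> p y)"
  shows "randers_metric_on (ball 0 \<rho>) \<alpha> \<beta>
    \<and> has_constant_curvature_on (ball 0 \<rho>) F (- 1)
    \<and> (\<forall>p\<in>ball 0 \<rho>. \<forall>y. y \<noteq> 0 \<longrightarrow> s_curvature F p y = 0)
    \<and> (\<epsilon> \<noteq> 0 \<longrightarrow> \<not> locally_projectively_flat_on (ball 0 \<rho>) F)
    \<and> (\<epsilon> \<noteq> 0 \<longrightarrow> \<not> gauss_curvature \<alpha> constant_on ball 0 \<rho>)
    \<and> (\<epsilon> = 0 \<longrightarrow> (\<forall>p\<in>ball 0 \<rho>. gauss_curvature \<alpha> p = - 1))"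
proof -
  have F: "F = (\<lambda>x y. randers_F \<epsilon> (x, y))"
    by (simp add: assms randers_F_def)
  show ?thesis
    unfolding F ball_eq_nav_domain[OF assms(1)] assms(2,3)
    using randers_metric randers_constant_curvature randers_s_curvature
      randers_not_locally_projectively_flat gauss_curvature_not_constant gauss_curvature_klein
    by blast
qed

end
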